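(* Let $\mathcal U$, $\mathcal U'$ be Hopf algebroids over $k$, let $C$ be a cocommutative $k$-coalgebra and let $(\Psi,\psi):C\longrightarrow V(\mathcal U,\mathcal U')$ be a measuring of Hopf algebroids. For each $x\in C$, the family of maps $$\underline\Psi_n(x):C_n(\mathcal U)\longrightarrow C_n(\mathcal U'),\qquad u^1\otimes\dots\otimes u^n\mapsto x_{(1)}(u^1)\otimes\dots\otimes x_{(n)}(u^n)\qquad(n\ge0)$$ gives a morphism of cyclic modules $C_\bullet(\mathcal U)\to C_\bullet(\mathcal U')$. In particular, for each $x\in C$ there are induced morphisms on Hochschild and cyclic homologies $$\underline\Psi_\bullet^{hoc}(x):HH_\bullet(\mathcal U)\longrightarrow HH_\bullet(\mathcal U'),\qquad \underline\Psi_\bullet^{cy}(x):HC_\bullet(\mathcal U)\longrightarrow HC_\bullet(\mathcal U').$$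
   Context: $k$ is a field; $Vect_k(V,W)$ denotes the space of $k$-linear maps. Sweedler notation is used with summation suppressed. Left bialgebroid $(U,A_L,s_L,t_L,\Delta_L,\epsilon_L)$ over $k$ (write $A=A_L$): unital $k$-algebras $U,A$; $k$-algebra morphisms $s_L:A\to U$, $t_L:A^{op}\to U$ with commuting images; $U$ is an $(A,A)$-bimodule via $a\cdot u\cdot b=s_L(a)t_L(b)u$ and $U\otimes_{A_L}U$ is formed with this structure (so $t_L(a)u\otimes v=u\otimes s_L(a)v$); $(U,\Delta_L:U\to U\otimes_{A_L}U,\epsilon_L:U\to A_L)$ is a coalgebra in $(A,A)$-bimodules such that $\Delta_L$ takes values in $U\times_{A_L}U:=\{\sum u_i\otimes u_i' : \sum u_it_L(a)\otimes u'_i=\sum u_i\otimes u_i's_L(a)\ \forall a\in A\}$ (an algebra under factorwise multiplication), $\Delta_L:U\to U\times_{A_L}U$ is a unital algebra morphism, and $\epsilon_L(us_L(\epsilon_L(u')))=\epsilon_L(uu')=\epsilon_L(ut_L(\epsilon_L(u')))$. Hopf algebroid $\mathcal U=(U,A_L,s_L,t_L,\Delta_L,\epsilon_L,S)$: a left bialgebroid with an involutive ($S^2=\mathrm{id}$) anti-automorphism $S$ of the $k$-algebra $U$ with $S\circ t_L=s_L$ and, in $U\otimes_{A_L}U$ for all $u\in U$, $S(u_{(1)})_{(1)}u_{(2)}\otimes S(u_{(1)})_{(2)}=1_U\otimes S(u)$ and $S(u_{(2)})_{(1)}\otimes S(u_{(2)})_{(2)}u_{(1)}=S(u)\otimes 1_U$.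 Measuring of algebras: for $k$-algebras $R,R'$ and a $k$-coalgebra $C$ with counit $\epsilon_C$, a linear map $\psi:C\to Vect_k(R,R')$ with $\psi(x)(ab)=\psi(x_{(1)})(a)\psi(x_{(2)})(b)$ and $\psi(x)(1_R)=\epsilon_C(x)1_{R'}$. One writes $x(a)$ for $\psi(x)(a)$. Measuring of Hopf algebroids from $\mathcal U$ to $\mathcal U'$ by a cocommutative $k$-coalgebra $C$: a pair of algebra measurings $\Psi:C\to Vect_k(U,U')$, $\psi:C\to Vect_k(A_L,A'_L)$ such that for all $x\in C$: $\Psi(x)s_L=s_L'\psi(x)$, $\Psi(x)t_L=t'_L\psi(x)$, $\Psi(x)S=S'\Psi(x)$, $\psi(x)\epsilon_L=\epsilon_L'\Psi(x)$, and $\Delta'_L(\Psi(x)(u))=\Psi(x_{(1)})(u_{(1)})\otimes\Psi(x_{(2)})(u_{(2)})$ in $U'\otimes_{A'_L}U'$ for all $u\in U$. The map $(\Psi,\psi)$ takes values in $V(\mathcal U,\mathcal U'):=\{(F,f)\in Vect_k(U,U')\times Vect_k(A_L,A_L'): Fs_L=s_L'f,\ Ft_L=t_L'f,\ FS=S'F,\ f\epsilon_L=\epsilon_L'F\}$. Cyclic module $C_\bullet(\mathcal U)$: put $A_R=A_L^{op}$, $s_R=t_L$, $\epsilon_R=\epsilon_L\circ S:U\to A_R$. View $U$ as an $(A_R,A_R)$-bimodule by $a\cdot u\cdot b=s_R(a)us_R(b)$. $C_n(\mathcal U)=U\otimes_{A_R}\cdots\otimes_{A_R}U$ ($n$ factors),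 $C_0(\mathcal U)=A_R$. Faces: $d_0(u^1\otimes\dots\otimes u^n)=\epsilon_R(u^1)\cdot u^2\otimes\dots\otimes u^n$; $d_i(u^1\otimes\dots\otimes u^n)=u^1\otimes\dots\otimes u^iu^{i+1}\otimes\dots\otimes u^n$ for $1\le i\le n-1$; $d_n(u^1\otimes\dots\otimes u^n)=u^1\otimes\dots\otimes u^{n-1}\cdot\epsilon_R(S(u^n))$ (for $n=1$: $d_0=\epsilon_R$, $d_1=\epsilon_R\circ S$). Degeneracies: $s_i$ inserts $1$ after the $i$-th factor, $0\le i\le n$ (in degree $0$: $s_0(a)=t_L(a)$). Cyclic operator: $t_n(u^1\otimes\dots\otimes u^n)=S(u^1_{(2)}\cdots u^{n-1}_{(2)}u^n)\otimes u^1_{(1)}\otimes\dots\otimes u^{n-1}_{(1)}$, $t_0=\mathrm{id}$. $HH_\bullet(\mathcal U)$ and $HC_\bullet(\mathcal U)$ are the Hochschild and cyclic homologies of this cyclic module. In degree $0$, $\underline\Psi_0(x)=\psi(x)$. *)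

theory Defs
  imports Complex_Main "HOL-Library.Poly_Mapping" "HOL-Algebra.Module" "HOL-Algebra.AbelCoset"
begin

text \<open>
  The ground field is a type of class \<^class>\<open>field\<close>. The given algebras and coalgebras are whole
  types: the ring structure comes from the sort \<open>{ring, monoid_mult}\<close> (associative, unital,
  possibly zero, not necessarily commutative), the action of the field is an explicit scalar
  multiplication. The spaces built from them (tensor products, chains, homology) are quotients
  and are represented by HOL-Algebra records of type \<^typ>\<open>('k, 'm) module\<close> whose carriers consist
  of cosets; the fields \<open>mult\<close> and \<open>one\<close> of these records are not used.
\<close>

section \<open>Vector spaces, quotients and linear extension\<close>

definition k_linear :: "('k, 'm) module \<Rightarrow> ('k, 'n) module \<Rightarrow> ('m \<Rightarrow> 'n) \<Rightarrow> bool" where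
  "k_linear M N f \<longleftrightarrow>
     f \<in> carrier M \<rightarrow> carrier N \<and>
     (\<forall>x\<in>carrier M. \<forall>y\<in>carrier M. f (x \<oplus>\<^bsub>M\<^esub> y) = f x \<oplus>\<^bsub>N\<^esub> f y) \<and>
     (\<forall>c. \<forall>x\<in>carrier M. f (c \<odot>\<^bsub>M\<^esub> x) = c \<odot>\<^bsub>N\<^esub> f x)"

text \<open>The quotient \<open>Z / B\<close> of subspaces \<open>B \<subseteq> Z\<close> of \<open>M\<close>.\<close>

definition subquot :: "('k, 'm) module \<Rightarrow> 'm set \<Rightarrow> 'm set \<Rightarrow> ('k, 'm set) module" where
  "subquot M Z B =
     \<lparr>carrier = (\<lambda>z. B +>\<^bsub>M\<^esub> z) ` Z, mult = undefined, one = undefined,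
      zero = B, add = (\<lambda>X Y. X <+>\<^bsub>M\<^esub> Y),
      smult = (\<lambda>c X. \<Union>x\<in>X. B +>\<^bsub>M\<^esub> (c \<odot>\<^bsub>M\<^esub> x))\<rparr>"

text \<open>\<^typ>\<open>'g \<Rightarrow>\<^sub>0 'k\<close> is the vector space with basis \<open>'g\<close>.\<close>

definition fscale :: "'k::field \<Rightarrow> ('g \<Rightarrow>\<^sub>0 'k) \<Rightarrow> ('g \<Rightarrow>\<^sub>0 'k)" where
  "fscale c = Poly_Mapping.map ((*) c)"

lemma lookup_fscale: "Poly_Mapping.lookup (fscale c z) g = c * Poly_Mapping.lookup z g"
  by (auto simp add: fscale_def Poly_Mapping.map.rep_eq when_def)

interpretation formal: vector_space "fscale :: 'k::field \<Rightarrow> ('g \<Rightarrow>\<^sub>0 'k) \<Rightarrow> ('g \<Rightarrow>\<^sub>0 'k)"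
  by unfold_locales
    (auto intro!: poly_mapping_eqI simp: lookup_fscale lookup_add algebra_simps)

definition formal_module :: "('k::field, 'g \<Rightarrow>\<^sub>0 'k) module" where
  "formal_module =
     \<lparr>carrier = UNIV, mult = undefined, one = undefined, zero = 0, add = (+), smult = fscale\<rparr>"

definition lin_ext :: "('k \<Rightarrow> 'v \<Rightarrow> 'v) \<Rightarrow> ('g \<Rightarrow> 'v) \<Rightarrow> ('g \<Rightarrow>\<^sub>0 'k::field) \<Rightarrow> 'v::ab_group_add" where
  "lin_ext sc f z = (\<Sum>g\<in>Poly_Mapping.keys z. sc (Poly_Mapping.lookup z g) (f g))"

lemma lin_ext_superset:
  assumes "vector_space sc" "finite S" "Poly_Mapping.keys z \<subseteq> S"
  shows "lin_ext sc f z = (\<Sum>g\<in>S. sc (Poly_Mapping.lookup z g) (f g))"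
proof -
  interpret vector_space sc by fact
  show ?thesis unfolding lin_ext_def
    by (rule sum.mono_neutral_left) (use assms in \<open>auto simp: in_keys_iff\<close>)
qed

lemma lin_ext_add:
  assumes "vector_space sc"
  shows "lin_ext sc f (y + z) = lin_ext sc f y + lin_ext sc f z"
proof -
  interpret vector_space sc by fact
  let ?S = "Poly_Mapping.keys y \<union> Poly_Mapping.keys z"
  have "Poly_Mapping.keys (y + z) \<subseteq> ?S" by (rule Poly_Mapping.keys_add)
  then show ?thesis
    using lin_ext_superset[OF assms, of ?S]
    by (simp add: lookup_add scale_left_distrib sum.distrib)
qed

lemma lin_ext_fscale:
  assumes "vector_space sc"
  shows "lin_ext sc f (fscale c z) = sc c (lin_ext sc f z)"
proof -
  interpret vector_space sc by fact
  have "Poly_Mapping.keys (fscale c z) \<subseteq> Poly_Mapping.keys z"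
    by (auto simp: in_keys_iff lookup_fscale)
  then show ?thesis
    using lin_ext_superset[OF assms, of "Poly_Mapping.keys z"]
    by (simp add: lookup_fscale scale_sum_right)
qed

lemma lin_ext_single:
  assumes "vector_space sc"
  shows "lin_ext sc f (Poly_Mapping.single g c) = sc c (f g)"
proof -
  interpret vector_space sc by fact
  show ?thesis by (simp add: lin_ext_def)
qed

lemma coset_eq_iff:
  assumes "formal.subspace N"
  shows "N +>\<^bsub>formal_module\<^esub> y = N +>\<^bsub>formal_module\<^esub> z \<longleftrightarrow> y - z \<in> N"
proof -
  have c: "N +>\<^bsub>formal_module\<^esub> w = (\<lambda>v. v + w) ` N" for w
    by (auto simp: a_r_coset_def r_coset_def formal_module_def)
  show ?thesis
  proof
    assume "N +>\<^bsub>formal_module\<^esub> y = N +>\<^bsub>formal_module\<^esub> z"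
    moreover have "y \<in> (\<lambda>v. v + y) ` N"
      using formal.subspace_0[OF assms] by (auto simp: image_iff)
    ultimately show "y - z \<in> N" unfolding c by auto
  next
    assume a: "y - z \<in> N"
    have "(\<lambda>v. v + y) ` N \<subseteq> (\<lambda>v. v + z) ` N"
    proof
      fix w assume "w \<in> (\<lambda>v. v + y) ` N"
      then obtain v where "v \<in> N" "w = v + y" by auto
      then show "w \<in> (\<lambda>v. v + z) ` N"
        using formal.subspace_add[OF assms \<open>v \<in> N\<close> a] by (intro image_eqI[of _ _ "v + (y - z)"]) auto
    qed
    moreover have "(\<lambda>v. v + z) ` N \<subseteq> (\<lambda>v. v + y) ` N"
    proof
      fix w assume "w \<in> (\<lambda>v. v + z) ` N"
      then obtain v where "v \<in> N" "w = v + z" by auto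
      then show "w \<in> (\<lambda>v. v + y) ` N"
        using formal.subspace_diff[OF assms \<open>v \<in> N\<close> a] by (intro image_eqI[of _ _ "v - (y - z)"]) auto
    qed
    ultimately show "N +>\<^bsub>formal_module\<^esub> y = N +>\<^bsub>formal_module\<^esub> z" unfolding c by auto
  qed
qed

text \<open>
  The map into a quotient by \<open>N\<close> induced by the linear map of formal sums with values \<open>f g\<close>
  on the basis. It applies to a coset \<open>X\<close>; if the linear map respects the subspaces that are
  factored out, all members of the union coincide.
\<close>

definition descend ::
    "('h \<Rightarrow>\<^sub>0 'k) set \<Rightarrow> ('g \<Rightarrow> 'h \<Rightarrow>\<^sub>0 'k) \<Rightarrow> ('g \<Rightarrow>\<^sub>0 'k) set \<Rightarrow> ('h \<Rightarrow>\<^sub>0 'k::field) set" where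
  "descend N f X = (\<Union>z\<in>X. N +>\<^bsub>formal_module\<^esub> lin_ext fscale f z)"

section \<open>Tensor powers of a bimodule\<close>

text \<open>
  The \<open>n\<close>-fold tensor power \<open>U \<otimes>\<^sub>A \<dots> \<otimes>\<^sub>A U\<close> of an \<open>(A,A)\<close>-bimodule \<open>U\<close>, given by generators and
  relations. For \<open>n > 0\<close> the generators are the pure tensors, i.e. lists of length \<open>n\<close>. The
  power for \<open>n = 0\<close> is \<open>A\<close>, presented in the same style by the generators \<open>Scalar a\<close> and the
  relations making \<open>a \<mapsto> Scalar a\<close> linear. The bimodule structure enters through
  \<open>r a u = u \<cdot> a\<close> and \<open>l a u = a \<cdot> u\<close>.
\<close>

datatype ('a, 'u) tgen = Scalar 'a | Tensor "'u list"

type_synonym ('k, 'a, 'u) formal_tensor = "('a, 'u) tgen \<Rightarrow>\<^sub>0 'k"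

abbreviation scal :: "'a \<Rightarrow> ('k::field, 'a, 'u) formal_tensor" where
  "scal a \<equiv> Poly_Mapping.single (Scalar a) 1"

abbreviation tens :: "'u list \<Rightarrow> ('k::field, 'a, 'u) formal_tensor" where
  "tens us \<equiv> Poly_Mapping.single (Tensor us) 1"

definition tensor_gens :: "nat \<Rightarrow> ('a, 'u) tgen set" where
  "tensor_gens n = (if n = 0 then range Scalar else {Tensor us |us. length us = n})"

definition tensor_rels ::
    "('k::field \<Rightarrow> 'u \<Rightarrow> 'u) \<Rightarrow> ('k \<Rightarrow> 'a \<Rightarrow> 'a) \<Rightarrow> ('a \<Rightarrow> 'u \<Rightarrow> 'u) \<Rightarrow> ('a \<Rightarrow> 'u \<Rightarrow> 'u) \<Rightarrow> nat
      \<Rightarrow> ('k, 'a::ab_group_add, 'u::ab_group_add) formal_tensor set" where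
  "tensor_rels scU scA r l n = formal.span
     (if n = 0 then
        {scal (a + b) - scal a - scal b |a b. True} \<union>
        {scal (scA c a) - fscale c (scal a) |c a. True}
      else
        {tens (us @ [u + v] @ vs) - tens (us @ [u] @ vs) - tens (us @ [v] @ vs) |us u v vs.
           length us + 1 + length vs = n} \<union>
        {tens (us @ [scU c u] @ vs) - fscale c (tens (us @ [u] @ vs)) |us c u vs.
           length us + 1 + length vs = n} \<union>
        {tens (us @ [r a u, v] @ vs) - tens (us @ [u, l a v] @ vs) |us a u v vs.
           length us + 2 + length vs = n})"

definition tensor_power ::
    "('k::field \<Rightarrow> 'u \<Rightarrow> 'u) \<Rightarrow> ('k \<Rightarrow> 'a \<Rightarrow> 'a) \<Rightarrow> ('a \<Rightarrow> 'u \<Rightarrow> 'u) \<Rightarrow> ('a \<Rightarrow> 'u \<Rightarrow> 'u) \<Rightarrow> nat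
      \<Rightarrow> ('k, ('k, 'a::ab_group_add, 'u::ab_group_add) formal_tensor set) module" where
  "tensor_power scU scA r l n =
     subquot formal_module {z. Poly_Mapping.keys z \<subseteq> tensor_gens n} (tensor_rels scU scA r l n)"

definition tensor_class ::
    "('k::field \<Rightarrow> 'u \<Rightarrow> 'u) \<Rightarrow> ('k \<Rightarrow> 'a \<Rightarrow> 'a) \<Rightarrow> ('a \<Rightarrow> 'u \<Rightarrow> 'u) \<Rightarrow> ('a \<Rightarrow> 'u \<Rightarrow> 'u) \<Rightarrow> nat
      \<Rightarrow> ('k, 'a::ab_group_add, 'u::ab_group_add) formal_tensor
      \<Rightarrow> ('k, 'a, 'u) formal_tensor set" where
  "tensor_class scU scA r l n z = tensor_rels scU scA r l n +>\<^bsub>formal_module\<^esub> z"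

text \<open>The presented power for \<open>n = 0\<close> is indeed \<open>A\<close>.\<close>

lemma subspace_tensor_rels: "formal.subspace (tensor_rels scU scA r l n)"
  unfolding tensor_rels_def by (rule formal.subspace_span)

lemma tensor_power_0_bij:
  fixes scU :: "'k::field \<Rightarrow> 'u \<Rightarrow> 'u::ab_group_add" and scA :: "'k \<Rightarrow> 'a \<Rightarrow> 'a::ab_group_add"
    and r l :: "'a \<Rightarrow> 'u \<Rightarrow> 'u"
  assumes "vector_space scA"
  shows "bij_betw (\<lambda>a. tensor_class scU scA r l 0 (scal a)) UNIV
           (carrier (tensor_power scU scA r l 0))"
proof -
  interpret A: vector_space scA by fact
  let ?N = "tensor_rels scU scA r l 0"
  have st: "formal.subspace ?N" by (rule subspace_tensor_rels)
  define ev :: "('k, 'a, 'u) formal_tensor \<Rightarrow> 'a" where "ev = lin_ext scA (\<lambda>g. case g of Scalar a \<Rightarrow> a | Tensor us \<Rightarrow> 0)"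
  have ev_scal [simp]: "ev (scal a) = a" for a
    by (simp add: ev_def lin_ext_single[OF assms])
  have ev_add: "ev (y + z) = ev y + ev z" for y z
    unfolding ev_def by (rule lin_ext_add[OF assms])
  have ev_scale: "ev (fscale c z) = scA c (ev z)" for c z
    unfolding ev_def by (rule lin_ext_fscale[OF assms])
  have ev_diff: "ev (y - z) = ev y - ev z" for y z
    using ev_add[of "y - z" z] by (simp add: algebra_simps)
  have kernel: "formal.subspace {z. ev z = 0}"
    unfolding formal.subspace_def
    using ev_diff[of 0 0] by (auto simp: ev_add ev_scale)
  have ev_rels: "ev z = 0" if "z \<in> ?N" for z
  proof -
    have "?N \<subseteq> {z. ev z = 0}"
      unfolding tensor_rels_def
      by (rule formal.span_minimal[OF _ kernel]) (auto simp: ev_diff ev_scale)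
    then show ?thesis using that by auto
  qed
  have add_rel: "scal (a + b) - scal a - scal b \<in> ?N" for a b
    unfolding tensor_rels_def by (rule formal.span_base) auto
  have scale_rel: "scal (scA c a) - fscale c (scal a) \<in> ?N" for c a
    unfolding tensor_rels_def by (rule formal.span_base) auto
  have zero_rel: "scal 0 \<in> ?N"
    using scale_rel[of 0 0] by simp
  have reduce: "z - scal (ev z) \<in> ?N" if "Poly_Mapping.keys z \<subseteq> range Scalar" for z
  proof -
    have z: "(\<Sum>g\<in>Poly_Mapping.keys z. Poly_Mapping.single g (Poly_Mapping.lookup z g)) = z"
      by (rule poly_mapping_eqI)
        (auto simp: lookup_sum lookup_single when_def in_keys_iff)
    have "(\<Sum>g\<in>G. Poly_Mapping.single g (Poly_Mapping.lookup z g))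
            - scal (ev (\<Sum>g\<in>G. Poly_Mapping.single g (Poly_Mapping.lookup z g))) \<in> ?N"
      if "finite G" "G \<subseteq> range Scalar" for G
      using that
    proof (induction G)
      case empty
      have "ev 0 = 0" using ev_diff[of 0 0] by simp
      then show ?case
        using formal.subspace_neg[OF subspace_tensor_rels zero_rel] by simp
    next
      case (insert g G)
      then obtain a where g: "g = Scalar a" by auto
      let ?c = "Poly_Mapping.lookup z g"
      let ?s = "\<Sum>g\<in>G. Poly_Mapping.single g (Poly_Mapping.lookup z g)"
      have sg: "Poly_Mapping.single g ?c = fscale ?c (scal a)"
        by (rule poly_mapping_eqI) (auto simp: g lookup_fscale lookup_single when_def)
      have "fscale ?c (scal a) + ?s - scal (scA ?c a + ev ?s) =
          - (scal (scA ?c a) - fscale ?c (scal a)) + (?s - scal (ev ?s))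
          - (scal (scA ?c a + ev ?s) - scal (scA ?c a) - scal (ev ?s))"
        by (simp add: algebra_simps)
      also have "\<dots> \<in> ?N"
        using insert
        by (intro formal.subspace_diff[OF st formal.subspace_add[OF st formal.subspace_neg[OF st
              scale_rel]] add_rel]) simp
      finally show ?case
        using insert(1,2) by (simp add: sg ev_add ev_scale)
    qed
    from this[of "Poly_Mapping.keys z"] that show ?thesis by (simp add: z)
  qed
  show ?thesis
    unfolding bij_betw_def
  proof
    show "inj (\<lambda>a. tensor_class scU scA r l 0 (scal a))"
    proof (rule injI)
      fix a b
      assume "tensor_class scU scA r l 0 (scal a) = tensor_class scU scA r l 0 (scal b)"
      then have "scal a - scal b \<in> ?N"
        unfolding tensor_class_def using coset_eq_iff[OF subspace_tensor_rels] by blast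
      from ev_rels[OF this] show "a = b" by (simp add: ev_diff)
    qed
    have "\<exists>a. ?N +>\<^bsub>formal_module\<^esub> z = tensor_class scU scA r l 0 (scal a)"
      if "Poly_Mapping.keys z \<subseteq> range Scalar" for z
      unfolding tensor_class_def using reduce[OF that] coset_eq_iff[OF subspace_tensor_rels] by blast
    then show "range (\<lambda>a. tensor_class scU scA r l 0 (scal a)) = carrier (tensor_power scU scA r l 0)"
      by (force simp: tensor_power_def subquot_def tensor_gens_def tensor_class_def image_iff)
  qed
qed

text \<open>
  Sweedler notation: \<open>representative X\<close> is a formal sum of lists \<open>[u\<^sub>(\<^sub>1\<^sub>), u\<^sub>(\<^sub>2\<^sub>)]\<close> in the class \<open>X = \<Delta> u\<close>, and
  \<open>sweedler sc f z\<close> is the sum of all \<open>f u\<^sub>(\<^sub>1\<^sub>) u\<^sub>(\<^sub>2\<^sub>)\<close> over that formal sum. All uses below are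
  independent of the choice of the representative.
\<close>

definition representative :: "'v set \<Rightarrow> 'v" where
  "representative X = (SOME z. z \<in> X)"

definition sweedler ::
    "('k \<Rightarrow> 'v \<Rightarrow> 'v) \<Rightarrow> ('u \<Rightarrow> 'u \<Rightarrow> 'v) \<Rightarrow> ('k::field, 'a, 'u) formal_tensor \<Rightarrow> 'v::ab_group_add" where
  "sweedler sc f = lin_ext sc (\<lambda>g. case g of Tensor [p, q] \<Rightarrow> f p q | _ \<Rightarrow> 0)"

section \<open>Coalgebras over the field\<close>

record (overloaded) ('k, 'c) coalgebra =
  scC :: "'k::field \<Rightarrow> 'c \<Rightarrow> 'c"
  DeltaC :: "'c \<Rightarrow> ('k, 'k, 'c) formal_tensor set"
  epsC :: "'c \<Rightarrow> 'k"

definition tensC ::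
    "('k::field, 'c::ab_group_add) coalgebra \<Rightarrow> nat \<Rightarrow> ('k, ('k, 'k, 'c) formal_tensor set) module" where
  "tensC C = tensor_power (scC C) (*) (scC C) (scC C)"

definition classC ::
    "('k::field, 'c::ab_group_add) coalgebra \<Rightarrow> nat
      \<Rightarrow> ('k, 'k, 'c) formal_tensor \<Rightarrow> ('k, 'k, 'c) formal_tensor set" where
  "classC C = tensor_class (scC C) (*) (scC C) (scC C)"

definition deltaC :: "('k::field, 'c) coalgebra \<Rightarrow> 'c \<Rightarrow> ('k, 'k, 'c) formal_tensor" where
  "deltaC C x = representative (DeltaC C x)"

definition is_coalgebra :: "('k::field, 'c::ab_group_add) coalgebra \<Rightarrow> bool" where
  "is_coalgebra C \<longleftrightarrow>
     vector_space (scC C) \<and>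
     (\<forall>x. DeltaC C x \<in> carrier (tensC C 2)) \<and>
     (\<forall>x y. DeltaC C (x + y) = DeltaC C x \<oplus>\<^bsub>tensC C 2\<^esub> DeltaC C y) \<and>
     (\<forall>c x. DeltaC C (scC C c x) = c \<odot>\<^bsub>tensC C 2\<^esub> DeltaC C x) \<and>
     (\<forall>x y. epsC C (x + y) = epsC C x + epsC C y) \<and>
     (\<forall>c x. epsC C (scC C c x) = c * epsC C x) \<and>
     (\<forall>x. classC C 3 (sweedler fscale (\<lambda>y z.
              sweedler fscale (\<lambda>y1 y2. tens [y1, y2, z]) (deltaC C y)) (deltaC C x))
        = classC C 3 (sweedler fscale (\<lambda>y z.
              sweedler fscale (\<lambda>z1 z2. tens [y, z1, z2]) (deltaC C z)) (deltaC C x))) \<and>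
     (\<forall>x. sweedler (scC C) (\<lambda>y z. scC C (epsC C y) z) (deltaC C x) = x) \<and>
     (\<forall>x. sweedler (scC C) (\<lambda>y z. scC C (epsC C z) y) (deltaC C x) = x)"

definition cocommutative_coalgebra :: "('k::field, 'c::ab_group_add) coalgebra \<Rightarrow> bool" where
  "cocommutative_coalgebra C \<longleftrightarrow>
     is_coalgebra C \<and>
     (\<forall>x. DeltaC C x = classC C 2 (sweedler fscale (\<lambda>y z. tens [z, y]) (deltaC C x)))"

text \<open>
  \<open>iter_comult C n x\<close> represents \<open>x\<^sub>(\<^sub>1\<^sub>) \<otimes> \<dots> \<otimes> x\<^sub>(\<^sub>n\<^sub>+\<^sub>1\<^sub>)\<close> as a formal sum of lists of length \<open>n + 1\<close>.
\<close>

primrec iter_comult ::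
    "('k::field, 'c) coalgebra \<Rightarrow> nat \<Rightarrow> 'c \<Rightarrow> ('c list \<Rightarrow>\<^sub>0 'k)" where
  "iter_comult C 0 x = Poly_Mapping.single [x] 1"
| "iter_comult C (Suc n) x =
     sweedler fscale (\<lambda>y z.
       lin_ext fscale (\<lambda>zs. Poly_Mapping.single (y # zs) 1) (iter_comult C n z)) (deltaC C x)"

section \<open>Left bialgebroids and Hopf algebroids\<close>

definition k_algebra :: "('k::field \<Rightarrow> 'r \<Rightarrow> 'r::{ring, monoid_mult}) \<Rightarrow> bool" where
  "k_algebra sc \<longleftrightarrow>
     vector_space sc \<and>
     (\<forall>c u v. sc c (u * v) = sc c u * v \<and> sc c (u * v) = u * sc c v)"

record (overloaded) ('k, 'u, 'a) hopf_algebroid =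
  scU :: "'k::field \<Rightarrow> 'u \<Rightarrow> 'u"
  scA :: "'k \<Rightarrow> 'a \<Rightarrow> 'a"
  sL :: "'a \<Rightarrow> 'u"
  tL :: "'a \<Rightarrow> 'u"
  DeltaL :: "'u \<Rightarrow> ('k, 'a, 'u) formal_tensor set"
  epsL :: "'u \<Rightarrow> 'a"
  antipode :: "'u \<Rightarrow> 'u"

text \<open>
  Tensor powers over \<open>A\<^sub>L\<close>, for the bimodule structure \<open>a \<cdot> u \<cdot> b = s\<^sub>L(a) t\<^sub>L(b) u\<close>.
\<close>

definition tensL ::
    "('k::field, 'u::{ring, monoid_mult}, 'a::{ring, monoid_mult}) hopf_algebroid \<Rightarrow> nat
      \<Rightarrow> ('k, ('k, 'a, 'u) formal_tensor set) module" where
  "tensL H = tensor_power (scU H) (scA H) (\<lambda>a u. tL H a * u) (\<lambda>a u. sL H a * u)"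

definition classL ::
    "('k::field, 'u::{ring, monoid_mult}, 'a::{ring, monoid_mult}) hopf_algebroid \<Rightarrow> nat
      \<Rightarrow> ('k, 'a, 'u) formal_tensor \<Rightarrow> ('k, 'a, 'u) formal_tensor set" where
  "classL H = tensor_class (scU H) (scA H) (\<lambda>a u. tL H a * u) (\<lambda>a u. sL H a * u)"

definition deltaL :: "('k::field, 'u, 'a) hopf_algebroid \<Rightarrow> 'u \<Rightarrow> ('k, 'a, 'u) formal_tensor" where
  "deltaL H u = representative (DeltaL H u)"

text \<open>The conditions below do not involve the field \<^term>\<open>antipode\<close>.\<close>

definition left_bialgebroid ::
    "('k::field, 'u::{ring, monoid_mult}, 'a::{ring, monoid_mult}) hopf_algebroid \<Rightarrow> bool" where
  "left_bialgebroid H \<longleftrightarrow>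
     k_algebra (scU H) \<and> k_algebra (scA H) \<and>
     \<comment> \<open>source and target\<close>
     (\<forall>a b. sL H (a + b) = sL H a + sL H b) \<and> (\<forall>c a. sL H (scA H c a) = scU H c (sL H a)) \<and>
     (\<forall>a b. sL H (a * b) = sL H a * sL H b) \<and> sL H 1 = 1 \<and>
     (\<forall>a b. tL H (a + b) = tL H a + tL H b) \<and> (\<forall>c a. tL H (scA H c a) = scU H c (tL H a)) \<and>
     (\<forall>a b. tL H (a * b) = tL H b * tL H a) \<and> tL H 1 = 1 \<and>
     (\<forall>a b. sL H a * tL H b = tL H b * sL H a) \<and>
     \<comment> \<open>\<open>\<Delta>\<^sub>L\<close> and \<open>\<epsilon>\<^sub>L\<close> are linear maps of \<open>(A,A)\<close>-bimodules\<close>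
     (\<forall>u. DeltaL H u \<in> carrier (tensL H 2)) \<and>
     (\<forall>u v. DeltaL H (u + v) = DeltaL H u \<oplus>\<^bsub>tensL H 2\<^esub> DeltaL H v) \<and>
     (\<forall>c u. DeltaL H (scU H c u) = c \<odot>\<^bsub>tensL H 2\<^esub> DeltaL H u) \<and>
     (\<forall>a b u. DeltaL H (sL H a * tL H b * u)
        = classL H 2 (sweedler fscale (\<lambda>p q. tens [sL H a * p, tL H b * q]) (deltaL H u))) \<and>
     (\<forall>u v. epsL H (u + v) = epsL H u + epsL H v) \<and>
     (\<forall>c u. epsL H (scU H c u) = scA H c (epsL H u)) \<and>
     (\<forall>a b u. epsL H (sL H a * tL H b * u) = a * epsL H u * b) \<and>
     \<comment> \<open>coassociativity and counit\<close>
     (\<forall>u. classL H 3 (sweedler fscale (\<lambda>p q.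
              sweedler fscale (\<lambda>p1 p2. tens [p1, p2, q]) (deltaL H p)) (deltaL H u))
        = classL H 3 (sweedler fscale (\<lambda>p q.
              sweedler fscale (\<lambda>q1 q2. tens [p, q1, q2]) (deltaL H q)) (deltaL H u))) \<and>
     (\<forall>u. sweedler (scU H) (\<lambda>p q. sL H (epsL H p) * q) (deltaL H u) = u) \<and>
     (\<forall>u. sweedler (scU H) (\<lambda>p q. tL H (epsL H q) * p) (deltaL H u) = u) \<and>
     \<comment> \<open>\<open>\<Delta>\<^sub>L\<close> takes values in \<open>U \<times>\<^sub>A U\<close> and is a morphism of unital algebras\<close>
     (\<forall>a u. classL H 2 (sweedler fscale (\<lambda>p q. tens [p * tL H a, q]) (deltaL H u))
          = classL H 2 (sweedler fscale (\<lambda>p q. tens [p, q * sL H a]) (deltaL H u))) \<and>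
     (\<forall>u v. DeltaL H (u * v)
        = classL H 2 (sweedler fscale (\<lambda>p q.
              sweedler fscale (\<lambda>p' q'. tens [p * p', q * q']) (deltaL H v)) (deltaL H u))) \<and>
     DeltaL H 1 = classL H 2 (tens [1, 1]) \<and>
     (\<forall>u u'. epsL H (u * sL H (epsL H u')) = epsL H (u * u') \<and>
             epsL H (u * u') = epsL H (u * tL H (epsL H u')))"

definition is_hopf_algebroid ::
    "('k::field, 'u::{ring, monoid_mult}, 'a::{ring, monoid_mult}) hopf_algebroid \<Rightarrow> bool" where
  "is_hopf_algebroid H \<longleftrightarrow>
     left_bialgebroid H \<and>
     (\<forall>u v. antipode H (u + v) = antipode H u + antipode H v) \<and>
     (\<forall>c u. antipode H (scU H c u) = scU H c (antipode H u)) \<and>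
     (\<forall>u v. antipode H (u * v) = antipode H v * antipode H u) \<and>
     antipode H 1 = 1 \<and>
     (\<forall>u. antipode H (antipode H u) = u) \<and>
     (\<forall>a. antipode H (tL H a) = sL H a) \<and>
     (\<forall>u. classL H 2 (sweedler fscale (\<lambda>p q.
              sweedler fscale (\<lambda>v w. tens [v * q, w]) (deltaL H (antipode H p))) (deltaL H u))
        = classL H 2 (tens [1, antipode H u])) \<and>
     (\<forall>u. classL H 2 (sweedler fscale (\<lambda>p q.
              sweedler fscale (\<lambda>v w. tens [v, w * p]) (deltaL H (antipode H q))) (deltaL H u))
        = classL H 2 (tens [antipode H u, 1]))"

section \<open>Measurings\<close>

definition algebra_measuring ::
    "('k::field, 'c::ab_group_add) coalgebra
      \<Rightarrow> ('k \<Rightarrow> 'r \<Rightarrow> 'r::{ring, monoid_mult}) \<Rightarrow> ('k \<Rightarrow> 's \<Rightarrow> 's::{ring, monoid_mult})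
      \<Rightarrow> ('c \<Rightarrow> 'r \<Rightarrow> 's) \<Rightarrow> bool" where
  "algebra_measuring C scR scS \<psi> \<longleftrightarrow>
     (\<forall>x y a. \<psi> (x + y) a = \<psi> x a + \<psi> y a) \<and>
     (\<forall>c x a. \<psi> (scC C c x) a = scS c (\<psi> x a)) \<and>
     (\<forall>x a b. \<psi> x (a + b) = \<psi> x a + \<psi> x b) \<and>
     (\<forall>c x a. \<psi> x (scR c a) = scS c (\<psi> x a)) \<and>
     (\<forall>x a b. \<psi> x (a * b) = sweedler scS (\<lambda>y z. \<psi> y a * \<psi> z b) (deltaC C x)) \<and>
     (\<forall>x. \<psi> x 1 = scS (epsC C x) 1)"

definition hopf_algebroid_measuring ::
    "('k::field, 'c::ab_group_add) coalgebra
      \<Rightarrow> ('k, 'u::{ring, monoid_mult}, 'a::{ring, monoid_mult}) hopf_algebroid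
      \<Rightarrow> ('k, 'v::{ring, monoid_mult}, 'b::{ring, monoid_mult}) hopf_algebroid
      \<Rightarrow> ('c \<Rightarrow> 'u \<Rightarrow> 'v) \<Rightarrow> ('c \<Rightarrow> 'a \<Rightarrow> 'b) \<Rightarrow> bool" where
  "hopf_algebroid_measuring C H H' \<Psi> \<psi> \<longleftrightarrow>
     algebra_measuring C (scU H) (scU H') \<Psi> \<and>
     algebra_measuring C (scA H) (scA H') \<psi> \<and>
     (\<forall>x a. \<Psi> x (sL H a) = sL H' (\<psi> x a)) \<and>
     (\<forall>x a. \<Psi> x (tL H a) = tL H' (\<psi> x a)) \<and>
     (\<forall>x u. \<Psi> x (antipode H u) = antipode H' (\<Psi> x u)) \<and>
     (\<forall>x u. \<psi> x (epsL H u) = epsL H' (\<Psi> x u)) \<and>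
     (\<forall>x u. DeltaL H' (\<Psi> x u)
        = classL H' 2 (sweedler fscale (\<lambda>y z.
              sweedler fscale (\<lambda>p q. tens [\<Psi> y p, \<Psi> z q]) (deltaL H u)) (deltaC C x)))"

section \<open>Cyclic modules, Hochschild and cyclic homology\<close>

text \<open>
  The underlying data of a cyclic module. In degree \<open>n\<close> there are faces \<open>face X n i\<close> and
  degeneracies \<open>degen X n i\<close> for \<open>0 \<le> i \<le> n\<close>, and the (unsigned) cyclic operator \<open>cyc X n\<close>. The
  simplicial and cyclic identities are not needed to say what a morphism is, nor to write down
  the complexes.
\<close>

record ('k, 'm) cyclic_data =
  cobj :: "nat \<Rightarrow> ('k, 'm) module"
  face :: "nat \<Rightarrow> nat \<Rightarrow> 'm \<Rightarrow> 'm"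
  degen :: "nat \<Rightarrow> nat \<Rightarrow> 'm \<Rightarrow> 'm"
  cyc :: "nat \<Rightarrow> 'm \<Rightarrow> 'm"

definition cyclic_module_morphism ::
    "('k, 'm) cyclic_data \<Rightarrow> ('k, 'n) cyclic_data \<Rightarrow> (nat \<Rightarrow> 'm \<Rightarrow> 'n) \<Rightarrow> bool" where
  "cyclic_module_morphism X Y f \<longleftrightarrow>
     (\<forall>n. k_linear (cobj X n) (cobj Y n) (f n)) \<and>
     (\<forall>n i. \<forall>z\<in>carrier (cobj X n). 1 \<le> n \<and> i \<le> n \<longrightarrow>
        f (n - 1) (face X n i z) = face Y n i (f n z)) \<and>
     (\<forall>n i. \<forall>z\<in>carrier (cobj X n). i \<le> n \<longrightarrow>
        f (n + 1) (degen X n i z) = degen Y n i (f n z)) \<and>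
     (\<forall>n. \<forall>z\<in>carrier (cobj X n). f n (cyc X n z) = cyc Y n (f n z))"

text \<open>Homology of a complex \<open>\<dots> \<rightarrow> M 1 \<rightarrow> M 0 \<rightarrow> 0\<close> with differentials \<open>d n : M n \<rightarrow> M (n - 1)\<close>.\<close>

definition cycles :: "(nat \<Rightarrow> ('k, 'm) module) \<Rightarrow> (nat \<Rightarrow> 'm \<Rightarrow> 'm) \<Rightarrow> nat \<Rightarrow> 'm set" where
  "cycles M d n = {z \<in> carrier (M n). n = 0 \<or> d n z = \<zero>\<^bsub>M (n - 1)\<^esub>}"

definition boundaries :: "(nat \<Rightarrow> ('k, 'm) module) \<Rightarrow> (nat \<Rightarrow> 'm \<Rightarrow> 'm) \<Rightarrow> nat \<Rightarrow> 'm set" where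
  "boundaries M d n = d (n + 1) ` carrier (M (n + 1))"

definition homology ::
    "(nat \<Rightarrow> ('k, 'm) module) \<Rightarrow> (nat \<Rightarrow> 'm \<Rightarrow> 'm) \<Rightarrow> nat \<Rightarrow> ('k, 'm set) module" where
  "homology M d n = subquot (M n) (cycles M d n) (boundaries M d n)"

definition homology_class ::
    "(nat \<Rightarrow> ('k, 'm) module) \<Rightarrow> (nat \<Rightarrow> 'm \<Rightarrow> 'm) \<Rightarrow> nat \<Rightarrow> 'm \<Rightarrow> 'm set" where
  "homology_class M d n z = boundaries M d n +>\<^bsub>M n\<^esub> z"

definition hoch_b :: "('k::field, 'm) cyclic_data \<Rightarrow> nat \<Rightarrow> 'm \<Rightarrow> 'm" where
  "hoch_b X n z =
     (\<Oplus>\<^bsub>cobj X (n - 1)\<^esub>i\<in>{..n}. (- 1) ^ i \<odot>\<^bsub>cobj X (n - 1)\<^esub> face X n i z)"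

definition hoch_b' :: "('k::field, 'm) cyclic_data \<Rightarrow> nat \<Rightarrow> 'm \<Rightarrow> 'm" where
  "hoch_b' X n z =
     (\<Oplus>\<^bsub>cobj X (n - 1)\<^esub>i\<in>{..<n}. (- 1) ^ i \<odot>\<^bsub>cobj X (n - 1)\<^esub> face X n i z)"

definition signed_cyc :: "('k::field, 'm) cyclic_data \<Rightarrow> nat \<Rightarrow> 'm \<Rightarrow> 'm" where
  "signed_cyc X n z = (- 1) ^ n \<odot>\<^bsub>cobj X n\<^esub> cyc X n z"

definition cyc_norm :: "('k::field, 'm) cyclic_data \<Rightarrow> nat \<Rightarrow> 'm \<Rightarrow> 'm" where
  "cyc_norm X n z = (\<Oplus>\<^bsub>cobj X n\<^esub>i\<in>{..n}. (signed_cyc X n ^^ i) z)"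

definition HH :: "('k::field, 'm) cyclic_data \<Rightarrow> nat \<Rightarrow> ('k, 'm set) module" where
  "HH X = homology (cobj X) (hoch_b X)"

text \<open>
  Tsygan's bicomplex has the entry \<open>C\<^sub>q\<close> in position \<open>(p, q)\<close>, with vertical differential \<open>b\<close>
  (\<open>p\<close> even) or \<open>-b'\<close> (\<open>p\<close> odd), and horizontal differential \<open>1 - \<tau>\<close> (\<open>p\<close> odd) or \<open>N\<close>
  (\<open>p > 0\<close> even), where \<open>\<tau> = (-1)\<^sup>q t\<^sub>q\<close> and \<open>N = 1 + \<tau> + \<dots> + \<tau>\<^sup>q\<close>. An element of degree \<open>n\<close>
  of the total complex is a family \<open>z\<close> with \<open>z q \<in> C\<^sub>q\<close> in position \<open>(n - q, q)\<close> for \<open>q \<le> n\<close>.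
\<close>

definition bicomplex_vert :: "('k::field, 'm) cyclic_data \<Rightarrow> nat \<Rightarrow> nat \<Rightarrow> 'm \<Rightarrow> 'm" where
  "bicomplex_vert X p q z =
     (if even p then hoch_b X q z else \<ominus>\<^bsub>cobj X (q - 1)\<^esub> hoch_b' X q z)"

definition bicomplex_horiz :: "('k::field, 'm) cyclic_data \<Rightarrow> nat \<Rightarrow> nat \<Rightarrow> 'm \<Rightarrow> 'm" where
  "bicomplex_horiz X p q z =
     (if odd p then z \<ominus>\<^bsub>cobj X q\<^esub> signed_cyc X q z else cyc_norm X q z)"

definition tot_mod :: "('k::field, 'm) cyclic_data \<Rightarrow> nat \<Rightarrow> ('k, nat \<Rightarrow> 'm) module" where
  "tot_mod X n =
     \<lparr>carrier = (\<Pi>\<^sub>E q\<in>{..n}. carrier (cobj X q)), mult = undefined, one = undefined,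
      zero = (\<lambda>q\<in>{..n}. \<zero>\<^bsub>cobj X q\<^esub>),
      add = (\<lambda>y z. \<lambda>q\<in>{..n}. y q \<oplus>\<^bsub>cobj X q\<^esub> z q),
      smult = (\<lambda>c z. \<lambda>q\<in>{..n}. c \<odot>\<^bsub>cobj X q\<^esub> z q)\<rparr>"

definition tot_d :: "('k::field, 'm) cyclic_data \<Rightarrow> nat \<Rightarrow> (nat \<Rightarrow> 'm) \<Rightarrow> nat \<Rightarrow> 'm" where
  "tot_d X n z =
     (\<lambda>q\<in>{..n - 1}. bicomplex_vert X (n - (q + 1)) (q + 1) (z (q + 1))
                      \<oplus>\<^bsub>cobj X q\<^esub> bicomplex_horiz X (n - q) q (z q))"

definition HC :: "('k::field, 'm) cyclic_data \<Rightarrow> nat \<Rightarrow> ('k, (nat \<Rightarrow> 'm) set) module" where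
  "HC X = homology (tot_mod X) (tot_d X)"

text \<open>
  \<open>h\<close> is given on the \<open>n\<close>-th homology by applying \<open>\<phi> n\<close> to representing cycles.
\<close>

definition induced_on_homology ::
    "(nat \<Rightarrow> ('k, 'm) module) \<Rightarrow> (nat \<Rightarrow> 'm \<Rightarrow> 'm) \<Rightarrow> (nat \<Rightarrow> ('k, 'n) module) \<Rightarrow> (nat \<Rightarrow> 'n \<Rightarrow> 'n)
      \<Rightarrow> (nat \<Rightarrow> 'm \<Rightarrow> 'n) \<Rightarrow> nat \<Rightarrow> ('m set \<Rightarrow> 'n set) \<Rightarrow> bool" where
  "induced_on_homology M d M' d' \<phi> n h \<longleftrightarrow>
     (\<forall>z\<in>cycles M d n. \<phi> n z \<in> cycles M' d' n \<and>
        h (homology_class M d n z) = homology_class M' d' n (\<phi> n z))"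

definition tot_map :: "(nat \<Rightarrow> 'm \<Rightarrow> 'n) \<Rightarrow> nat \<Rightarrow> (nat \<Rightarrow> 'm) \<Rightarrow> nat \<Rightarrow> 'n" where
  "tot_map f n z = (\<lambda>q\<in>{..n}. f q (z q))"

section \<open>The cyclic module of a Hopf algebroid\<close>

text \<open>
  Tensor powers over \<open>A\<^sub>R = A\<^sub>L\<^sup>o\<^sup>p\<close>, for the bimodule structure \<open>a \<cdot> u \<cdot> b = s\<^sub>R(a) u s\<^sub>R(b)\<close> with
  \<open>s\<^sub>R = t\<^sub>L\<close>. As a vector space, \<open>A\<^sub>R\<close> is \<open>A\<^sub>L\<close>.
\<close>

definition relsR ::
    "('k::field, 'u::{ring, monoid_mult}, 'a::{ring, monoid_mult}) hopf_algebroid \<Rightarrow> nat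
      \<Rightarrow> ('k, 'a, 'u) formal_tensor set" where
  "relsR H = tensor_rels (scU H) (scA H) (\<lambda>a u. u * tL H a) (\<lambda>a u. tL H a * u)"

definition tensR ::
    "('k::field, 'u::{ring, monoid_mult}, 'a::{ring, monoid_mult}) hopf_algebroid \<Rightarrow> nat
      \<Rightarrow> ('k, ('k, 'a, 'u) formal_tensor set) module" where
  "tensR H = tensor_power (scU H) (scA H) (\<lambda>a u. u * tL H a) (\<lambda>a u. tL H a * u)"

definition classR ::
    "('k::field, 'u::{ring, monoid_mult}, 'a::{ring, monoid_mult}) hopf_algebroid \<Rightarrow> nat
      \<Rightarrow> ('k, 'a, 'u) formal_tensor \<Rightarrow> ('k, 'a, 'u) formal_tensor set" where
  "classR H = tensor_class (scU H) (scA H) (\<lambda>a u. u * tL H a) (\<lambda>a u. tL H a * u)"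

definition epsR :: "('k::field, 'u, 'a) hopf_algebroid \<Rightarrow> 'u \<Rightarrow> 'a" where
  "epsR H u = epsL H (antipode H u)"

text \<open>
  The structure maps on generators. The factor \<open>u\<^sup>i\<close> of a pure tensor \<open>us\<close> is \<open>us ! (i - 1)\<close>.
\<close>

definition face_gen ::
    "('k::field, 'u::{ring, monoid_mult}, 'a::{ring, monoid_mult}) hopf_algebroid
      \<Rightarrow> nat \<Rightarrow> nat \<Rightarrow> ('a, 'u) tgen \<Rightarrow> ('k, 'a, 'u) formal_tensor" where
  "face_gen H n i g = (case g of Scalar a \<Rightarrow> 0 | Tensor us \<Rightarrow>
     if n = 1 then
       (if i = 0 then scal (epsR H (us ! 0)) else scal (epsR H (antipode H (us ! 0))))
     else if i = 0 then
       tens ((tL H (epsR H (us ! 0)) * us ! 1) # drop 2 us)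
     else if i < n then
       tens (take (i - 1) us @ [us ! (i - 1) * us ! i] @ drop (i + 1) us)
     else
       tens (take (n - 2) us @ [us ! (n - 2) * tL H (epsR H (antipode H (us ! (n - 1))))]))"

definition degen_gen ::
    "('k::field, 'u::{ring, monoid_mult}, 'a::{ring, monoid_mult}) hopf_algebroid
      \<Rightarrow> nat \<Rightarrow> ('a, 'u) tgen \<Rightarrow> ('k, 'a, 'u) formal_tensor" where
  "degen_gen H i g = (case g of
     Scalar a \<Rightarrow> tens [tL H a]
   | Tensor us \<Rightarrow> tens (take i us @ [1] @ drop i us))"

text \<open>
  \<open>sweedler_list H f [u\<^sup>1, \<dots>, u\<^sup>m]\<close> is the sum of all
  \<open>f [u\<^sup>1\<^sub>(\<^sub>1\<^sub>), \<dots>, u\<^sup>m\<^sub>(\<^sub>1\<^sub>)] [u\<^sup>1\<^sub>(\<^sub>2\<^sub>), \<dots>, u\<^sup>m\<^sub>(\<^sub>2\<^sub>)]\<close>.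
\<close>

primrec sweedler_list ::
    "('k::field, 'u, 'a) hopf_algebroid \<Rightarrow> ('u list \<Rightarrow> 'u list \<Rightarrow> ('k, 'a, 'u) formal_tensor)
      \<Rightarrow> 'u list \<Rightarrow> ('k, 'a, 'u) formal_tensor" where
  "sweedler_list H f [] = f [] []"
| "sweedler_list H f (u # us) =
     sweedler fscale (\<lambda>p q. sweedler_list H (\<lambda>ps qs. f (p # ps) (q # qs)) us) (deltaL H u)"

definition cyc_gen ::
    "('k::field, 'u::{ring, monoid_mult}, 'a::{ring, monoid_mult}) hopf_algebroid
      \<Rightarrow> ('a, 'u) tgen \<Rightarrow> ('k, 'a, 'u) formal_tensor" where
  "cyc_gen H g = (case g of
     Scalar a \<Rightarrow> scal a
   | Tensor us \<Rightarrow>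
       sweedler_list H (\<lambda>ps qs. tens (antipode H (prod_list qs * last us) # ps)) (butlast us))"

definition cyclic_module_of ::
    "('k::field, 'u::{ring, monoid_mult}, 'a::{ring, monoid_mult}) hopf_algebroid
      \<Rightarrow> ('k, ('k, 'a, 'u) formal_tensor set) cyclic_data" where
  "cyclic_module_of H =
     \<lparr>cobj = tensR H,
      face = (\<lambda>n i. descend (relsR H (n - 1)) (face_gen H n i)),
      degen = (\<lambda>n i. descend (relsR H (n + 1)) (degen_gen H i)),
      cyc = (\<lambda>n. descend (relsR H n) (cyc_gen H))\<rparr>"

section \<open>The maps induced by a measuring\<close>

definition measured_tensor ::
    "('k::field, 'c) coalgebra \<Rightarrow> ('c \<Rightarrow> 'u \<Rightarrow> 'v) \<Rightarrow> 'c \<Rightarrow> 'u list \<Rightarrow> ('k, 'b, 'v) formal_tensor" where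
  "measured_tensor C \<Psi> x us =
     lin_ext fscale (\<lambda>xs. tens (map2 \<Psi> xs us)) (iter_comult C (length us - 1) x)"

definition measured_chain ::
    "('k::field, 'c) coalgebra
      \<Rightarrow> ('k, 'v::{ring, monoid_mult}, 'b::{ring, monoid_mult}) hopf_algebroid
      \<Rightarrow> ('c \<Rightarrow> 'u \<Rightarrow> 'v) \<Rightarrow> ('c \<Rightarrow> 'a \<Rightarrow> 'b) \<Rightarrow> 'c \<Rightarrow> nat
      \<Rightarrow> ('k, 'a, 'u) formal_tensor set \<Rightarrow> ('k, 'b, 'v) formal_tensor set" where
  "measured_chain C H' \<Psi> \<psi> x n = descend (relsR H' n)
     (\<lambda>g. case g of Scalar a \<Rightarrow> scal (\<psi> x a) | Tensor us \<Rightarrow> measured_tensor C \<Psi> x us)"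

end

theory Submission
  imports Defs
begin

text \<open>
  Elements of a tensor power over \<open>A\<close> are separated by the functionals \<open>U\<^sup>n \<rightarrow> k\<close> that are
  multilinear and balanced over \<open>A\<close>. A map given on pure tensors is therefore well defined as soon
  as it pulls balanced functionals back to balanced functionals, and every identity in a tensor
  power becomes an identity of Sweedler sums with values in the field, where all sums can be
  interchanged freely. In this form the compatibility of \<open>x\<^sub>(\<^sub>1\<^sub>) \<otimes> \<dots> \<otimes> x\<^sub>(\<^sub>n\<^sub>)\<close> with balancing,
  faces and degeneracies is coassociativity, the counit and the measuring property. For the cyclic
  operator one substitutes \<open>\<Delta>(x(u)) = x\<^sub>(\<^sub>1\<^sub>)(u\<^sub>(\<^sub>1\<^sub>)) \<otimes> x\<^sub>(\<^sub>2\<^sub>)(u\<^sub>(\<^sub>2\<^sub>))\<close> in one tensor factor after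
  the other, from the last to the first; the Takeuchi condition makes each substitution legitimate,
  and cocommutativity collects the legs of \<open>x\<close> in the required order. A morphism of cyclic modules
  commutes with all differentials of the Hochschild complex and of Tsygan's bicomplex.
\<close>

section \<open>Formal sums and linear functionals\<close>

text \<open>Two tensor products meet here. Chains are balanced over A_R, where t_L(a) passes from
  right multiplication on one factor to left multiplication on the next; coproducts live over A_L,
  where t_L(a) and s_L(a) both multiply from the left. In t_n the first legs stand side by side over
  A_R while the second legs are multiplied inside the antipode, so a functional on chains is not
  visibly balanced over A_L in any one coproduct. At the left end the bridge is S(s_L(a) c) = S(c)
  t_L(a), which takes s_L(a) out of the antipode and across the first tensor sign. From any other
  slot the scalar has to travel to that end through the coproducts on its left, so these must still
  be intact when a coproduct is expanded; hence the right-to-left order. Functionals take values in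
  k rather than in A because the relations span a k-subspace of a free vector space, and a vector
  outside a subspace is separated from it by extending a basis.\<close>

abbreviation pairing :: "('g \<Rightarrow> 'k) \<Rightarrow> ('g \<Rightarrow>\<^sub>0 'k::field) \<Rightarrow> 'k" where
  "pairing \<equiv> lin_ext (*)"

definition functional :: "('k::field \<Rightarrow> 'v \<Rightarrow> 'v) \<Rightarrow> ('v::ab_group_add \<Rightarrow> 'k) \<Rightarrow> bool" where
  "functional sc f \<longleftrightarrow> (\<forall>x y. f (x + y) = f x + f y) \<and> (\<forall>c x. f (sc c x) = c * f x)"

lemma functionalI:
  assumes "\<And>x y. f (x + y) = f x + f y" "\<And>c x. f (sc c x) = c * f x"
  shows "functional sc f"
  using assms by (simp add: functional_def)

lemma functional_add: "functional sc f \<Longrightarrow> f (x + y) = f x + f y"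
  and functional_scale: "functional sc f \<Longrightarrow> f (sc c x) = c * f x"
  by (simp_all add: functional_def)

lemma functional_zero: "functional sc f \<Longrightarrow> f 0 = 0"
  using functional_add[of sc f 0 0] by (metis add.right_neutral add_cancel_left_right)

lemma functional_sum: "functional sc f \<Longrightarrow> f (\<Sum>i\<in>I. h i) = (\<Sum>i\<in>I. f (h i))"
  by (induction I rule: infinite_finite_induct) (simp_all add: functional_zero functional_add)

lemma functional_comp:
  assumes "functional sc f" "\<And>x y. g (x + y) = g x + g y" "\<And>c x. g (sc' c x) = sc c (g x)"
  shows "functional sc' (\<lambda>x. f (g x))"
  using assms by (simp add: functional_def)

lemma vector_space_mult: "vector_space ((*) :: 'k::field \<Rightarrow> 'k \<Rightarrow> 'k)"
  by unfold_locales (auto simp: algebra_simps)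

lemmas vector_space_fscale = formal.vector_space_axioms

lemma lin_ext_zero [simp]: "lin_ext sc f 0 = 0"
  by (simp add: lin_ext_def)

lemma lin_ext_diff:
  assumes "vector_space sc"
  shows "lin_ext sc f (y - z) = lin_ext sc f y - lin_ext sc f z"
  using lin_ext_add[OF assms, of f "y - z" z] by (simp add: algebra_simps)

lemma lin_ext_sum:
  assumes "vector_space sc"
  shows "lin_ext sc f (\<Sum>i\<in>I. h i) = (\<Sum>i\<in>I. lin_ext sc f (h i))"
  by (induction I rule: infinite_finite_induct) (simp_all add: lin_ext_add[OF assms])

lemma lin_ext_cong:
  "(\<And>g. g \<in> Poly_Mapping.keys z \<Longrightarrow> f g = h g) \<Longrightarrow> lin_ext sc f z = lin_ext sc h z"
  by (simp add: lin_ext_def)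

text \<open>Evaluating a functional on the image of a map given on generators means evaluating its
  pull-back; this is how \<open>pairing\<close> passes through linear extensions.\<close>

lemma lin_ext_lin_ext:
  assumes "vector_space sc"
  shows "lin_ext sc h (lin_ext fscale f z) = lin_ext sc (\<lambda>g. lin_ext sc h (f g)) z"
  unfolding lin_ext_def[of fscale] lin_ext_sum[OF assms] lin_ext_fscale[OF assms]
  by (simp add: lin_ext_def)

lemma functional_lin_ext:
  assumes "functional sc h"
  shows "h (lin_ext sc f z) = pairing (\<lambda>g. h (f g)) z"
  unfolding lin_ext_def functional_sum[OF assms] functional_scale[OF assms] ..

lemma pairing_single [simp]: "pairing f (Poly_Mapping.single g 1) = f g"
  by (simp add: lin_ext_single[OF vector_space_mult])

lemmas pairing_lin_ext = lin_ext_lin_ext[OF vector_space_mult]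
  and pairing_add = lin_ext_add[OF vector_space_mult]
  and pairing_diff = lin_ext_diff[OF vector_space_mult]
  and pairing_fscale = lin_ext_fscale[OF vector_space_mult]

lemma formal_sum_singles:
  "(\<Sum>g\<in>Poly_Mapping.keys z. fscale (Poly_Mapping.lookup z g) (Poly_Mapping.single g 1)) = z"
  by (rule poly_mapping_eqI)
    (auto simp: lookup_sum lookup_fscale lookup_single when_def in_keys_iff if_distrib cong: if_cong)

lemma functional_eq_pairing:
  assumes "functional fscale \<phi>"
  shows "\<phi> z = pairing (\<lambda>g. \<phi> (Poly_Mapping.single g 1)) z"
proof -
  have "\<phi> z = \<phi> (\<Sum>g\<in>Poly_Mapping.keys z. fscale (Poly_Mapping.lookup z g) (Poly_Mapping.single g 1))"
    by (simp only: formal_sum_singles)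
  also have "\<dots> = pairing (\<lambda>g. \<phi> (Poly_Mapping.single g 1)) z"
    unfolding functional_sum[OF assms] functional_scale[OF assms] lin_ext_def ..
  finally show ?thesis .
qed

text \<open>A basis of \<open>N\<close> stays independent when \<open>z\<close> is added, so a
  linear functional may be prescribed as 0 on the basis and 1 at \<open>z\<close>. It is kept as its
  values on generators, which determine it through \<open>pairing\<close>.\<close>

lemma subspace_separation:
  fixes N :: "('g \<Rightarrow>\<^sub>0 'k::field) set"
  assumes N: "formal.subspace N" and z: "z \<notin> N"
  obtains \<beta> where "\<And>y. y \<in> N \<Longrightarrow> pairing \<beta> y = 0" "pairing \<beta> z \<noteq> 0"
proof -
  interpret k: vector_space "(*) :: 'k \<Rightarrow> 'k \<Rightarrow> 'k" by (rule vector_space_mult)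
  interpret vector_space_pair fscale "(*) :: 'k \<Rightarrow> 'k \<Rightarrow> 'k" by unfold_locales
  obtain B where B: "B \<subseteq> N" "formal.independent B" "N \<subseteq> formal.span B"
    using formal.maximal_independent_subset[of N] by blast
  have BN: "formal.span B = N"
    using B formal.span_minimal[OF B(1) N] by blast
  then have "formal.independent (insert z B)"
    using z B by (intro formal.independent_insertI) auto
  from linear_independent_extend[OF this, of "\<lambda>b. if b = z then 1 else 0"]
  obtain \<phi> where \<phi>: "Vector_Spaces.linear fscale (*) \<phi>"
    "\<And>b. b \<in> insert z B \<Longrightarrow> \<phi> b = (if b = z then 1 else 0)" by blast
  interpret \<phi>: Vector_Spaces.linear fscale "(*)" \<phi> by (rule \<phi>(1))
  have f: "functional fscale \<phi>"
    by (rule functionalI) (simp_all add: \<phi>.add \<phi>.scale)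
  have "\<phi> y = 0" if "y \<in> N" for y
  proof (rule \<phi>.eq_0_on_span)
    show "y \<in> formal.span B" using that BN by simp
    show "\<phi> b = 0" if "b \<in> B" for b using that \<phi>(2)[of b] B(1) z by auto
  qed
  moreover have "\<phi> z \<noteq> 0" using \<phi>(2)[of z] by simp
  ultimately show ?thesis
    using that[of "\<lambda>g. \<phi> (Poly_Mapping.single g 1)"] functional_eq_pairing[OF f] by metis
qed

section \<open>Balanced functionals\<close>

text \<open>These are the values on generators of the linear functionals that vanish on
  \<open>tensor_rels\<close>. Nothing is asked of generators of other degrees.\<close>

definition balanced ::
    "('k::field \<Rightarrow> 'u \<Rightarrow> 'u) \<Rightarrow> ('k \<Rightarrow> 'a \<Rightarrow> 'a) \<Rightarrow> ('a \<Rightarrow> 'u \<Rightarrow> 'u) \<Rightarrow> ('a \<Rightarrow> 'u \<Rightarrow> 'u) \<Rightarrow> nat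
      \<Rightarrow> (('a::ab_group_add, 'u::ab_group_add) tgen \<Rightarrow> 'k) \<Rightarrow> bool" where
  "balanced scM scB r l n \<beta> \<longleftrightarrow>
     (if n = 0 then functional scB (\<lambda>a. \<beta> (Scalar a))
      else
        (\<forall>us vs. length us + 1 + length vs = n \<longrightarrow> functional scM (\<lambda>u. \<beta> (Tensor (us @ u # vs)))) \<and>
        (\<forall>us a u v vs. length us + 2 + length vs = n \<longrightarrow>
           \<beta> (Tensor (us @ r a u # v # vs)) = \<beta> (Tensor (us @ u # l a v # vs))))"

text \<open>One direction checks the generating relations. Conversely, a vector outside their span
  has a separating functional, and the vanishing of that functional on the generating relations is
  exactly balancedness.\<close>

lemma tensor_rels_iff:
  "z \<in> tensor_rels scM scB r l n \<longleftrightarrow> (\<forall>\<beta>. balanced scM scB r l n \<beta> \<longrightarrow> pairing \<beta> z = 0)"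
proof
  assume z: "z \<in> tensor_rels scM scB r l n"
  show "\<forall>\<beta>. balanced scM scB r l n \<beta> \<longrightarrow> pairing \<beta> z = 0"
  proof (intro allI impI)
    fix \<beta> assume \<beta>: "balanced scM scB r l n \<beta>"
    have s: "formal.subspace {z. pairing \<beta> z = 0}"
      by (simp add: formal.subspace_def pairing_add pairing_fscale)
    have "tensor_rels scM scB r l n \<subseteq> {z. pairing \<beta> z = 0}"
      unfolding tensor_rels_def using \<beta>
      by (intro formal.span_minimal[OF _ s])
        (auto simp: balanced_def functional_def pairing_diff pairing_fscale)
    with z show "pairing \<beta> z = 0" by blast
  qed
next
  assume *: "\<forall>\<beta>. balanced scM scB r l n \<beta> \<longrightarrow> pairing \<beta> z = 0"
  show "z \<in> tensor_rels scM scB r l n"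
  proof (rule ccontr)
    assume "z \<notin> tensor_rels scM scB r l n"
    from subspace_separation[OF subspace_tensor_rels this]
    obtain \<beta> where \<beta>: "\<And>y. y \<in> tensor_rels scM scB r l n \<Longrightarrow> pairing \<beta> y = 0"
      and nz: "pairing \<beta> z \<noteq> 0"
      by metis
    have 0: "pairing \<beta> (scal (a + b) - scal a - scal b) = 0"
      "pairing \<beta> (scal (scB c a) - fscale c (scal a)) = 0" if "n = 0" for a b c
      using that by (intro \<beta>, unfold tensor_rels_def, intro formal.span_base, force)+
    have n: "pairing \<beta> (tens (us @ [u + v] @ vs) - tens (us @ [u] @ vs) - tens (us @ [v] @ vs)) = 0"
      "pairing \<beta> (tens (us @ [scM c u] @ vs) - fscale c (tens (us @ [u] @ vs))) = 0"
      if "length us + 1 + length vs = n" for us u v vs c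
      using that
      by (intro \<beta>, unfold tensor_rels_def, intro formal.span_base, subst if_not_P, simp, blast)+
    have b: "pairing \<beta> (tens (us @ [r a u, v] @ vs) - tens (us @ [u, l a v] @ vs)) = 0"
      if "length us + 2 + length vs = n" for us a u v vs
      using that
      by (intro \<beta>, unfold tensor_rels_def, intro formal.span_base, subst if_not_P, simp, blast)
    have "balanced scM scB r l n \<beta>"
      using 0 n b
      by (auto simp: balanced_def functional_def pairing_add pairing_diff pairing_fscale algebra_simps)
    with * nz show False by blast
  qed
qed

lemma tensor_class_eq_iff:
  "tensor_class scM scB r l n y = tensor_class scM scB r l n z \<longleftrightarrow>
     (\<forall>\<beta>. balanced scM scB r l n \<beta> \<longrightarrow> pairing \<beta> y = pairing \<beta> z)"
  by (simp add: tensor_class_def coset_eq_iff[OF subspace_tensor_rels] tensor_rels_iff pairing_diff)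

lemma mem_tensor_class_iff:
  "y \<in> tensor_class scM scB r l n z \<longleftrightarrow> tensor_class scM scB r l n y = tensor_class scM scB r l n z"
proof -
  have "y \<in> tensor_class scM scB r l n z \<longleftrightarrow> y - z \<in> tensor_rels scM scB r l n"
    by (force simp: tensor_class_def a_r_coset_def r_coset_def formal_module_def)
  then show ?thesis by (simp add: tensor_class_def coset_eq_iff[OF subspace_tensor_rels])
qed

lemma representative_tensor_class:
  assumes "X \<in> carrier (tensor_power scM scB r l n)"
  shows "tensor_class scM scB r l n (representative X) = X"
proof -
  obtain z where X: "X = tensor_class scM scB r l n z"
    using assms by (auto simp: tensor_power_def subquot_def tensor_class_def)
  then have "z \<in> X" by (simp add: mem_tensor_class_iff)
  then have "representative X \<in> X" unfolding representative_def by (rule someI)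
  then show ?thesis by (simp add: X mem_tensor_class_iff)
qed

text \<open>Members of one class pair equally with the pulled-back functionals, so their images lie
  in one class and the union defining \<open>descend\<close> runs over equal sets.\<close>

lemma descend_tensor_class:
  assumes "\<And>\<beta>. balanced scM' scB' r' l' n' \<beta> \<Longrightarrow> balanced scM scB r l n (\<lambda>g. pairing \<beta> (f g))"
  shows "descend (tensor_rels scM' scB' r' l' n') f (tensor_class scM scB r l n z)
    = tensor_class scM' scB' r' l' n' (lin_ext fscale f z)"
proof -
  have "tensor_class scM' scB' r' l' n' (lin_ext fscale f y)
      = tensor_class scM' scB' r' l' n' (lin_ext fscale f z)"
    if "y \<in> tensor_class scM scB r l n z" for y
    using that assms by (auto simp: mem_tensor_class_iff tensor_class_eq_iff pairing_lin_ext)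
  moreover have "z \<in> tensor_class scM scB r l n z" by (simp add: mem_tensor_class_iff)
  ultimately show ?thesis unfolding descend_def tensor_class_def[symmetric] by blast
qed

section \<open>Vector spaces as records\<close>

text \<open>A vector space given as a record whose scalars form the type \<open>'k\<close>; the
  HOL-Algebra locale \<open>module\<close> takes a record for the scalar ring instead.\<close>

locale k_space = abelian_group M for M :: "('k::field, 'm) module" (structure) +
  assumes smult_closed [simp, intro]: "x \<in> carrier M \<Longrightarrow> c \<odot> x \<in> carrier M"
    and smult_r_distr: "x \<in> carrier M \<Longrightarrow> y \<in> carrier M \<Longrightarrow> c \<odot> (x \<oplus> y) = c \<odot> x \<oplus> c \<odot> y"
    and smult_assoc: "x \<in> carrier M \<Longrightarrow> c \<odot> (d \<odot> x) = (c * d) \<odot> x"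

lemma carrier_tensor_power:
  "carrier (tensor_power scM scB r l n)
     = tensor_class scM scB r l n ` {z. Poly_Mapping.keys z \<subseteq> tensor_gens n}"
  by (simp add: tensor_power_def subquot_def tensor_class_def)

lemma zero_tensor_power: "\<zero>\<^bsub>tensor_power scM scB r l n\<^esub> = tensor_class scM scB r l n 0"
  by (auto simp: tensor_power_def subquot_def tensor_class_def a_r_coset_def r_coset_def
      formal_module_def)

lemma add_tensor_power:
  "tensor_class scM scB r l n y \<oplus>\<^bsub>tensor_power scM scB r l n\<^esub> tensor_class scM scB r l n z
     = tensor_class scM scB r l n (y + z)"
proof -
  let ?N = "tensor_rels scM scB r l n"
  have N: "formal.subspace ?N" by (rule subspace_tensor_rels)
  have c: "tensor_class scM scB r l n w = (\<lambda>v. v + w) ` ?N" for w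
    by (auto simp: tensor_class_def a_r_coset_def r_coset_def formal_module_def)
  have "(\<lambda>v. v + y) ` ?N <+>\<^bsub>formal_module\<^esub> (\<lambda>v. v + z) ` ?N = (\<lambda>v. v + (y + z)) ` ?N"
  proof (intro equalityI subsetI)
    fix w assume "w \<in> (\<lambda>v. v + y) ` ?N <+>\<^bsub>formal_module\<^esub> (\<lambda>v. v + z) ` ?N"
    then obtain v v' where "v \<in> ?N" "v' \<in> ?N" "w = (v + y) + (v' + z)"
      by (auto simp: set_add_def set_mult_def formal_module_def)
    then show "w \<in> (\<lambda>v. v + (y + z)) ` ?N"
      using formal.subspace_add[OF N] by (intro image_eqI[of _ _ "v + v'"]) (auto simp: algebra_simps)
  next
    fix w assume "w \<in> (\<lambda>v. v + (y + z)) ` ?N"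
    then obtain v where "v \<in> ?N" "w = (v + y) + (0 + z)" by (auto simp: algebra_simps)
    then show "w \<in> (\<lambda>v. v + y) ` ?N <+>\<^bsub>formal_module\<^esub> (\<lambda>v. v + z) ` ?N"
      using formal.subspace_0[OF N] by (force simp: set_add_def set_mult_def formal_module_def)
  qed
  then show ?thesis by (simp add: c tensor_power_def subquot_def)
qed

lemma smult_tensor_power:
  "c \<odot>\<^bsub>tensor_power scM scB r l n\<^esub> tensor_class scM scB r l n z = tensor_class scM scB r l n (fscale c z)"
proof -
  have "c \<odot>\<^bsub>tensor_power scM scB r l n\<^esub> tensor_class scM scB r l n z
      = (\<Union>y\<in>tensor_class scM scB r l n z.
           tensor_class scM scB r l n (c \<odot>\<^bsub>formal_module\<^esub> y))"
    by (simp add: tensor_power_def subquot_def tensor_class_def)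
  also have "\<dots> = tensor_class scM scB r l n (fscale c z)"
  proof (rule UN_constant_eq)
    show "z \<in> tensor_class scM scB r l n z" by (simp add: mem_tensor_class_iff)
    show "\<forall>y\<in>tensor_class scM scB r l n z.
        tensor_class scM scB r l n (c \<odot>\<^bsub>formal_module\<^esub> y) = tensor_class scM scB r l n (fscale c z)"
      by (auto simp: mem_tensor_class_iff tensor_class_eq_iff pairing_fscale formal_module_def)
  qed
  finally show ?thesis .
qed

lemma keys_fscale_subset: "Poly_Mapping.keys z \<subseteq> G \<Longrightarrow> Poly_Mapping.keys (fscale c z) \<subseteq> G"
  by (auto simp: in_keys_iff lookup_fscale)

lemma k_space_tensor_power: "k_space (tensor_power scM scB r l n)"
proof -
  let ?M = "tensor_power scM scB r l n"
  have "abelian_group ?M"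
  proof (rule abelian_groupI)
    fix X assume "X \<in> carrier ?M"
    then obtain z where z: "X = tensor_class scM scB r l n z" "Poly_Mapping.keys z \<subseteq> tensor_gens n"
      by (auto simp: carrier_tensor_power)
    then show "\<exists>Y\<in>carrier ?M. Y \<oplus>\<^bsub>?M\<^esub> X = \<zero>\<^bsub>?M\<^esub>"
      by (intro bexI[of _ "tensor_class scM scB r l n (- z)"])
        (auto simp: carrier_tensor_power add_tensor_power zero_tensor_power)
  qed (auto simp: carrier_tensor_power add_tensor_power zero_tensor_power add_ac
      dest!: subsetD[OF Poly_Mapping.keys_add])
  moreover have "k_space_axioms ?M"
    by unfold_locales
      (auto simp: carrier_tensor_power add_tensor_power smult_tensor_power formal.scale_right_distrib
        intro!: imageI keys_fscale_subset)
  ultimately show ?thesis by (rule k_space.intro)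
qed

text \<open>The assumption on pairings gives independence of the representative; the one on
  \<open>keys\<close> keeps images in the carrier, which consists of the classes of sums supported
  on generators of the right degree.\<close>

lemma k_linear_descend:
  assumes "\<And>\<beta>. balanced scM' scB' r' l' n' \<beta> \<Longrightarrow> balanced scM scB r l n (\<lambda>g. pairing \<beta> (f g))"
    and "\<And>g. g \<in> tensor_gens n \<Longrightarrow> Poly_Mapping.keys (f g) \<subseteq> tensor_gens n'"
  shows "k_linear (tensor_power scM scB r l n) (tensor_power scM' scB' r' l' n')
    (descend (tensor_rels scM' scB' r' l' n') f)"
proof -
  have "Poly_Mapping.keys (lin_ext fscale f z) \<subseteq> tensor_gens n'"
    if "Poly_Mapping.keys z \<subseteq> tensor_gens n" for z
    using keys_sum[of "\<lambda>g. fscale (Poly_Mapping.lookup z g) (f g)" "Poly_Mapping.keys z"]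
      that assms(2) keys_fscale_subset unfolding lin_ext_def by blast
  then show ?thesis
    by (auto simp: k_linear_def carrier_tensor_power descend_tensor_class[OF assms(1)]
        add_tensor_power smult_tensor_power lin_ext_add[OF vector_space_fscale]
        lin_ext_fscale[OF vector_space_fscale])
qed

section \<open>Sweedler sums\<close>

abbreviation sw :: "('u \<Rightarrow> 'u \<Rightarrow> 'k) \<Rightarrow> ('k::field, 'a, 'u) formal_tensor \<Rightarrow> 'k" where
  "sw \<equiv> sweedler (*)"

lemma sweedler_eq_lin_ext:
  "sweedler sc F P = lin_ext sc (\<lambda>g. case g of Tensor [p, q] \<Rightarrow> F p q | _ \<Rightarrow> 0) P"
  by (simp add: sweedler_def)

primrec tfactors :: "('a, 'u) tgen \<Rightarrow> 'u list" where
  "tfactors (Scalar a) = []"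
| "tfactors (Tensor us) = us"

text \<open>Replaces the pattern match on two-element lists by a fixed finite index set, so that
  linearity and interchange of Sweedler sums become facts about finite sums of scalars.\<close>

lemma sw_eq_sum:
  "sw F P = (\<Sum>g | g \<in> Poly_Mapping.keys P \<and> length (tfactors g) = 2.
     Poly_Mapping.lookup P g * F (tfactors g ! 0) (tfactors g ! 1))"
proof -
  have *: "(case g of Tensor [p, q] \<Rightarrow> F p q | _ \<Rightarrow> 0)
      = (if length (tfactors g) = 2 then F (tfactors g ! 0) (tfactors g ! 1) else 0)" for g
    by (cases g) (auto split: list.split)
  show ?thesis
    unfolding sweedler_eq_lin_ext lin_ext_def *
    by (rule sum.mono_neutral_cong_right) auto
qed

lemma functional_sweedler:
  assumes "functional sc h"
  shows "h (sweedler sc F P) = sw (\<lambda>p q. h (F p q)) P"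
  unfolding sweedler_eq_lin_ext functional_lin_ext[OF assms]
  by (rule lin_ext_cong)
    (auto split: tgen.split list.split simp: functional_zero[OF assms])

lemma functional_pairing: "functional fscale (pairing \<beta>)"
  by (simp add: functional_def pairing_add pairing_fscale)

lemmas pairing_sweedler = functional_sweedler[OF functional_pairing]

lemma sw_functional:
  assumes F: "\<And>p q. functional sc (\<lambda>x. F x p q)"
  shows "functional sc (\<lambda>x. sw (F x) P)"
proof (rule functionalI)
  show "sw (F (x + y)) P = sw (F x) P + sw (F y) P" for x y
    unfolding sw_eq_sum functional_add[OF F] distrib_left sum.distrib ..
  show "sw (F (sc c x)) P = c * sw (F x) P" for c x
    unfolding sw_eq_sum functional_scale[OF F] sum_distrib_left by (simp only: mult.left_commute)
qed

lemma sw_swap: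
  "sw (\<lambda>p q. sw (\<lambda>r s. F p q r s) Q) P = sw (\<lambda>r s. sw (\<lambda>p q. F p q r s) P) Q"
  unfolding sw_eq_sum sum_distrib_left
  by (subst sum.swap) (intro sum.cong refl, rule mult.left_commute)

lemma sw_scale: "sw (\<lambda>p q. c * F p q) P = c * sw F P"
proof -
  have "functional (*) ((*) c)" by (simp add: functional_def algebra_simps)
  from functional_sweedler[OF this, symmetric] show ?thesis .
qed

lemma keys_lin_ext:
  assumes "\<And>g. g \<in> Poly_Mapping.keys z \<Longrightarrow> Poly_Mapping.keys (f g) \<subseteq> G"
  shows "Poly_Mapping.keys (lin_ext fscale f z) \<subseteq> G"
  unfolding lin_ext_def
  by (rule order_trans[OF keys_sum UN_least]) (intro keys_fscale_subset assms)

lemma keys_sweedler: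
  assumes "\<And>p q. Poly_Mapping.keys (F p q) \<subseteq> G"
  shows "Poly_Mapping.keys (sweedler fscale F P) \<subseteq> G"
  unfolding sweedler_eq_lin_ext
  by (rule keys_lin_ext) (auto split: tgen.split list.split dest: subsetD[OF assms])

text \<open>Curried form of a functional on a tensor square, the form in which it receives the two
  legs of a coproduct.\<close>

definition balanced2 ::
    "('k::field \<Rightarrow> 'u \<Rightarrow> 'u) \<Rightarrow> ('a \<Rightarrow> 'u \<Rightarrow> 'u) \<Rightarrow> ('a \<Rightarrow> 'u \<Rightarrow> 'u)
      \<Rightarrow> ('u::ab_group_add \<Rightarrow> 'u \<Rightarrow> 'k) \<Rightarrow> bool" where
  "balanced2 sc r l F \<longleftrightarrow>
     (\<forall>q. functional sc (\<lambda>p. F p q)) \<and> (\<forall>p. functional sc (F p)) \<and>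
     (\<forall>a p q. F (r a p) q = F p (l a q))"

lemma balanced2I:
  assumes "\<And>q. functional sc (\<lambda>p. F p q)" "\<And>p. functional sc (F p)"
    "\<And>a p q. F (r a p) q = F p (l a q)"
  shows "balanced2 sc r l F"
  using assms by (simp add: balanced2_def)

lemma balanced_pair:
  assumes "balanced2 sc r l F"
  shows "balanced sc scB r l 2 (\<lambda>g. case g of Tensor [p, q] \<Rightarrow> F p q | _ \<Rightarrow> 0)"
proof -
  have "functional sc (\<lambda>u. case Tensor (us @ u # vs) of Tensor [p, q] \<Rightarrow> F p q | _ \<Rightarrow> 0)"
    if "length us + length vs = 1" for us vs
  proof (cases us)
    case Nil
    with that obtain v where "vs = [v]" by (auto simp: length_Suc_conv)
    with Nil show ?thesis using assms by (simp add: balanced2_def)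
  next
    case (Cons u us')
    with that have "us = [u]" "vs = []" by auto
    then show ?thesis using assms by (simp add: balanced2_def)
  qed
  with assms show ?thesis by (auto simp: balanced_def balanced2_def)
qed

text \<open>A Sweedler sum sees a coproduct only through its class, provided the summand is balanced
  in the two legs. This neutralises the choice made by \<open>representative\<close>.\<close>

lemma sw_tensor_class_cong:
  assumes "tensor_class sc scB r l 2 P = tensor_class sc scB r l 2 Q" "balanced2 sc r l F"
  shows "sw F P = sw F Q"
  using assms(1) balanced_pair[OF assms(2)] unfolding tensor_class_eq_iff sweedler_eq_lin_ext
  by blast

section \<open>Cocommutative coalgebras\<close>

definition multilinear ::
    "('k::field \<Rightarrow> 'u \<Rightarrow> 'u) \<Rightarrow> nat \<Rightarrow> ('u::ab_group_add list \<Rightarrow> 'k) \<Rightarrow> bool" where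
  "multilinear sc n b \<longleftrightarrow>
     (\<forall>us vs. length us + 1 + length vs = n \<longrightarrow> functional sc (\<lambda>u. b (us @ u # vs)))"

lemma multilinearD:
  "multilinear sc n b \<Longrightarrow> length us + 1 + length vs = n \<Longrightarrow> functional sc (\<lambda>u. b (us @ u # vs))"
  by (simp add: multilinear_def)

lemma multilinear_append:
  assumes "multilinear sc n b" "length us + m + length vs = n"
  shows "multilinear sc m (\<lambda>ws. b (us @ ws @ vs))"
  unfolding multilinear_def
proof (intro allI impI)
  fix ps qs :: "'b list" assume "length ps + 1 + length qs = m"
  then show "functional sc (\<lambda>u. b (us @ (ps @ u # qs) @ vs))"
    using multilinearD[OF assms(1), of "us @ ps" "qs @ vs"] assms(2) by simp
qed

lemma multilinear_Cons:
  "multilinear sc (Suc n) b \<Longrightarrow> multilinear sc n (\<lambda>vs. b (v # vs))"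
  using multilinear_append[of sc "Suc n" b "[v]" n "[]"] by simp

lemma multilinear_hd:
  "multilinear sc (Suc n) b \<Longrightarrow> length vs = n \<Longrightarrow> functional sc (\<lambda>u. b (u # vs))"
  using multilinearD[of sc "Suc n" b "[]" vs] by simp

locale cocommutative =
  fixes C :: "('k::field, 'c::ab_group_add) coalgebra"
  assumes cocommutative: "cocommutative_coalgebra C"
begin

abbreviation SW :: "'c \<Rightarrow> ('c \<Rightarrow> 'c \<Rightarrow> 'k) \<Rightarrow> 'k" where
  "SW x F \<equiv> sw F (deltaC C x)"

abbreviation linC :: "('c \<Rightarrow> 'k) \<Rightarrow> bool" where
  "linC \<equiv> functional (scC C)"

lemma is_coalgebra: "is_coalgebra C"
  using cocommutative by (simp add: cocommutative_coalgebra_def)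

lemma classC_deltaC: "classC C 2 (deltaC C x) = DeltaC C x"
proof -
  have "DeltaC C x \<in> carrier (tensC C 2)"
    using is_coalgebra unfolding is_coalgebra_def by blast
  then show ?thesis
    unfolding tensC_def classC_def deltaC_def by (rule representative_tensor_class)
qed

lemma balanced2_bilinear:
  assumes "\<And>z. linC (\<lambda>y. F y z)" "\<And>y. linC (F y)"
  shows "balanced2 (scC C) (scC C) (scC C) F"
  using assms by (simp add: balanced2_def functional_def)

text \<open>\<open>deltaC\<close> is a choice and need not be additive. But the representative of a
  sum and the sum of the representatives lie in the same class, and a bilinear summand cannot tell
  them apart.\<close>

lemma SW_functional:
  assumes "\<And>z. linC (\<lambda>y. F y z)" "\<And>y. linC (F y)"
  shows "linC (\<lambda>x. SW x F)"
proof (rule functionalI)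
  note b = balanced2_bilinear[OF assms]
  fix x y c
  have "classC C 2 (deltaC C (x + y)) = classC C 2 (deltaC C x + deltaC C y)"
    using is_coalgebra
    by (simp add: classC_deltaC is_coalgebra_def)
      (simp add: classC_deltaC[symmetric] classC_def tensC_def add_tensor_power)
  from sw_tensor_class_cong[OF this[unfolded classC_def] b]
  show "SW (x + y) F = SW x F + SW y F"
    by (simp add: sweedler_eq_lin_ext pairing_add)
  have "classC C 2 (deltaC C (scC C c x)) = classC C 2 (fscale c (deltaC C x))"
    using is_coalgebra
    by (simp add: classC_deltaC is_coalgebra_def)
      (simp add: classC_deltaC[symmetric] classC_def tensC_def smult_tensor_power)
  from sw_tensor_class_cong[OF this[unfolded classC_def] b]
  show "SW (scC C c x) F = c * SW x F"
    by (simp add: sweedler_eq_lin_ext pairing_fscale)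
qed

lemma SW_cocomm:
  assumes "\<And>z. linC (\<lambda>y. F y z)" "\<And>y. linC (F y)"
  shows "SW x F = SW x (\<lambda>y z. F z y)"
proof -
  have "classC C 2 (deltaC C x) = classC C 2 (sweedler fscale (\<lambda>y z. tens [z, y]) (deltaC C x))"
    using cocommutative unfolding classC_deltaC cocommutative_coalgebra_def by blast
  from sw_tensor_class_cong[OF this[unfolded classC_def] balanced2_bilinear[OF assms]]
  show ?thesis by (simp add: sweedler_eq_lin_ext[of _ F] pairing_sweedler)
qed

lemma SW_coassoc:
  assumes F: "\<And>y z. linC (\<lambda>x. F x y z)" "\<And>x z. linC (\<lambda>y. F x y z)" "\<And>x y. linC (\<lambda>z. F x y z)"
  shows "SW x (\<lambda>y z. SW y (\<lambda>y1 y2. F y1 y2 z)) = SW x (\<lambda>y z. SW z (\<lambda>z1 z2. F y z1 z2))"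
proof -
  define \<beta> :: "('k, 'c) tgen \<Rightarrow> 'k"
    where "\<beta> g = (case g of Tensor [y1, y2, z] \<Rightarrow> F y1 y2 z | _ \<Rightarrow> 0)" for g
  have \<beta>: "\<beta> (Tensor [p, q, r]) = F p q r" for p q r by (simp add: \<beta>_def)
  have "functional (scC C) (\<lambda>u. \<beta> (Tensor (us @ u # vs)))" if "length us + length vs = 2" for us vs
  proof -
    from that consider (0) v w where "us = []" "vs = [v, w]" | (1) v w where "us = [v]" "vs = [w]"
      | (2) v w where "us = [v, w]" "vs = []"
      by (cases us rule: list.exhaust[case_product list.exhaust[of "tl us"]])
        (auto simp: length_Suc_conv numeral_2_eq_2)
    then show ?thesis by cases (simp_all add: \<beta> F)
  qed
  note lin = this
  \<comment> \<open>Over the field both actions are scalar multiplication, so the balancing relation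
    follows from linearity in the two neighbouring slots.\<close>
  have "balanced (scC C) (*) (scC C) (scC C) 3 \<beta>"
    unfolding balanced_def
  proof (simp, intro conjI allI impI)
    fix us vs :: "'c list" and a u v
    assume "length us + length vs = Suc 0"
    then show "\<beta> (Tensor (us @ scC C a u # v # vs)) = \<beta> (Tensor (us @ u # scC C a v # vs))"
      using lin[of us "v # vs"] lin[of "us @ [u]" vs] by (simp add: functional_def)
  qed (use lin in auto)
  moreover have "classC C 3 (sweedler fscale (\<lambda>y z.
              sweedler fscale (\<lambda>y1 y2. tens [y1, y2, z]) (deltaC C y)) (deltaC C x))
        = classC C 3 (sweedler fscale (\<lambda>y z.
              sweedler fscale (\<lambda>z1 z2. tens [y, z1, z2]) (deltaC C z)) (deltaC C x))"
    using is_coalgebra by (simp add: is_coalgebra_def)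
  ultimately have "SW x (\<lambda>y z. SW y (\<lambda>y1 y2. \<beta> (Tensor [y1, y2, z])))
      = SW x (\<lambda>y z. SW z (\<lambda>z1 z2. \<beta> (Tensor [y, z1, z2])))"
    unfolding classC_def tensor_class_eq_iff by (simp add: pairing_sweedler)
  then show ?thesis by (simp only: \<beta>)
qed

lemma SW_counit:
  assumes "linC f"
  shows "SW x (\<lambda>y z. epsC C y * f z) = f x" "SW x (\<lambda>y z. epsC C z * f y) = f x"
proof -
  have "sweedler (scC C) (\<lambda>y z. scC C (epsC C y) z) (deltaC C x) = x"
    "sweedler (scC C) (\<lambda>y z. scC C (epsC C z) y) (deltaC C x) = x"
    using is_coalgebra by (simp_all add: is_coalgebra_def)
  from this[THEN arg_cong[of _ _ f]]
  show "SW x (\<lambda>y z. epsC C y * f z) = f x" "SW x (\<lambda>y z. epsC C z * f y) = f x"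
    by (simp_all add: functional_sweedler[OF assms] functional_scale[OF assms])
qed

text \<open>Exchange of the two middle legs x_(2) and x_(3): reassociation makes them the legs of a
  single element, where cocommutativity swaps them.\<close>

lemma SW_interchange:
  assumes F: "\<And>b c d. linC (\<lambda>a. F a b c d)" "\<And>a c d. linC (\<lambda>b. F a b c d)"
    "\<And>a b d. linC (\<lambda>c. F a b c d)" "\<And>a b c. linC (\<lambda>d. F a b c d)"
  shows "SW x (\<lambda>y z. SW y (\<lambda>a b. SW z (\<lambda>c d. F a b c d)))
    = SW x (\<lambda>y z. SW y (\<lambda>a c. SW z (\<lambda>b d. F a b c d)))"
proof -
  have "SW x (\<lambda>y z. SW y (\<lambda>a b. SW z (\<lambda>c d. F a b c d)))
      = SW x (\<lambda>a w. SW w (\<lambda>b v. SW v (\<lambda>c d. F a b c d)))"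
    by (rule SW_coassoc) (intro sw_functional SW_functional F)+
  also have "\<dots> = SW x (\<lambda>a w. SW w (\<lambda>c v. SW v (\<lambda>b d. F a b c d)))"
  proof -
    have "SW w (\<lambda>b v. SW v (\<lambda>c d. F a b c d)) = SW w (\<lambda>c v. SW v (\<lambda>b d. F a b c d))" for a w
    proof -
      have "SW w (\<lambda>b v. SW v (\<lambda>c d. F a b c d)) = SW w (\<lambda>s d. SW s (\<lambda>b c. F a b c d))"
        by (rule SW_coassoc[symmetric]) (intro F)+
      also have "\<dots> = SW w (\<lambda>s d. SW s (\<lambda>c b. F a b c d))"
        by (subst SW_cocomm) (intro F refl)+
      also have "\<dots> = SW w (\<lambda>c v. SW v (\<lambda>b d. F a b c d))"
        by (rule SW_coassoc) (intro F)+
      finally show ?thesis .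
    qed
    then show ?thesis by (simp only:)
  qed
  also have "SW x (\<lambda>a w. SW w (\<lambda>c v. SW v (\<lambda>b d. F a b c d)))
      = SW x (\<lambda>y z. SW y (\<lambda>a c. SW z (\<lambda>b d. F a b c d)))"
    by (rule SW_coassoc[symmetric]) (intro sw_functional SW_functional F)+
  finally show ?thesis .
qed

end

section \<open>Measurings of tensors\<close>

lemma functional_mult:
  assumes "k_algebra sc" "functional sc f"
  shows "functional sc (\<lambda>v. f (w * v))" "functional sc (\<lambda>v. f (v * w))"
proof -
  have "f (w * sc c v) = f (sc c (w * v))" "f (sc c v * w) = f (sc c (v * w))" for c v
    using assms(1) unfolding k_algebra_def by metis+
  with assms(2) show "functional sc (\<lambda>v. f (w * v))" "functional sc (\<lambda>v. f (v * w))"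
    by (simp_all add: functional_def distrib_left distrib_right)
qed

text \<open>
  The value of a functional \<open>b\<close> at \<open>x\<^sub>(\<^sub>1\<^sub>)(u\<^sup>1) \<otimes> \<dots> \<otimes> x\<^sub>(\<^sub>n\<^sub>)(u\<^sup>n)\<close>. Reading the empty tensor
  as the counit makes the recursion uniform, at the price of one more comultiplication than in
  \<^const>\<open>iter_comult\<close>.
\<close>

primrec meas ::
    "('k::field, 'c) coalgebra \<Rightarrow> ('c \<Rightarrow> 'u \<Rightarrow> 'v) \<Rightarrow> 'u list \<Rightarrow> 'c \<Rightarrow> ('v list \<Rightarrow> 'k) \<Rightarrow> 'k" where
  "meas C \<Psi> [] x b = epsC C x * b []"
| "meas C \<Psi> (u # us) x b = sw (\<lambda>y z. meas C \<Psi> us z (\<lambda>vs. b (\<Psi> y u # vs))) (deltaC C x)"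

lemma meas_cong:
  "(\<And>vs. length vs = length us \<Longrightarrow> b vs = b' vs) \<Longrightarrow> meas C \<Psi> us x b = meas C \<Psi> us x b'"
proof (induction us arbitrary: x b b')
  case (Cons u us)
  have "meas C \<Psi> us z (\<lambda>vs. b (\<Psi> y u # vs)) = meas C \<Psi> us z (\<lambda>vs. b' (\<Psi> y u # vs))" for y z
    by (rule Cons.IH) (simp add: Cons.prems)
  then show ?case by simp
qed simp

lemma meas_functional:
  assumes "\<And>vs. length vs = length us \<Longrightarrow> functional sc (\<lambda>y. b y vs)"
  shows "functional sc (\<lambda>y. meas C \<Psi> us x (b y))"
  using assms
proof (induction us arbitrary: x b)
  case Nil
  then show ?case by (simp add: functional_def algebra_simps)
next
  case (Cons u us)
  show ?case by (simp, intro sw_functional Cons.IH) (simp add: Cons.prems)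
qed

lemma meas_sw:
  "meas C \<Psi> us x (\<lambda>vs. sw (\<lambda>p q. F p q vs) P) = sw (\<lambda>p q. meas C \<Psi> us x (F p q)) P"
  by (induction us arbitrary: x F) (simp_all add: sw_scale[symmetric] sw_swap[of _ P])

lemma keys_iter_comult: "Poly_Mapping.keys (iter_comult C n x) \<subseteq> {xs. length xs = Suc n}"
proof (induction n arbitrary: x)
  case (Suc n)
  show ?case
    by (auto intro!: keys_sweedler keys_lin_ext dest: subsetD[OF Suc])
qed simp

lemma keys_measured_tensor:
  "us \<noteq> [] \<Longrightarrow> Poly_Mapping.keys (measured_tensor C \<Psi> x us) \<subseteq> tensor_gens (length us)"
  unfolding measured_tensor_def
  by (rule keys_lin_ext) (use keys_iter_comult in \<open>fastforce simp: tensor_gens_def\<close>)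

locale measured = cocommutative C
  for C :: "('k::field, 'c::ab_group_add) coalgebra" +
  fixes sc :: "'k \<Rightarrow> 'r \<Rightarrow> 'r::{ring, monoid_mult}" and sc' :: "'k \<Rightarrow> 's \<Rightarrow> 's::{ring, monoid_mult}"
    and \<Psi> :: "'c \<Rightarrow> 'r \<Rightarrow> 's"
  assumes algebra: "k_algebra sc'" and measuring: "algebra_measuring C sc sc' \<Psi>"
begin

lemma functional_measure:
  assumes "functional sc' f"
  shows "linC (\<lambda>x. f (\<Psi> x u))" "functional sc (\<lambda>u. f (\<Psi> x u))"
  using assms measuring by (simp_all add: functional_def algebra_measuring_def)

lemma functional_measure_mult:
  assumes "functional sc' f"
  shows "f (\<Psi> x (u * v)) = SW x (\<lambda>y z. f (\<Psi> y u * \<Psi> z v))"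
proof -
  have "\<Psi> x (u * v) = sweedler sc' (\<lambda>y z. \<Psi> y u * \<Psi> z v) (deltaC C x)"
    using measuring by (simp add: algebra_measuring_def)
  then show ?thesis by (simp add: functional_sweedler[OF assms])
qed

lemma functional_measure_one:
  assumes "functional sc' f"
  shows "f (\<Psi> x 1) = epsC C x * f 1"
  using measuring functional_scale[OF assms] by (simp add: algebra_measuring_def)

lemma linC_epsC: "linC (\<lambda>x. epsC C x * c)"
  using is_coalgebra by (simp add: functional_def is_coalgebra_def algebra_simps)

lemma meas_linC:
  assumes "multilinear sc' (length us) b"
  shows "linC (\<lambda>x. meas C \<Psi> us x b)"
  using assms
proof (induction us arbitrary: b)
  case Nil
  show ?case by (simp add: linC_epsC)
next
  case (Cons u us)
  note b = Cons.prems[unfolded length_Cons]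
  show ?case
    unfolding meas.simps
  proof (rule SW_functional)
    show "linC (\<lambda>y. meas C \<Psi> us z (\<lambda>vs. b (\<Psi> y u # vs)))" for z
      by (intro meas_functional functional_measure(1)) (rule multilinear_hd[OF b])
    show "linC (\<lambda>z. meas C \<Psi> us z (\<lambda>vs. b (\<Psi> y u # vs)))" for y
      by (intro Cons.IH multilinear_Cons b)
  qed
qed

lemma multilinear_meas_suffix:
  assumes "multilinear sc' (n + length ws) b"
  shows "multilinear sc' n (\<lambda>vs. meas C \<Psi> ws z (\<lambda>vs'. b (vs @ vs')))"
  unfolding multilinear_def
proof (intro allI impI meas_functional)
  fix us vs vs' :: "'s list"
  assume "length us + 1 + length vs = n" "length vs' = length ws"
  then show "functional sc' (\<lambda>u. b ((us @ u # vs) @ vs'))"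
    using multilinearD[OF assms, of us "vs @ vs'"] by simp
qed

lemma multilinear_prefix:
  assumes "multilinear sc' (length vs + n) b"
  shows "multilinear sc' n (\<lambda>vs'. b (vs @ vs'))"
  using multilinear_append[OF assms, of vs n "[]"] by simp

text \<open>Coassociativity for arbitrary lengths: the legs of x can be cut at any place into a
  block for \<open>us\<close> and a block for \<open>ws\<close>. If \<open>us\<close> is empty, its
  block carries the counit and disappears.\<close>

lemma meas_append:
  assumes "multilinear sc' (length us + length ws) b"
  shows "meas C \<Psi> (us @ ws) x b = SW x (\<lambda>y z. meas C \<Psi> us y (\<lambda>vs. meas C \<Psi> ws z (\<lambda>vs'. b (vs @ vs'))))"
  using assms
proof (induction us arbitrary: x b)
  case Nil
  then have "linC (\<lambda>x. meas C \<Psi> ws x b)" by (intro meas_linC) simp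
  from SW_counit(1)[OF this] show ?case by simp
next
  case (Cons u us)
  note b = Cons.prems[unfolded length_Cons add_Suc]
  let ?F = "\<lambda>y1 y2 z. meas C \<Psi> us y2 (\<lambda>vs. meas C \<Psi> ws z (\<lambda>vs'. b (\<Psi> y1 u # vs @ vs')))"
  have "meas C \<Psi> ((u # us) @ ws) x b = SW x (\<lambda>y z. SW z (\<lambda>z1 z2. ?F y z1 z2))"
    by (simp add: Cons.IH[OF multilinear_Cons[OF b]])
  also have "\<dots> = SW x (\<lambda>y z. SW y (\<lambda>y1 y2. ?F y1 y2 z))"
  proof (rule SW_coassoc[symmetric])
    show "linC (\<lambda>y1. ?F y1 y2 z)" for y2 z
      by (intro meas_functional functional_measure(1)) (rule multilinear_hd[OF b], simp)
    show "linC (\<lambda>y2. ?F y1 y2 z)" for y1 z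
      by (intro meas_linC multilinear_meas_suffix multilinear_Cons[OF b])
    show "linC (\<lambda>z. ?F y1 y2 z)" for y1 y2
    proof (intro meas_functional meas_linC)
      fix vs :: "'s list" assume "length vs = length us"
      then show "multilinear sc' (length ws) (\<lambda>vs'. b (\<Psi> y1 u # vs @ vs'))"
        using multilinear_prefix[of vs "length ws" "\<lambda>vs. b (\<Psi> y1 u # vs)"] multilinear_Cons[OF b]
        by simp
    qed
  qed
  finally show ?case by (simp add: meas_sw)
qed

lemma meas_single:
  assumes "multilinear sc' (Suc 0) b"
  shows "meas C \<Psi> [u] x b = b [\<Psi> x u]"
  using SW_counit(2)[OF functional_measure(1)[OF multilinear_hd[OF assms]]] by simp

text \<open>\<open>meas\<close> recurses from the left, while the cyclic operator singles out the
  last factor; this peels from the right.\<close>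

lemma meas_snoc:
  assumes "multilinear sc' (Suc (length us)) b"
  shows "meas C \<Psi> (us @ [u]) x b = SW x (\<lambda>y z. meas C \<Psi> us y (\<lambda>vs. b (vs @ [\<Psi> z u])))"
proof -
  have "meas C \<Psi> us y (\<lambda>vs. meas C \<Psi> [u] z (\<lambda>vs'. b (vs @ vs')))
      = meas C \<Psi> us y (\<lambda>vs. b (vs @ [\<Psi> z u]))" for y z
    by (intro meas_cong meas_single multilinear_prefix) (use assms in simp)
  then show ?thesis using assms by (subst meas_append) auto
qed

lemma multilinear_meas:
  assumes "multilinear sc' n b"
  shows "multilinear sc n (\<lambda>us. meas C \<Psi> us x b)"
  unfolding multilinear_def
proof (intro allI impI)
  fix us vs :: "'r list" assume n: "length us + 1 + length vs = n"
  show "functional sc (\<lambda>u. meas C \<Psi> (us @ u # vs) x b)"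
    using assms n
    by (subst meas_append, simp, simp,
        intro sw_functional meas_functional functional_measure(2) meas_functional)
      (drule multilinearD, auto)
qed

text \<open>\<open>iter_comult\<close> starts from a single factor whereas \<open>meas\<close>
  starts from none. The two recursions are therefore matched by an induction with base
  \<open>[u]\<close>, where \<open>meas_single\<close> removes the extra leg by the counit.\<close>

lemma pairing_measured_tensor:
  assumes "us \<noteq> []" "multilinear sc' (length us) (\<lambda>vs. \<beta> (Tensor vs))"
  shows "pairing \<beta> (measured_tensor C \<Psi> x us) = meas C \<Psi> us x (\<lambda>vs. \<beta> (Tensor vs))"
proof -
  have "pairing (\<lambda>xs. b (map2 \<Psi> xs us)) (iter_comult C (length us - 1) x) = meas C \<Psi> us x b"
    if "us \<noteq> []" "multilinear sc' (length us) b" for b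
    using that
  proof (induction us arbitrary: x b rule: induct_list012)
    case (2 u)
    then show ?case by (simp add: meas_single del: meas.simps)
  next
    case (3 u v us)
    have "multilinear sc' (length (v # us)) (\<lambda>vs. b (\<Psi> y u # vs))" for y
      by (rule multilinear_Cons) (use 3(4) in simp)
    from 3(2)[OF _ this] show ?case by (simp add: pairing_sweedler pairing_lin_ext del: meas.simps(2)) simp
  qed simp
  from this[OF assms] show ?thesis by (simp add: measured_tensor_def pairing_lin_ext)
qed

end

section \<open>Balanced functionals on lists\<close>

definition list_balanced ::
    "('k::field \<Rightarrow> 'u \<Rightarrow> 'u) \<Rightarrow> ('a \<Rightarrow> 'u \<Rightarrow> 'u) \<Rightarrow> ('a \<Rightarrow> 'u \<Rightarrow> 'u) \<Rightarrow> nat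
      \<Rightarrow> ('u::ab_group_add list \<Rightarrow> 'k) \<Rightarrow> bool" where
  "list_balanced sc r l n b \<longleftrightarrow> multilinear sc n b \<and>
     (\<forall>us a u v vs. length us + 2 + length vs = n \<longrightarrow> b (us @ r a u # v # vs) = b (us @ u # l a v # vs))"

lemma balanced_iff_list_balanced:
  "n > 0 \<Longrightarrow> balanced sc scB r l n \<beta> \<longleftrightarrow> list_balanced sc r l n (\<lambda>us. \<beta> (Tensor us))"
  by (simp add: balanced_def list_balanced_def multilinear_def)

lemma list_balanced_0: "list_balanced sc r l 0 b"
  by (simp add: list_balanced_def multilinear_def)

text \<open>Splits off the first factor, so that balancedness can be proved along the recursions of
  \<open>merge\<close>, \<open>ins\<close> and \<open>meas\<close>.\<close>

lemma list_balanced_Suc_iff: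
  "list_balanced sc r l (Suc n) b \<longleftrightarrow>
     (\<forall>vs. length vs = n \<longrightarrow> functional sc (\<lambda>u. b (u # vs))) \<and>
     (\<forall>a u v vs. Suc (length vs) = n \<longrightarrow> b (r a u # v # vs) = b (u # l a v # vs)) \<and>
     (\<forall>u. list_balanced sc r l n (\<lambda>vs. b (u # vs)))" (is "_ \<longleftrightarrow> ?R")
proof
  assume L: "list_balanced sc r l (Suc n) b"
  have "b (u # us @ r a p # q # vs) = b (u # us @ p # l a q # vs)"
    if "length us + 2 + length vs = n" for u us a p q vs
    using that L[unfolded list_balanced_def, THEN conjunct2, rule_format, of "u # us" vs a p q] by simp
  moreover have "b (r a u # v # vs) = b (u # l a v # vs)" if "Suc (length vs) = n" for a u v vs
    using that L[unfolded list_balanced_def, THEN conjunct2, rule_format, of "[]" vs a u v] by simp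
  ultimately show ?R
    using L by (auto simp: list_balanced_def intro: multilinear_Cons multilinear_hd)
next
  assume R: ?R
  show "list_balanced sc r l (Suc n) b"
    unfolding list_balanced_def multilinear_def
  proof (intro conjI allI impI)
    fix us vs :: "'b list" assume "length us + 1 + length vs = Suc n"
    then show "functional sc (\<lambda>u. b (us @ u # vs))"
      using R by (cases us) (auto simp: list_balanced_def multilinear_def)
  next
    fix us vs :: "'b list" and a u v assume "length us + 2 + length vs = Suc n"
    then show "b (us @ r a u # v # vs) = b (us @ u # l a v # vs)"
      using R by (cases us) (auto simp: list_balanced_def)
  qed
qed

lemma list_balanced_multilinear: "list_balanced sc r l n b \<Longrightarrow> multilinear sc n b"
  by (simp add: list_balanced_def)

lemma list_balanced_rel:
  "list_balanced sc r l n b \<Longrightarrow> length us + 2 + length vs = n \<Longrightarrow>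
    b (us @ r a u # v # vs) = b (us @ u # l a v # vs)"
  by (simp add: list_balanced_def)

text \<open>The common shape of all faces in degree at least two: two neighbouring factors become
  one. Keeping \<mu> abstract covers d_0 and d_n, where one of the two factors goes through a counit
  first.\<close>

definition merge :: "nat \<Rightarrow> ('u \<Rightarrow> 'u \<Rightarrow> 'u) \<Rightarrow> 'u list \<Rightarrow> 'u list" where
  "merge j \<mu> us = take j us @ \<mu> (us ! j) (us ! Suc j) # drop (Suc (Suc j)) us"

lemma merge_0 [simp]: "merge 0 \<mu> (u # v # us) = \<mu> u v # us"
  and merge_Suc [simp]: "merge (Suc j) \<mu> (u # us) = u # merge j \<mu> us"
  by (simp_all add: merge_def)

lemma length_merge: "Suc j < length us \<Longrightarrow> length (merge j \<mu> us) = length us - 1"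
  by (simp add: merge_def)

text \<open>A relation between the two merged factors is \<open>mid\<close>; a relation between the
  merged factor and a neighbour uses the linearity of \<mu> on that side. \<open>left\<close> and
  \<open>right\<close> are demanded only if there is a neighbour on that side, which admits the
  outer faces d_0 and d_n.\<close>

lemma list_balanced_merge:
  assumes "list_balanced sc r l n b" "j < n"
    and lin: "\<And>f v. functional sc f \<Longrightarrow> functional sc (\<lambda>u. f (\<mu> u v))"
      "\<And>f u. functional sc f \<Longrightarrow> functional sc (\<lambda>v. f (\<mu> u v))"
    and mid: "\<And>a u v. \<mu> (r a u) v = \<mu> u (l a v)"
    and left: "\<And>a u v. j > 0 \<Longrightarrow> \<mu> (l a u) v = l a (\<mu> u v)"
    and right: "\<And>a u v. Suc j < n \<Longrightarrow> \<mu> u (r a v) = r a (\<mu> u v)"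
  shows "list_balanced sc r l (Suc n) (\<lambda>us. b (merge j \<mu> us))"
  using assms(1,2) left right
proof (induction j arbitrary: n b)
  case 0
  then obtain m where n: "n = Suc m" by (cases n) auto
  note b = 0(1)[unfolded n list_balanced_Suc_iff]
  have "functional sc (\<lambda>u. b (\<mu> u v # vs))" "functional sc (\<lambda>u. b (\<mu> v u # vs))"
    if "length vs = m" for v vs
    using that b lin[of "\<lambda>u. b (u # vs)"] by simp_all
  then show ?case
    unfolding n list_balanced_Suc_iff using b 0(4) mid n
    by (auto simp: length_Suc_conv)
next
  case (Suc j)
  then obtain m where n: "n = Suc m" by (cases n) auto
  note b = Suc.prems(1)[unfolded n list_balanced_Suc_iff]
  have IH: "list_balanced sc r l n (\<lambda>us. b (u # merge j \<mu> us))" for u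
    unfolding n using b Suc.prems n by (intro Suc.IH) auto
  have "b (r a u # merge j \<mu> (v # vs)) = b (u # merge j \<mu> (l a v # vs))"
    if len: "Suc (length vs) = n" for a u v vs
  \<comment> \<open>For \<open>j = 0\<close> the neighbour \<open>v\<close> is itself merged with
    its successor, and \<open>left\<close> takes the scalar out of \<mu>. Otherwise the merge
    happens further to the right.\<close>
  proof (cases j)
    case 0
    then obtain v' vs' where "vs = v' # vs'" using len Suc.prems(2) by (cases vs) auto
    then show ?thesis using 0 b that n Suc.prems(3) by simp
  next
    case (Suc i)
    have "length (merge i \<mu> vs) = length vs - 1"
      using Suc Suc.prems(2) that by (intro length_merge) simp
    then show ?thesis using Suc b that n Suc.prems(2) by simp
  qed
  moreover have "functional sc (\<lambda>u. b (u # merge j \<mu> vs))" if "length vs = n" for vs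
    using b that n Suc.prems(2) length_merge[of j vs \<mu>] by simp
  ultimately show ?case
    unfolding list_balanced_Suc_iff[of _ _ _ n] using IH by simp
qed

definition ins :: "nat \<Rightarrow> 'u \<Rightarrow> 'u list \<Rightarrow> 'u list" where
  "ins j e us = take j us @ e # drop j us"

lemma ins_0 [simp]: "ins 0 e us = e # us"
  and ins_Suc [simp]: "ins (Suc j) e (u # us) = u # ins j e us"
  by (simp_all add: ins_def)

lemma length_ins: "length (ins j e us) = Suc (length us)"
  by (simp add: ins_def)

text \<open>A scalar crosses the inserted factor because it acts on \<open>e\<close> equally from
  both sides; in the application \<open>e\<close> is the unit.\<close>

lemma list_balanced_ins:
  assumes "list_balanced sc r l (Suc n) b" "j \<le> n" and e: "\<And>a. r a e = l a e"
  shows "list_balanced sc r l n (\<lambda>us. b (ins j e us))"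
  using assms(1,2)
proof (induction j arbitrary: n b)
  case 0
  then show ?case by (simp add: list_balanced_Suc_iff[of _ _ _ n])
next
  case (Suc j)
  then obtain m where n: "n = Suc m" by (cases n) auto
  note b = Suc.prems(1)[unfolded list_balanced_Suc_iff[of _ _ _ n]]
  have IH: "list_balanced sc r l m (\<lambda>us. b (u # ins j e us))" for u
    using b Suc.prems(2) n by (intro Suc.IH) auto
  have "b (r a u # ins j e (v # vs)) = b (u # ins j e (l a v # vs))"
    if "Suc (length vs) = m" for a u v vs
  proof (cases j)
    case 0
    have "b (u # r a e # v # vs) = b (u # e # l a v # vs)"
      using list_balanced_rel[OF Suc.prems(1), of "[u]" vs a e v] that n by simp
    then show ?thesis using 0 b that n e by simp
  next
    case (Suc i)
    then show ?thesis using b that n by (simp add: length_ins)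
  qed
  moreover have "functional sc (\<lambda>u. b (u # ins j e vs))" if "length vs = m" for vs
    using b that n by (simp add: length_ins)
  ultimately show ?case
    unfolding n list_balanced_Suc_iff[of _ _ _ m] using IH by simp
qed

section \<open>Hopf algebroids\<close>

text \<open>Scalar-valued counterpart of \<open>sweedler_list\<close>: what remains of it after
  pairing with a functional.\<close>

primrec swl ::
    "('k::field, 'u, 'a) hopf_algebroid \<Rightarrow> 'u list \<Rightarrow> ('u list \<Rightarrow> 'u list \<Rightarrow> 'k) \<Rightarrow> 'k" where
  "swl H [] f = f [] []"
| "swl H (u # us) f = sw (\<lambda>p q. swl H us (\<lambda>ps qs. f (p # ps) (q # qs))) (deltaL H u)"

lemma pairing_sweedler_list:
  "pairing \<beta> (sweedler_list H F us) = swl H us (\<lambda>ps qs. pairing \<beta> (F ps qs))"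
  by (induction us arbitrary: F) (simp_all add: pairing_sweedler)

lemma keys_sweedler_list:
  assumes "\<And>ps qs. length ps = length us \<Longrightarrow> Poly_Mapping.keys (F ps qs) \<subseteq> G"
  shows "Poly_Mapping.keys (sweedler_list H F us) \<subseteq> G"
  using assms
proof (induction us arbitrary: F)
  case (Cons u us)
  show ?case by (simp, intro keys_sweedler Cons.IH Cons.prems) simp
qed simp

lemma swl_cong:
  "(\<And>ps qs. length ps = length us \<Longrightarrow> length qs = length us \<Longrightarrow> f ps qs = f' ps qs)
    \<Longrightarrow> swl H us f = swl H us f'"
proof (induction us arbitrary: f f')
  case (Cons u us)
  have "swl H us (\<lambda>ps qs. f (p # ps) (q # qs)) = swl H us (\<lambda>ps qs. f' (p # ps) (q # qs))" for p q
    by (rule Cons.IH) (simp add: Cons.prems)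
  then show ?case by simp
qed simp

lemma swl_functional:
  assumes "\<And>ps qs. length ps = length us \<Longrightarrow> length qs = length us \<Longrightarrow> functional sc (\<lambda>y. f y ps qs)"
  shows "functional sc (\<lambda>y. swl H us (f y))"
  using assms
proof (induction us arbitrary: f)
  case (Cons u us)
  show ?case by (simp, intro sw_functional Cons.IH) (simp add: Cons.prems)
qed simp

lemma swl_sw:
  "swl H us (\<lambda>ps qs. sw (\<lambda>p q. F p q ps qs) P) = sw (\<lambda>p q. swl H us (F p q)) P"
  by (induction us arbitrary: F) (simp_all add: sw_swap[of _ P])

lemma swl_append:
  "swl H (us @ vs) f = swl H us (\<lambda>ps qs. swl H vs (\<lambda>ps' qs'. f (ps @ ps') (qs @ qs')))"
  by (induction us arbitrary: f) simp_all

lemma swl_Cons_inner: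
  "swl H us (\<lambda>ps qs. swl H (v # vs) (f ps qs))
    = sw (\<lambda>p q. swl H us (\<lambda>ps qs. swl H vs (\<lambda>ps' qs'. f ps qs (p # ps') (q # qs')))) (deltaL H v)"
  by (simp add: swl_sw)

lemma swl_swap:
  "swl H us (\<lambda>ps qs. swl H vs (\<lambda>ps' qs'. f ps qs ps' qs'))
    = swl H vs (\<lambda>ps' qs'. swl H us (\<lambda>ps qs. f ps qs ps' qs'))"
  by (induction us arbitrary: f) (simp_all add: swl_sw)

lemma swl_snoc:
  "swl H (us @ [u]) f = sw (\<lambda>p q. swl H us (\<lambda>ps qs. f (ps @ [p]) (qs @ [q]))) (deltaL H u)"
  by (simp add: swl_append swl_sw)

lemma balanced2_swl:
  assumes "\<And>ps qs. length ps = length us \<Longrightarrow> length qs = length us \<Longrightarrow> balanced2 sc r l (\<lambda>p q. F p q ps qs)"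
  shows "balanced2 sc r l (\<lambda>p q. swl H us (F p q))"
proof (rule balanced2I)
  show "functional sc (\<lambda>p. swl H us (F p q))" for q
    by (rule swl_functional) (use assms in \<open>simp add: balanced2_def\<close>)
  show "functional sc (\<lambda>q. swl H us (F p q))" for p
    by (rule swl_functional) (use assms in \<open>simp add: balanced2_def\<close>)
  show "swl H us (F (r a p) q) = swl H us (F p (l a q))" for a p q
    by (rule swl_cong) (use assms in \<open>simp add: balanced2_def\<close>)
qed

section \<open>The Hopf algebroid axioms seen through functionals, and the pull-back along the
  cyclic operator\<close>

locale hopf =
  fixes H :: "('k::field, 'u::{ring, monoid_mult}, 'a::{ring, monoid_mult}) hopf_algebroid"
  assumes hopf: "is_hopf_algebroid H"
begin

abbreviation "lin \<equiv> functional (scU H)"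
abbreviation "balL \<equiv> balanced2 (scU H) (\<lambda>a u. tL H a * u) (\<lambda>a u. sL H a * u)"
abbreviation "balR \<equiv> list_balanced (scU H) (\<lambda>a u. u * tL H a) (\<lambda>a u. tL H a * u)"
abbreviation "S \<equiv> antipode H"

lemma bialgebroid: "left_bialgebroid H"
  using hopf by (simp add: is_hopf_algebroid_def)

lemma algU: "k_algebra (scU H)"
  and sL_1: "sL H 1 = 1"
  and tL_add: "tL H (a + b) = tL H a + tL H b" and tL_scale: "tL H (scA H c a) = scU H c (tL H a)"
  and tL_mult: "tL H (a * b) = tL H b * tL H a" and tL_1: "tL H 1 = 1"
  and sL_tL: "sL H a * tL H b = tL H b * sL H a"
  and epsL_add: "epsL H (u + v) = epsL H u + epsL H v"
  and epsL_scale: "epsL H (scU H c u) = scA H c (epsL H u)"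
  using bialgebroid unfolding left_bialgebroid_def by iprover+

lemma S_add: "S (u + v) = S u + S v" and S_scale: "S (scU H c u) = scU H c (S u)"
  and S_mult: "S (u * v) = S v * S u" and S_S: "S (S u) = u"
  and S_tL: "S (tL H a) = sL H a"
  using hopf unfolding is_hopf_algebroid_def by iprover+

lemma S_sL: "S (sL H a) = tL H a"
  by (metis S_S S_tL)

lemma epsL_bimodule: "epsL H (sL H a * tL H b * u) = a * epsL H u * b"
  using bialgebroid unfolding left_bialgebroid_def by iprover

lemma epsL_sL: "epsL H (sL H a * u) = a * epsL H u"
  and epsL_tL: "epsL H (tL H a * u) = epsL H u * a"
  using epsL_bimodule[of a 1 u] epsL_bimodule[of 1 a u] by (simp_all add: sL_1 tL_1)

lemma scU_mult: "scU H c u * v = scU H c (u * v)" "u * scU H c v = scU H c (u * v)"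
  using algU unfolding k_algebra_def by metis+

lemma lin_mult: "lin f \<Longrightarrow> lin (\<lambda>u. f (v * u))" "lin f \<Longrightarrow> lin (\<lambda>u. f (u * v))"
  by (rule functional_mult[OF algU], assumption)+

lemma lin_S: "lin f \<Longrightarrow> lin (\<lambda>u. f (S u))"
  by (rule functional_comp[of "scU H"]) (simp_all add: S_add S_scale)

lemma balL_D: "balL F \<Longrightarrow> lin (\<lambda>p. F p q)" "balL F \<Longrightarrow> lin (F p)"
  "balL F \<Longrightarrow> F (tL H a * p) q = F p (sL H a * q)"
  by (simp_all add: balanced2_def)

lemma classL_deltaL: "classL H 2 (deltaL H u) = DeltaL H u"
proof -
  have "DeltaL H u \<in> carrier (tensL H 2)"
    using bialgebroid unfolding left_bialgebroid_def by iprover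
  then show ?thesis
    unfolding tensL_def classL_def deltaL_def by (rule representative_tensor_class)
qed

lemma sw_classL_cong:
  assumes "classL H 2 P = classL H 2 Q" "balL F"
  shows "sw F P = sw F Q"
  using sw_tensor_class_cong[OF assms(1)[unfolded classL_def] assms(2)] .

lemma sw_deltaL_eq:
  assumes "DeltaL H u = classL H 2 P" "balL F"
  shows "sw F (deltaL H u) = sw F P"
  using assms by (intro sw_classL_cong) (simp_all add: classL_deltaL)

lemma sw_deltaL_functional:
  assumes "balL F"
  shows "lin (\<lambda>u. sw F (deltaL H u))"
proof (rule functionalI)
  fix u v c
  have "DeltaL H (u + v) = DeltaL H u \<oplus>\<^bsub>tensL H 2\<^esub> DeltaL H v"
    "DeltaL H (scU H c u) = c \<odot>\<^bsub>tensL H 2\<^esub> DeltaL H u"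
    using bialgebroid unfolding left_bialgebroid_def by iprover+
  then have "DeltaL H (u + v) = classL H 2 (deltaL H u + deltaL H v)"
    "DeltaL H (scU H c u) = classL H 2 (fscale c (deltaL H u))"
    by (simp_all add: classL_deltaL[symmetric] classL_def tensL_def add_tensor_power smult_tensor_power)
  from this[THEN sw_deltaL_eq, OF assms]
  show "sw F (deltaL H (u + v)) = sw F (deltaL H u) + sw F (deltaL H v)"
    "sw F (deltaL H (scU H c u)) = c * sw F (deltaL H u)"
    by (simp_all add: sweedler_eq_lin_ext pairing_add pairing_fscale)
qed

lemma sw_deltaL_Takeuchi:
  assumes "balL F"
  shows "sw (\<lambda>p q. F (p * tL H a) q) (deltaL H u) = sw (\<lambda>p q. F p (q * sL H a)) (deltaL H u)"
proof -
  have "classL H 2 (sweedler fscale (\<lambda>p q. tens [p * tL H a, q]) (deltaL H u))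
      = classL H 2 (sweedler fscale (\<lambda>p q. tens [p, q * sL H a]) (deltaL H u))"
    using bialgebroid unfolding left_bialgebroid_def by iprover
  from sw_classL_cong[OF this assms] show ?thesis
    by (simp add: sweedler_eq_lin_ext[of _ F] pairing_sweedler)
qed

text \<open>The legs of \<open>v\<close> are summed outside, so that the inner sum is a functional
  of these legs to which coproduct rules for \<open>v\<close> can be applied next.\<close>

lemma sw_deltaL_mult:
  assumes "balL F"
  shows "sw F (deltaL H (u * v))
    = sw (\<lambda>p' q'. sw (\<lambda>p q. F (p * p') (q * q')) (deltaL H u)) (deltaL H v)"
proof -
  have "DeltaL H (u * v) = classL H 2 (sweedler fscale (\<lambda>p q.
      sweedler fscale (\<lambda>p' q'. tens [p * p', q * q']) (deltaL H v)) (deltaL H u))"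
    using bialgebroid unfolding left_bialgebroid_def by iprover
  from sw_deltaL_eq[OF this assms] show ?thesis
    by (simp add: sweedler_eq_lin_ext[of _ F] pairing_sweedler) (rule sw_swap)
qed

lemma sw_deltaL_tL:
  assumes "balL F"
  shows "sw F (deltaL H (tL H a * u)) = sw (\<lambda>p q. F p (tL H a * q)) (deltaL H u)"
proof -
  have "DeltaL H (sL H 1 * tL H a * u)
      = classL H 2 (sweedler fscale (\<lambda>p q. tens [sL H 1 * p, tL H a * q]) (deltaL H u))"
    using bialgebroid unfolding left_bialgebroid_def by iprover
  then have "DeltaL H (tL H a * u)
      = classL H 2 (sweedler fscale (\<lambda>p q. tens [p, tL H a * q]) (deltaL H u))"
    by (simp add: sL_1)
  from sw_deltaL_eq[OF this assms] show ?thesis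
    by (simp add: sweedler_eq_lin_ext[of _ F] pairing_sweedler)
qed

lemma sw_deltaL_one:
  assumes "balL F"
  shows "sw F (deltaL H 1) = F 1 1"
proof -
  have "DeltaL H 1 = classL H 2 (tens [1, 1])"
    using bialgebroid unfolding left_bialgebroid_def by iprover
  from sw_deltaL_eq[OF this assms] show ?thesis by (simp add: sweedler_eq_lin_ext)
qed

text \<open>The bimodule axiom controls left multiplication by t_L(a). Right multiplication is
  reduced to it by multiplicativity, since t_L(a) has coproduct 1 \<otimes> t_L(a). For this the sum
  over the legs of \<open>u\<close> must be balanced as a functional of the legs of t_L(a), which is
  the Takeuchi condition for \<open>u\<close>.\<close>

lemma sw_deltaL_mult_tL:
  assumes F: "balL F"
  shows "sw F (deltaL H (u * tL H a)) = sw (\<lambda>p q. F p (q * tL H a)) (deltaL H u)"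
proof -
  have inner: "balL (\<lambda>p q. F (p * p') (q * q'))" for p' q'
    by (rule balanced2I) (use F in \<open>auto simp: mult.assoc intro: lin_mult balL_D\<close>)
  have F': "balL (\<lambda>p' q'. sw (\<lambda>p q. F (p * p') (q * q')) (deltaL H u))"
  proof (rule balanced2I)
    fix b p' q'
    have "sw (\<lambda>p q. F (p * (tL H b * p')) (q * q')) (deltaL H u)
        = sw (\<lambda>p q. F ((p * tL H b) * p') (q * q')) (deltaL H u)"
      by (simp add: mult.assoc)
    also have "\<dots> = sw (\<lambda>p q. F (p * p') ((q * sL H b) * q')) (deltaL H u)"
      by (rule sw_deltaL_Takeuchi[OF inner])
    finally show "sw (\<lambda>p q. F (p * (tL H b * p')) (q * q')) (deltaL H u)
        = sw (\<lambda>p q. F (p * p') (q * (sL H b * q'))) (deltaL H u)"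
      by (simp add: mult.assoc)
  qed (intro sw_functional lin_mult balL_D[OF F])+
  have F'': "balL (\<lambda>p' q'. sw (\<lambda>p q. F (p * p') (q * (tL H a * q'))) (deltaL H u))"
  proof (rule balanced2I)
    fix b p' q'
    have "sL H b * (tL H a * q') = tL H a * (sL H b * q')"
      by (simp only: mult.assoc[symmetric] sL_tL)
    then show "sw (\<lambda>p q. F (p * (tL H b * p')) (q * (tL H a * q'))) (deltaL H u)
        = sw (\<lambda>p q. F (p * p') (q * (tL H a * (sL H b * q')))) (deltaL H u)"
      using balL_D(3)[OF F', of b p' "tL H a * q'"] by simp
  next
    show "lin (\<lambda>q'. sw (\<lambda>p q. F (p * p') (q * (tL H a * q'))) (deltaL H u))" for p'
      by (rule lin_mult(1)[OF balL_D(2)[OF F']])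
  qed (rule balL_D(1)[OF F'])
  \<comment> \<open>Writing t_L(a) as \<open>tL H a * 1\<close> lets the rule for left
    multiplication and the coproduct of \<open>1\<close> apply in turn; \<open>F'\<close> licenses
    the first and \<open>F''\<close> the second.\<close>
  have "sw F (deltaL H (u * tL H a))
      = sw (\<lambda>p' q'. sw (\<lambda>p q. F (p * p') (q * q')) (deltaL H u)) (deltaL H (tL H a * 1))"
    unfolding sw_deltaL_mult[OF F] mult_1_right ..
  also have "\<dots> = sw (\<lambda>p q. F p (q * tL H a)) (deltaL H u)"
    by (subst sw_deltaL_tL[OF F']) (simp add: sw_deltaL_one[OF F''])
  finally show ?thesis .
qed

text \<open>Conditions on a balanced functional of \<open>n + 1\<close> factors once its first
  argument is written as \<open>S c\<close>. Since S(s_L(a) c) = S(c) t_L(a), the balancing between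
  \<open>S c\<close> and the first remaining factor becomes the last clause.\<close>

definition cyc_balanced :: "nat \<Rightarrow> ('u list \<Rightarrow> 'u \<Rightarrow> 'k) \<Rightarrow> bool" where
  "cyc_balanced n f \<longleftrightarrow>
     (\<forall>c. balR n (\<lambda>ps. f ps c)) \<and> (\<forall>ps. length ps = n \<longrightarrow> lin (f ps)) \<and>
     (\<forall>a p ps c. Suc (length ps) = n \<longrightarrow> f (tL H a * p # ps) c = f (p # ps) (sL H a * c))"

lemma cyc_balanced_antipode:
  assumes "balR (Suc n) b"
  shows "cyc_balanced n (\<lambda>ps c. b (S c # ps))"
  using assms unfolding cyc_balanced_def list_balanced_Suc_iff
  by (auto simp: S_mult S_sL intro: lin_S)

lemma cyc_balancedD:
  assumes "cyc_balanced n f"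
  shows "length us + 1 + length vs = n \<Longrightarrow> lin (\<lambda>u. f (us @ u # vs) c)"
    and "length us + 2 + length vs = n \<Longrightarrow> f (us @ u * tL H a # v # vs) c = f (us @ u # tL H a * v # vs) c"
    and "length us = n \<Longrightarrow> lin (f us)"
    and "Suc (length us) = n \<Longrightarrow> f (tL H a * u # us) c = f (u # us) (sL H a * c)"
  using assms unfolding cyc_balanced_def
  by (auto simp: list_balanced_def multilinear_def)

text \<open>
  A single slot of the cyclic operator is not balanced by itself: moving \<open>t\<^sub>L(a)\<close> to the left
  neighbour changes the latter's coproduct, and this is absorbed by the Takeuchi condition,
  slot by slot down to the first one.
\<close>

lemma balL_cyc_slot:
  assumes "cyc_balanced n f" "length us + 1 + length vs = n"
  shows "balL (\<lambda>p q. swl H us (\<lambda>ps qs. f (ps @ p # vs) (prod_list qs * q * c)))"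
  using assms(2)
proof (induction us arbitrary: vs c rule: rev_induct)
  case Nil
  then show ?case
    using cyc_balancedD(1)[OF assms(1), of "[]" vs] cyc_balancedD(4)[OF assms(1), of vs]
    by (auto intro!: balanced2I lin_mult cyc_balancedD(3)[OF assms(1)] simp: mult.assoc)
next
  case (snoc u us)
  \<comment> \<open>The slot is now that of \<open>u\<close>: \<open>p\<close> has joined the fixed
    factors on the right, and \<open>c\<close> is general so that \<open>q\<close> can be absorbed
    into it.\<close>
  have IH: "balL (\<lambda>p0 q0. swl H us (\<lambda>ps qs. f (ps @ p0 # p # vs) (prod_list qs * q0 * c)))" for p c
    using snoc by simp
  show ?case
  proof (rule balanced2I)
    fix a p q
    have "swl H (us @ [u]) (\<lambda>ps qs. f (ps @ tL H a * p # vs) (prod_list qs * q * c))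
        = sw (\<lambda>p0 q0. swl H us (\<lambda>ps qs. f (ps @ p0 # tL H a * p # vs) (prod_list qs * q0 * (q * c))))
            (deltaL H u)"
      by (simp add: swl_snoc mult.assoc)
    also have "\<dots> = sw (\<lambda>p0 q0. swl H us (\<lambda>ps qs. f (ps @ p0 * tL H a # p # vs) (prod_list qs * q0 * (q * c))))
            (deltaL H u)"
    proof -
      have "swl H us (\<lambda>ps qs. f (ps @ p0 # tL H a * p # vs) (prod_list qs * q0 * (q * c)))
          = swl H us (\<lambda>ps qs. f (ps @ p0 * tL H a # p # vs) (prod_list qs * q0 * (q * c)))" for p0 q0
        using snoc.prems by (intro swl_cong cyc_balancedD(2)[OF assms(1), symmetric]) simp
      then show ?thesis by simp
    qed
    also have "\<dots> = sw (\<lambda>p0 q0. swl H us (\<lambda>ps qs. f (ps @ p0 # p # vs) (prod_list qs * (q0 * sL H a) * (q * c))))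
            (deltaL H u)"
      by (rule sw_deltaL_Takeuchi[OF IH])
    also have "\<dots> = swl H (us @ [u]) (\<lambda>ps qs. f (ps @ p # vs) (prod_list qs * (sL H a * q) * c))"
      by (simp add: swl_snoc mult.assoc)
    finally show "swl H (us @ [u]) (\<lambda>ps qs. f (ps @ tL H a * p # vs) (prod_list qs * q * c))
        = swl H (us @ [u]) (\<lambda>ps qs. f (ps @ p # vs) (prod_list qs * (sL H a * q) * c))" .
  next
    show "lin (\<lambda>p. swl H (us @ [u]) (\<lambda>ps qs. f (ps @ p # vs) (prod_list qs * q * c)))" for q
      using snoc.prems by (intro swl_functional cyc_balancedD(1)[OF assms(1)]) simp
    show "lin (\<lambda>q. swl H (us @ [u]) (\<lambda>ps qs. f (ps @ p # vs) (prod_list qs * q * c)))" for p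
      using snoc.prems by (intro swl_functional lin_mult cyc_balancedD(3)[OF assms(1)]) simp
  qed
qed

text \<open>Here the factors to the right of the slot are comultiplied too. For fixed legs of these
  it is the previous statement, and Sweedler sums of balanced functionals are balanced.\<close>

lemma balL_cyc_slot':
  assumes "cyc_balanced n f" "length us + 1 + length vs = n"
  shows "balL (\<lambda>p q. swl H us (\<lambda>ps qs. swl H vs (\<lambda>ps' qs'.
    f (ps @ p # ps') (prod_list qs * (q * (d * (prod_list qs' * w)))))))"
proof -
  have "balL (\<lambda>p q. swl H vs (\<lambda>ps' qs'. swl H us (\<lambda>ps qs.
    f (ps @ p # ps') (prod_list qs * q * (d * (prod_list qs' * w))))))"
    using assms(2) by (intro balanced2_swl balL_cyc_slot[OF assms(1)]) simp
  then show ?thesis by (subst swl_swap) (simp add: mult.assoc)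
qed

text \<open>For \<open>f ps c = b (S c # ps)\<close> this is the pull-back of \<open>b\<close> along
  the cyclic operator. An abstract \<open>f\<close> allows the same formula with \<open>b\<close>
  replaced by a measured functional.\<close>

definition cyc_pull :: "('u list \<Rightarrow> 'u \<Rightarrow> 'k) \<Rightarrow> 'u list \<Rightarrow> 'k" where
  "cyc_pull f us = swl H (butlast us) (\<lambda>ps qs. f ps (prod_list qs * last us))"

text \<open>Both sides of a balancing relation insert t_L(a) at the same place between second legs:
  u t_L(a) has coproduct u_(1) \<otimes> u_(2) t_L(a), and t_L(a) v has v_(1) \<otimes> t_L(a)
  v_(2). If \<open>v\<close> is the last factor, it enters the product whole. Linearity in a
  comultiplied factor also rests on the balanced slot, as \<open>deltaL\<close> is a choice.\<close>

lemma list_balanced_cyc_pull: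
  assumes f: "cyc_balanced n f"
  shows "balR (Suc n) (cyc_pull f)"
  unfolding list_balanced_def multilinear_def
proof (intro conjI allI impI)
  fix us vs :: "'u list" assume n: "length us + 1 + length vs = Suc n"
  show "lin (\<lambda>u. cyc_pull f (us @ u # vs))"
  proof (cases vs rule: rev_cases)
    case Nil
    then show ?thesis
      using n by (auto simp: cyc_pull_def intro!: swl_functional lin_mult cyc_balancedD(3)[OF f])
  next
    case (snoc vs' w)
    \<comment> \<open>The factor \<open>1\<close> is the \<open>d\<close> of
      \<open>balL_cyc_slot'\<close>.\<close>
    have "cyc_pull f (us @ u # vs) = sw (\<lambda>p q. swl H us (\<lambda>ps qs. swl H vs' (\<lambda>ps' qs'.
        f (ps @ p # ps') (prod_list qs * (q * (1 * (prod_list qs' * w))))))) (deltaL H u)" for u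
      by (simp add: cyc_pull_def snoc butlast_append swl_append swl_Cons_inner mult.assoc del: swl.simps)
    then show ?thesis
      using n snoc by (simp only:, intro sw_deltaL_functional balL_cyc_slot'[OF f]) simp
  qed
next
  fix us vs :: "'u list" and a u v assume n: "length us + 2 + length vs = Suc n"
  show "cyc_pull f (us @ u * tL H a # v # vs) = cyc_pull f (us @ u # tL H a * v # vs)"
  proof (cases vs rule: rev_cases)
    case Nil
    have "balL (\<lambda>p q. swl H us (\<lambda>ps qs. f (ps @ [p]) (prod_list qs * q * v)))"
      by (rule balL_cyc_slot[OF f]) (use n Nil in simp)
    from sw_deltaL_mult_tL[OF this, of u a] show ?thesis
      by (simp add: cyc_pull_def Nil butlast_append swl_snoc mult.assoc)
  next
    case (snoc vs' w)
    \<comment> \<open>In \<open>1\<close> the slot is at \<open>u\<close>; in \<open>2\<close> it is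
      at \<open>v\<close>, with \<open>u\<close> among the factors to its left. The chain below
      passes from one to the other with t_L(a) standing between the second legs.\<close>
    have 1: "balL (\<lambda>p q. swl H us (\<lambda>ps qs. swl H (v # vs') (\<lambda>ps' qs'.
        f (ps @ p # ps') (prod_list qs * (q * (1 * (prod_list qs' * w)))))))"
      by (rule balL_cyc_slot'[OF f]) (use n snoc in simp)
    have 2: "balL (\<lambda>p q. swl H (us @ [u]) (\<lambda>ps qs. swl H vs' (\<lambda>ps' qs'.
        f (ps @ p # ps') (prod_list qs * (q * (1 * (prod_list qs' * w)))))))"
      by (rule balL_cyc_slot'[OF f]) (use n snoc in simp)
    have "cyc_pull f (us @ u * tL H a # v # vs)
        = sw (\<lambda>p q. swl H us (\<lambda>ps qs. swl H (v # vs') (\<lambda>ps' qs'.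
            f (ps @ p # ps') (prod_list qs * (q * (1 * (prod_list qs' * w))))))) (deltaL H (u * tL H a))"
      by (simp add: cyc_pull_def snoc butlast_append swl_append swl_Cons_inner mult.assoc del: swl.simps)
    also have "\<dots> = sw (\<lambda>p q. swl H us (\<lambda>ps qs. swl H (v # vs') (\<lambda>ps' qs'.
            f (ps @ p # ps') (prod_list qs * ((q * tL H a) * (1 * (prod_list qs' * w))))))) (deltaL H u)"
      by (rule sw_deltaL_mult_tL[OF 1])
    also have "\<dots> = swl H (us @ [u]) (\<lambda>ps qs. swl H (v # vs') (\<lambda>ps' qs'.
            f (ps @ ps') (prod_list qs * (tL H a * (prod_list qs' * w)))))"
      by (simp add: swl_snoc mult.assoc del: swl.simps)
    also have "\<dots> = sw (\<lambda>p q. swl H (us @ [u]) (\<lambda>ps qs. swl H vs' (\<lambda>ps' qs'.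
            f (ps @ p # ps') (prod_list qs * ((tL H a * q) * (1 * (prod_list qs' * w))))))) (deltaL H v)"
      by (simp add: swl_Cons_inner mult.assoc del: swl.simps)
    also have "\<dots> = sw (\<lambda>p q. swl H (us @ [u]) (\<lambda>ps qs. swl H vs' (\<lambda>ps' qs'.
            f (ps @ p # ps') (prod_list qs * (q * (1 * (prod_list qs' * w))))))) (deltaL H (tL H a * v))"
      by (rule sw_deltaL_tL[OF 2, symmetric])
    also have "\<dots> = swl H (us @ [u]) (\<lambda>ps qs. swl H ((tL H a * v) # vs') (\<lambda>ps' qs'.
            f (ps @ ps') (prod_list qs * (prod_list qs' * w))))"
      by (simp add: swl_Cons_inner mult.assoc del: swl.simps)
    also have "\<dots> = cyc_pull f (us @ u # tL H a * v # vs)"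
    proof -
      have *: "us @ u # (tL H a * v) # vs' = (us @ [u]) @ (tL H a * v) # vs'" by simp
      show ?thesis
        unfolding cyc_pull_def snoc
        by (simp add: butlast_append * swl_append[of H "us @ [u]"] mult.assoc
            del: swl.simps append_assoc append_Cons append_Nil)
    qed
    finally show ?thesis .
  qed
qed

end

lemma list_balanced_cong:
  assumes "list_balanced sc r l n b" "\<And>us. length us = n \<Longrightarrow> b' us = b us"
  shows "list_balanced sc r l n b'"
  using assms by (auto simp: list_balanced_def multilinear_def)

text \<open>A square of descended maps commutes if it does so on generators after pairing with
  balanced functionals. The first four assumptions make the four sides of the square well defined;
  \<open>h\<close> serves in both degrees.\<close>

lemma descend_commute:
  assumes "\<And>\<beta>. balanced sc scB r l m \<beta> \<Longrightarrow> balanced sc scB r l n (\<lambda>g. pairing \<beta> (d g))"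
    and "\<And>\<beta>. balanced sc' scB' r' l' m \<beta> \<Longrightarrow> balanced sc' scB' r' l' n (\<lambda>g. pairing \<beta> (d' g))"
    and "\<And>\<beta>. balanced sc' scB' r' l' m \<beta> \<Longrightarrow> balanced sc scB r l m (\<lambda>g. pairing \<beta> (h g))"
    and "\<And>\<beta>. balanced sc' scB' r' l' n \<beta> \<Longrightarrow> balanced sc scB r l n (\<lambda>g. pairing \<beta> (h g))"
    and eq: "\<And>g \<beta>. g \<in> tensor_gens n \<Longrightarrow> balanced sc' scB' r' l' m \<beta> \<Longrightarrow>
      pairing (\<lambda>g. pairing \<beta> (h g)) (d g) = pairing (\<lambda>g. pairing \<beta> (d' g)) (h g)"
    and z: "z \<in> carrier (tensor_power sc scB r l n)"
  shows "descend (tensor_rels sc' scB' r' l' m) h (descend (tensor_rels sc scB r l m) d z)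
    = descend (tensor_rels sc' scB' r' l' m) d' (descend (tensor_rels sc' scB' r' l' n) h z)"
proof -
  obtain Z where Z: "z = tensor_class sc scB r l n Z" "Poly_Mapping.keys Z \<subseteq> tensor_gens n"
    using z by (auto simp: carrier_tensor_power)
  have "pairing \<beta> (lin_ext fscale h (lin_ext fscale d Z)) = pairing \<beta> (lin_ext fscale d' (lin_ext fscale h Z))"
    if "balanced sc' scB' r' l' m \<beta>" for \<beta>
    unfolding pairing_lin_ext by (rule lin_ext_cong) (use Z(2) that eq in blast)
  then have "tensor_class sc' scB' r' l' m (lin_ext fscale h (lin_ext fscale d Z))
      = tensor_class sc' scB' r' l' m (lin_ext fscale d' (lin_ext fscale h Z))"
    by (simp add: tensor_class_eq_iff)
  moreover note descend_tensor_class[of sc scB r l m sc scB r l n d Z, OF assms(1)]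
    descend_tensor_class[of sc' scB' r' l' m sc' scB' r' l' n d', OF assms(2)]
    descend_tensor_class[of sc' scB' r' l' m sc scB r l m h, OF assms(3)]
    descend_tensor_class[of sc' scB' r' l' n sc scB r l n h, OF assms(4)]
  ultimately show ?thesis by (simp only: Z(1))
qed

section \<open>The cyclic structure maps\<close>

text \<open>With the counit built into the product for d_0 and d_n, every face in degree at least
  two multiplies two neighbours.\<close>

definition face_mult ::
    "('k::field, 'u::{ring, monoid_mult}, 'a::{ring, monoid_mult}) hopf_algebroid
      \<Rightarrow> nat \<Rightarrow> nat \<Rightarrow> 'u \<Rightarrow> 'u \<Rightarrow> 'u" where
  "face_mult H n i u v =
     (if i = 0 then tL H (epsR H u) * v else if i < n then u * v
      else u * tL H (epsR H (antipode H v)))"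

text \<open>\<open>min (i - 1) (n - 2)\<close> is the position of the left one of the two factors:
  truncated subtraction gives 0 for \<open>i = 0\<close>, inner faces give \<open>i - 1\<close>, and
  the minimum cuts \<open>i = n\<close> back to \<open>n - 2\<close>.\<close>

lemma face_gen_eq_merge:
  assumes "length us = n" "2 \<le> n" "i \<le> n"
  shows "face_gen H n i (Tensor us) = tens (merge (min (i - 1) (n - 2)) (face_mult H n i) us)"
proof -
  consider "i = 0" | "0 < i" "i < n" | "i = n" using assms by linarith
  then show ?thesis
  proof cases
    case 3
    have "Suc (n - 2) = n - 1" "Suc (Suc (n - 2)) = n" using assms by auto
    then show ?thesis
      using assms 3 by (simp add: face_gen_def merge_def face_mult_def[abs_def])
  qed (use assms in \<open>auto simp: face_gen_def merge_def face_mult_def[abs_def] min_def numeral_2_eq_2\<close>)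
qed

lemma keys_face_gen:
  assumes "g \<in> tensor_gens n" "1 \<le> n" "i \<le> n"
  shows "Poly_Mapping.keys (face_gen H n i g) \<subseteq> tensor_gens (n - 1)"
proof (cases "n = 1")
  case True
  with assms show ?thesis by (auto simp: tensor_gens_def face_gen_def split: if_splits)
next
  case False
  with assms obtain us where "g = Tensor us" "length us = n" by (auto simp: tensor_gens_def)
  then show ?thesis
    using False assms by (simp add: face_gen_eq_merge) (simp add: tensor_gens_def length_merge)
qed

lemma keys_cyc_gen:
  assumes "g \<in> tensor_gens n"
  shows "Poly_Mapping.keys (cyc_gen H g) \<subseteq> tensor_gens n"
proof (cases g)
  case (Tensor us)
  then have "length us = n" "n \<noteq> 0" using assms by (auto simp: tensor_gens_def split: if_splits)
  then show ?thesis
    unfolding Tensor cyc_gen_def tgen.case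
    by (intro keys_sweedler_list) (auto simp: tensor_gens_def)
qed (use assms in \<open>auto simp: tensor_gens_def cyc_gen_def split: if_splits\<close>)

context hopf
begin

abbreviation "balA \<equiv> balanced (scU H) (scA H) (\<lambda>a u. u * tL H a) (\<lambda>a u. tL H a * u)"

lemma epsR_add: "epsR H (u + v) = epsR H u + epsR H v"
  and epsR_scale: "epsR H (scU H c u) = scA H c (epsR H u)"
  and epsR_mult_tL: "epsR H (u * tL H a) = a * epsR H u"
  and epsR_S: "epsR H (S u) = epsL H u"
  by (simp_all add: epsR_def S_add S_scale S_mult S_tL S_S epsL_add epsL_scale epsL_sL)

lemma face_mult_lin:
  assumes "lin f"
  shows "lin (\<lambda>u. f (face_mult H n i u v))" "lin (\<lambda>v. f (face_mult H n i u v))"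
  using assms
  by (auto simp: functional_def face_mult_def epsR_S epsR_add epsR_scale epsL_add epsL_scale
      tL_add tL_scale scU_mult distrib_left distrib_right)

lemma balA_face:
  assumes "balA (n - 1) \<beta>" "1 \<le> n" "i \<le> n"
  shows "balA n (\<lambda>g. pairing \<beta> (face_gen H n i g))"
proof (cases "n = 1")
  case True
  \<comment> \<open>In degree one the target is A itself, presented by scalars, where a balanced
    functional is just a linear one.\<close>
  have "functional (scA H) (\<lambda>a. \<beta> (Scalar a))"
    using assms(1) True by (simp add: balanced_def)
  then show ?thesis
    using True
    by (auto simp: balanced_def face_gen_def functional_def epsR_add epsR_scale S_add S_scale)
next
  case False
  with assms obtain m where n: "n = Suc m" "m > 0" by (cases n) auto
  let ?j = "min (i - 1) (n - 2)"
  have b: "balR m (\<lambda>us. \<beta> (Tensor us))"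
    using assms n by (simp add: balanced_iff_list_balanced)
  have "balR (Suc m) (\<lambda>us. \<beta> (Tensor (merge ?j (face_mult H n i) us)))"
  proof (rule list_balanced_merge[OF b])
    show "?j < m" using n by auto
    \<comment> \<open>For \<open>i = 0\<close> the counit gives
      \<open>epsR H (u * tL H a) = a * epsR H u\<close>, for \<open>i = n\<close> it gives
      \<open>epsL H (tL H a * v) = epsL H v * a\<close>; in both cases \<open>tL\<close> reverses
      the product.\<close>
    show "face_mult H n i (u * tL H a) v = face_mult H n i u (tL H a * v)" for a u v
      by (auto simp: face_mult_def epsR_mult_tL epsR_S epsL_tL tL_mult mult.assoc)
    show "face_mult H n i (tL H a * u) v = tL H a * face_mult H n i u v" if "0 < ?j" for a u v
      using that by (auto simp: face_mult_def mult.assoc)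
    show "face_mult H n i u (v * tL H a) = face_mult H n i u v * tL H a" if "Suc ?j < m" for a u v
      using that n assms(3) by (auto simp: face_mult_def mult.assoc)
  qed (rule face_mult_lin, assumption)+
  then have "balR (Suc m) (\<lambda>us. pairing \<beta> (face_gen H n i (Tensor us)))"
    by (rule list_balanced_cong) (use n assms(3) in \<open>subst face_gen_eq_merge, auto\<close>)
  then show ?thesis using n by (simp add: balanced_iff_list_balanced)
qed

lemma balA_degen:
  assumes "balA (n + 1) \<beta>" "i \<le> n"
  shows "balA n (\<lambda>g. pairing \<beta> (degen_gen H i g))"
proof -
  have b: "balR (Suc n) (\<lambda>us. \<beta> (Tensor us))"
    using assms by (simp add: balanced_iff_list_balanced)
  show ?thesis
  proof (cases "n = 0")
    case True
    have "lin (\<lambda>u. \<beta> (Tensor [u]))"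
      using b True by (simp add: list_balanced_Suc_iff)
    then show ?thesis using True by (simp add: balanced_def degen_gen_def functional_def tL_add tL_scale)
  next
    case False
    have "balR n (\<lambda>us. \<beta> (Tensor (ins i 1 us)))"
      by (rule list_balanced_ins[OF b assms(2)]) simp
    then show ?thesis
      using False by (simp add: balanced_iff_list_balanced degen_gen_def ins_def)
  qed
qed

lemma pairing_cyc_gen:
  "pairing \<beta> (cyc_gen H (Tensor us)) = cyc_pull (\<lambda>ps c. \<beta> (Tensor (S c # ps))) us"
  by (simp add: cyc_gen_def cyc_pull_def pairing_sweedler_list)

lemma balA_cyc:
  assumes "balA n \<beta>"
  shows "balA n (\<lambda>g. pairing \<beta> (cyc_gen H g))"
proof (cases n)
  case 0
  then show ?thesis using assms by (simp add: balanced_def cyc_gen_def)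
next
  case (Suc m)
  then have "balR (Suc m) (\<lambda>us. \<beta> (Tensor us))"
    using assms by (simp add: balanced_iff_list_balanced)
  from list_balanced_cyc_pull[OF cyc_balanced_antipode[OF this]]
  show ?thesis using Suc by (simp add: balanced_iff_list_balanced pairing_cyc_gen)
qed

lemma multilinear_cyc:
  assumes "cyc_balanced n f"
  shows "multilinear (scU H) n (\<lambda>us. swl H us (\<lambda>ps qs. f ps (prod_list qs * c)))"
  using multilinear_append[OF list_balanced_multilinear[OF list_balanced_cyc_pull[OF assms]],
      of "[]" n "[c]"]
  by (simp add: cyc_pull_def)

text \<open>Fixing the last leg lowers the degree by one, as the reverse induction in
  \<open>meas_swl\<close> requires.\<close>

lemma cyc_balanced_snoc:
  assumes "cyc_balanced (Suc n) f"
  shows "cyc_balanced n (\<lambda>ps. f (ps @ [p]))"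
  unfolding cyc_balanced_def list_balanced_def multilinear_def
proof (intro conjI allI impI)
  show "lin (\<lambda>u. f ((us @ u # vs) @ [p]) c)" if "length us + 1 + length vs = n" for us vs c
    using cyc_balancedD(1)[OF assms, of us "vs @ [p]"] that by simp
  show "f ((us @ u * tL H a # v # vs) @ [p]) c = f ((us @ u # tL H a * v # vs) @ [p]) c"
    if "length us + 2 + length vs = n" for us u a v vs c
    using cyc_balancedD(2)[OF assms, of us "vs @ [p]"] that by simp
  show "lin (f (ps @ [p]))" if "length ps = n" for ps
    using cyc_balancedD(3)[OF assms, of "ps @ [p]"] that by simp
  show "f ((tL H a * u # ps) @ [p]) c = f ((u # ps) @ [p]) (sL H a * c)" if "Suc (length ps) = n" for a u ps c
    using cyc_balancedD(4)[OF assms, of "ps @ [p]"] that by simp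
qed

end

section \<open>Compatibility of measurings with the cyclic structure\<close>

context measured
begin

text \<open>The leg of x on the merged factor splits in two by the rule for \<mu>, and
  coassociativity turns the two halves into consecutive legs.\<close>

lemma meas_merge:
  assumes "multilinear sc' n b" "length us = Suc n" "j < n"
    and \<mu>: "\<And>f x u v. functional sc' f \<Longrightarrow> f (\<Psi> x (\<mu> u v)) = SW x (\<lambda>y z. f (\<mu>' (\<Psi> y u) (\<Psi> z v)))"
    and lin: "\<And>f v. functional sc' f \<Longrightarrow> functional sc' (\<lambda>u. f (\<mu>' u v))"
      "\<And>f u. functional sc' f \<Longrightarrow> functional sc' (\<lambda>v. f (\<mu>' u v))"
  shows "meas C \<Psi> (merge j \<mu> us) x b = meas C \<Psi> us x (\<lambda>vs. b (merge j \<mu>' vs))"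
  using assms(1-3)
proof (induction j arbitrary: us n b x)
  case 0
  then obtain m u v ws where n: "n = Suc m" "us = u # v # ws" "length ws = m"
    by (cases n) (auto simp: length_Suc_conv)
  note b = 0(1)[unfolded n]
  let ?F = "\<lambda>y1 y2 z. meas C \<Psi> ws z (\<lambda>vs. b (\<mu>' (\<Psi> y1 u) (\<Psi> y2 v) # vs))"
  have lin': "functional sc' (\<lambda>p. meas C \<Psi> ws z (\<lambda>vs. b (p # vs)))" for z
    using n by (intro meas_functional multilinear_hd[OF b]) simp
  have "meas C \<Psi> (merge 0 \<mu> us) x b = SW x (\<lambda>y z. meas C \<Psi> ws z (\<lambda>vs. b (\<Psi> y (\<mu> u v) # vs)))"
    by (simp add: n)
  also have "\<dots> = SW x (\<lambda>y z. SW y (\<lambda>y1 y2. ?F y1 y2 z))"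
    by (simp only: \<mu>[OF lin'])
  also have "\<dots> = SW x (\<lambda>y z. SW z (\<lambda>z1 z2. ?F y z1 z2))"
  proof (rule SW_coassoc)
    show "linC (\<lambda>y1. ?F y1 y2 z)" for y2 z
      by (rule functional_measure(1)[OF lin(1)[OF lin']])
    show "linC (\<lambda>y2. ?F y1 y2 z)" for y1 z
      by (rule functional_measure(1)[OF lin(2)[OF lin']])
    show "linC (\<lambda>z. ?F y1 y2 z)" for y1 y2
      using n by (intro meas_linC) (use multilinear_Cons[OF b] in simp)
  qed
  also have "\<dots> = meas C \<Psi> us x (\<lambda>vs. b (merge 0 \<mu>' vs))"
    by (simp add: n)
  finally show ?case .
next
  case (Suc j)
  then obtain m u ws where n: "n = Suc m" "us = u # ws" "length ws = Suc m"
    by (cases n) (auto simp: length_Suc_conv)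
  have "meas C \<Psi> (merge j \<mu> ws) z (\<lambda>vs. b (\<Psi> y u # vs))
      = meas C \<Psi> ws z (\<lambda>vs. b (\<Psi> y u # merge j \<mu>' vs))" for y z
    using Suc.prems n by (intro Suc.IH) (auto intro: multilinear_Cons)
  then show ?case by (simp add: n)
qed

text \<open>The leg acting on the inserted unit yields only its counit, because x(1) = \<epsilon>(x)
  1, and the counit law deletes it.\<close>

lemma meas_ins_one:
  assumes "multilinear sc' (Suc (length us)) b" "j \<le> length us"
  shows "meas C \<Psi> (ins j 1 us) x b = meas C \<Psi> us x (\<lambda>vs. b (ins j 1 vs))"
  using assms
proof (induction j arbitrary: us b x)
  case 0
  have "functional sc' (\<lambda>p. meas C \<Psi> us z (\<lambda>vs. b (p # vs)))" for z
    by (intro meas_functional multilinear_hd[OF 0(1)])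
  from functional_measure_one[OF this]
  have "meas C \<Psi> (ins 0 1 us) x b = SW x (\<lambda>y z. epsC C y * meas C \<Psi> us z (\<lambda>vs. b (1 # vs)))"
    by simp
  also have "\<dots> = meas C \<Psi> us x (\<lambda>vs. b (ins 0 1 vs))"
    by (subst SW_counit(1)) (auto intro!: meas_linC multilinear_Cons 0)
  finally show ?case .
next
  case (Suc j)
  then obtain u ws where us: "us = u # ws" by (cases us) auto
  have "meas C \<Psi> (ins j 1 ws) z (\<lambda>vs. b (\<Psi> y u # vs))
      = meas C \<Psi> ws z (\<lambda>vs. b (\<Psi> y u # ins j 1 vs))" for y z
    using Suc.prems us by (intro Suc.IH) (auto intro: multilinear_Cons)
  then show ?case by (simp add: us)
qed

end

section \<open>Measurings of Hopf algebroids: balancing, faces, degeneracies and the cyclic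
  operator\<close>

locale hopf_measuring = H: hopf H + H': hopf H' + cocommutative C
  for H :: "('k::field, 'u::{ring, monoid_mult}, 'a::{ring, monoid_mult}) hopf_algebroid"
    and H' :: "('k, 'v::{ring, monoid_mult}, 'b::{ring, monoid_mult}) hopf_algebroid"
    and C :: "('k, 'c::ab_group_add) coalgebra" +
  fixes \<Psi> :: "'c \<Rightarrow> 'u \<Rightarrow> 'v" and \<psi> :: "'c \<Rightarrow> 'a \<Rightarrow> 'b"
  assumes hopf_measuring: "hopf_algebroid_measuring C H H' \<Psi> \<psi>"
begin

sublocale measured C "scU H" "scU H'" \<Psi>
  using H'.algU hopf_measuring by unfold_locales (simp_all add: hopf_algebroid_measuring_def)

lemma \<psi>_measuring: "algebra_measuring C (scA H) (scA H') \<psi>"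
  and \<Psi>_tL: "\<Psi> x (tL H a) = tL H' (\<psi> x a)"
  and \<Psi>_S: "\<Psi> x (antipode H u) = antipode H' (\<Psi> x u)"
  and \<psi>_epsL: "\<psi> x (epsL H u) = epsL H' (\<Psi> x u)"
  using hopf_measuring unfolding hopf_algebroid_measuring_def by iprover+

lemma \<psi>_epsR: "\<psi> x (epsR H u) = epsR H' (\<Psi> x u)"
  by (simp add: epsR_def \<psi>_epsL \<Psi>_S)

lemma sw_deltaL_measured:
  assumes "H'.balL F"
  shows "sw F (deltaL H' (\<Psi> x u)) = SW x (\<lambda>y z. sw (\<lambda>p q. F (\<Psi> y p) (\<Psi> z q)) (deltaL H u))"
proof -
  have "DeltaL H' (\<Psi> x u) = classL H' 2 (sweedler fscale (\<lambda>y z.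
      sweedler fscale (\<lambda>p q. tens [\<Psi> y p, \<Psi> z q]) (deltaL H u)) (deltaC C x))"
    using hopf_measuring unfolding hopf_algebroid_measuring_def by iprover
  from H'.sw_deltaL_eq[OF this assms] show ?thesis
    by (simp add: sweedler_eq_lin_ext[of _ F] pairing_sweedler)
qed

text \<open>Both sides of a balancing relation expand to x_(1)(u) \<otimes> t'_L(x_(2)(a)) x_(3)(v),
  with the remaining legs behind: on one side by measuring the product \<open>u * tL H a\<close>, on
  the other by measuring \<open>tL H a * v\<close>.\<close>

lemma list_balanced_meas:
  assumes "H'.balR n b"
  shows "H.balR n (\<lambda>us. meas C \<Psi> us x b)"
  using assms
proof (induction n arbitrary: b x)
  case 0
  show ?case by (rule list_balanced_0)
next
  case (Suc n)
  note b = Suc.prems[unfolded list_balanced_Suc_iff]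
  have rel: "meas C \<Psi> (u * tL H a # v # vs) x b = meas C \<Psi> (u # tL H a * v # vs) x b"
    if n: "Suc (length vs) = n" for a u v vs
  proof -
    let ?G = "\<lambda>p q z. meas C \<Psi> vs z (\<lambda>ws. b (p # q # ws))"
    have lin1: "H'.lin (\<lambda>p. ?G p q z)" for q z
      using b n by (intro meas_functional) auto
    have bp: "multilinear (scU H') (Suc (length vs)) (\<lambda>ws. b (p # ws))" for p
      using b n list_balanced_multilinear by blast
    have lin2: "H'.lin (\<lambda>q. ?G p q z)" for p z
      by (intro meas_functional multilinear_hd[OF bp])
    have lin3: "linC (\<lambda>z. ?G p q z)" for p q
      by (intro meas_linC multilinear_Cons[OF bp])
    have rel: "?G (p * tL H' c) q z = ?G p (tL H' c * q) z" for p q c z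
      using b n by (intro meas_cong) auto
    \<comment> \<open>The common expansion: \<open>y1\<close> acts on \<open>u\<close>,
      \<open>y2\<close> on \<open>tL H a\<close>, \<open>z1\<close> on \<open>v\<close> and
      \<open>z2\<close> on the rest.\<close>
    let ?K = "\<lambda>y1 y2 z1 z2. ?G (\<Psi> y1 u) (\<Psi> y2 (tL H a) * \<Psi> z1 v) z2"
    have K: "linC (\<lambda>y1. ?K y1 y2 z1 z2)" "linC (\<lambda>y2. ?K y1 y2 z1 z2)"
      "linC (\<lambda>z1. ?K y1 y2 z1 z2)" "linC (\<lambda>z2. ?K y1 y2 z1 z2)" for y1 y2 z1 z2
      by (rule functional_measure(1)[OF lin1] functional_measure(1)[OF H'.lin_mult(1)[OF lin2]]
          functional_measure(1)[OF H'.lin_mult(2)[OF lin2]] lin3)+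
    have "meas C \<Psi> (u * tL H a # v # vs) x b
        = SW x (\<lambda>y z. SW z (\<lambda>z1 z2. ?G (\<Psi> y (u * tL H a)) (\<Psi> z1 v) z2))"
      by simp
    \<comment> \<open>\<open>\<Psi>_tL\<close> exhibits the value of \<open>y2\<close> as
      \<open>tL H' (\<psi> y2 a)\<close>, which \<open>rel\<close> carries over the tensor
      sign.\<close>
    also have "\<dots> = SW x (\<lambda>y z. SW z (\<lambda>z1 z2. SW y (\<lambda>y1 y2. ?K y1 y2 z1 z2)))"
      by (simp only: functional_measure_mult[OF lin1] \<Psi>_tL rel)
    also have "\<dots> = SW x (\<lambda>y z. SW y (\<lambda>y1 y2. SW z (\<lambda>z1 z2. ?K y1 y2 z1 z2)))"
      by (subst sw_swap) (rule refl)
    also have "\<dots> = SW x (\<lambda>y1 w. SW w (\<lambda>y2 z. SW z (\<lambda>z1 z2. ?K y1 y2 z1 z2)))"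
      by (rule SW_coassoc) (intro sw_functional SW_functional K)+
    also have "\<dots> = SW x (\<lambda>y1 w. SW w (\<lambda>y z2. SW y (\<lambda>y2 z1. ?K y1 y2 z1 z2)))"
      by (subst SW_coassoc) (intro K refl)+
    also have "\<dots> = SW x (\<lambda>y z. SW z (\<lambda>z1 z2. ?G (\<Psi> y u) (\<Psi> z1 (tL H a * v)) z2))"
      by (simp only: functional_measure_mult[OF lin2])
    also have "\<dots> = meas C \<Psi> (u # tL H a * v # vs) x b"
      by simp
    finally show ?thesis .
  qed
  have "H.balR n (\<lambda>vs. meas C \<Psi> (u # vs) x b)" for u
  proof -
    have IH: "H.balR n (\<lambda>vs. meas C \<Psi> vs z (\<lambda>ws. b (\<Psi> y u # ws)))" for y z
      using b by (intro Suc.IH) simp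
    show ?thesis
      unfolding list_balanced_def multilinear_def meas.simps
      using IH by (auto simp: list_balanced_def multilinear_def intro!: sw_functional)
  qed
  moreover have "H.lin (\<lambda>u. meas C \<Psi> (u # vs) x b)" if "length vs = n" for vs
    using multilinear_hd[OF multilinear_meas[OF list_balanced_multilinear[OF Suc.prems]] that] .
  ultimately show ?case
    unfolding list_balanced_Suc_iff using rel by blast
qed

abbreviation "mgen x g \<equiv>
  (case g of Scalar a \<Rightarrow> scal (\<psi> x a) | Tensor us \<Rightarrow> measured_tensor C \<Psi> x us)"

lemma pairing_mgen:
  assumes "H'.balA n \<beta>" "length us = n" "n > 0"
  shows "pairing \<beta> (mgen x (Tensor us)) = meas C \<Psi> us x (\<lambda>vs. \<beta> (Tensor vs))"
  using assms by (auto intro!: pairing_measured_tensor list_balanced_multilinear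
      simp: balanced_iff_list_balanced)

lemma balA_mgen:
  assumes "H'.balA n \<beta>"
  shows "H.balA n (\<lambda>g. pairing \<beta> (mgen x g))"
proof (cases "n = 0")
  case True
  then show ?thesis
    using assms \<psi>_measuring by (simp add: balanced_def functional_def algebra_measuring_def)
next
  case False
  then have "H.balR n (\<lambda>us. meas C \<Psi> us x (\<lambda>vs. \<beta> (Tensor vs)))"
    using assms by (intro list_balanced_meas) (simp add: balanced_iff_list_balanced)
  then have "H.balR n (\<lambda>us. pairing \<beta> (mgen x (Tensor us)))"
    by (rule list_balanced_cong) (use False pairing_mgen[OF assms] in simp)
  then show ?thesis using False by (simp add: balanced_iff_list_balanced)
qed

lemma functional_face_mult:
  assumes "H'.lin f"
  shows "f (\<Psi> x (face_mult H n i u v)) = SW x (\<lambda>y z. f (face_mult H' n i (\<Psi> y u) (\<Psi> z v)))"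
  by (simp add: face_mult_def functional_measure_mult[OF assms] \<Psi>_tL \<psi>_epsR \<Psi>_S)

lemma face_mgen:
  assumes \<beta>: "H'.balA (n - 1) \<beta>" and n: "1 \<le> n" "i \<le> n" and g: "g \<in> tensor_gens n"
  shows "pairing (\<lambda>g. pairing \<beta> (mgen x g)) (face_gen H n i g)
    = pairing (\<lambda>g. pairing \<beta> (face_gen H' n i g)) (mgen x g)"
proof -
  obtain us where us: "g = Tensor us" "length us = n"
    using g n by (auto simp: tensor_gens_def split: if_splits)
  have R: "pairing (\<lambda>g. pairing \<beta> (face_gen H' n i g)) (mgen x g)
      = meas C \<Psi> us x (\<lambda>vs. pairing \<beta> (face_gen H' n i (Tensor vs)))"
    using pairing_mgen[OF H'.balA_face[OF \<beta> n] us(2)] n by (simp add: us)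
  show ?thesis
  proof (cases "n = 1")
    case True
    then obtain u where u: "us = [u]" using us(2) by (auto simp: length_Suc_conv)
    have "multilinear (scU H') (Suc 0) (\<lambda>vs. pairing \<beta> (face_gen H' n i (Tensor vs)))"
      using H'.balA_face[OF \<beta> n] True
      by (auto simp: balanced_iff_list_balanced intro: list_balanced_multilinear)
    from meas_single[OF this] show ?thesis
      unfolding R u using True by (simp add: us u face_gen_def \<psi>_epsR \<Psi>_S del: meas.simps)
  next
    case False
    have "multilinear (scU H') (n - 1) (\<lambda>vs. \<beta> (Tensor vs))"
      using \<beta> n False by (auto simp: balanced_iff_list_balanced intro: list_balanced_multilinear)
    have "pairing (\<lambda>g. pairing \<beta> (mgen x g)) (face_gen H n i g)
        = meas C \<Psi> (merge (min (i - 1) (n - 2)) (face_mult H n i) us) x (\<lambda>vs. \<beta> (Tensor vs))"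
      using n False us pairing_mgen[OF \<beta>]
      by (simp add: face_gen_eq_merge length_merge)
    also have "\<dots> = meas C \<Psi> us x (\<lambda>vs. \<beta> (Tensor (merge (min (i - 1) (n - 2)) (face_mult H' n i) vs)))"
      by (rule meas_merge[of "n - 1"])
        (use n False us functional_face_mult H'.face_mult_lin
          \<open>multilinear (scU H') (n - 1) (\<lambda>vs. \<beta> (Tensor vs))\<close> in auto)
    also have "\<dots> = meas C \<Psi> us x (\<lambda>vs. pairing \<beta> (face_gen H' n i (Tensor vs)))"
      by (rule meas_cong) (use n False us in \<open>simp add: face_gen_eq_merge\<close>)
    finally show ?thesis unfolding R .
  qed
qed

lemma degen_mgen:
  assumes \<beta>: "H'.balA (n + 1) \<beta>" and i: "i \<le> n" and g: "g \<in> tensor_gens n"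
  shows "pairing (\<lambda>g. pairing \<beta> (mgen x g)) (degen_gen H i g)
    = pairing (\<lambda>g. pairing \<beta> (degen_gen H' i g)) (mgen x g)"
proof -
  have b: "multilinear (scU H') (Suc n) (\<lambda>vs. \<beta> (Tensor vs))"
    using \<beta> by (auto simp: balanced_iff_list_balanced intro: list_balanced_multilinear)
  show ?thesis
  proof (cases g)
    case (Scalar a)
    then have "n = 0" using g by (auto simp: tensor_gens_def split: if_splits)
    then show ?thesis
      using Scalar pairing_mgen[OF \<beta>] b by (simp add: degen_gen_def meas_single \<Psi>_tL del: meas.simps)
  next
    case (Tensor us)
    then have us: "length us = n" "n > 0" using g by (auto simp: tensor_gens_def split: if_splits)
    have "pairing (\<lambda>g. pairing \<beta> (mgen x g)) (degen_gen H i g)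
        = meas C \<Psi> (ins i 1 us) x (\<lambda>vs. \<beta> (Tensor vs))"
      using pairing_mgen[OF \<beta>, of "ins i 1 us"] us Tensor
      by (simp add: degen_gen_def length_ins) (simp add: ins_def)
    also have "\<dots> = meas C \<Psi> us x (\<lambda>vs. \<beta> (Tensor (ins i 1 vs)))"
      by (rule meas_ins_one) (use b us i in auto)
    also have "\<dots> = pairing (\<lambda>g. pairing \<beta> (degen_gen H' i g)) (mgen x g)"
      using pairing_mgen[OF H'.balA_degen[OF \<beta> i] us] by (simp add: Tensor degen_gen_def ins_def)
    finally show ?thesis .
  qed
qed

text \<open>All first legs end up measured by one half of x and the product of all second legs by
  the other half. In the reverse induction the last factor is opened while those before it are still
  intact, as its slot functional requires, and its second leg is absorbed into
  \<open>c\<close>.\<close>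

lemma meas_swl:
  assumes "H'.cyc_balanced (length us) f"
  shows "meas C \<Psi> us x (\<lambda>vs. swl H' vs (\<lambda>ps qs. f ps (prod_list qs * c)))
    = swl H us (\<lambda>ps qs. SW x (\<lambda>y z. meas C \<Psi> ps y (\<lambda>vs. f vs (\<Psi> z (prod_list qs) * c))))"
  using assms
proof (induction us arbitrary: x f c rule: rev_induct)
  case Nil
  have lin: "H'.lin (\<lambda>w. f [] (w * c))"
    using H'.cyc_balancedD(3)[OF Nil] by (intro H'.lin_mult) simp
  \<comment> \<open>The counit removes \<open>y\<close>, and \<open>\<Psi> x 1\<close> contributes
    the counit that \<open>meas\<close> assigns to the empty list.\<close>
  show ?case
    using SW_counit(1)[OF functional_measure(1)[OF lin]] functional_measure_one[OF lin]
    by simp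
next
  case (snoc u us)
  have f: "H'.cyc_balanced (Suc (length us)) f" using snoc.prems by simp
  have f': "H'.cyc_balanced (length us) (\<lambda>ps. f (ps @ [v]))" for v
    by (rule H'.cyc_balanced_snoc[OF f])
  \<comment> \<open>\<open>y1\<close> acts on the earlier first legs \<open>ps\<close> and
    \<open>y2\<close> on the product of \<open>qs\<close>, while \<open>z1\<close> and
    \<open>z2\<close> act on the legs \<open>p\<close> and \<open>q\<close> of the new
    factor.\<close>
  let ?M = "\<lambda>p q ps qs y1 y2 z1 z2. meas C \<Psi> ps y1 (\<lambda>vs. f (vs @ [\<Psi> z1 p]) (\<Psi> y2 (prod_list qs) * (\<Psi> z2 q * c)))"
  have M: "linC (\<lambda>y1. ?M p q ps qs y1 y2 z1 z2)" "linC (\<lambda>y2. ?M p q ps qs y1 y2 z1 z2)"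
    "linC (\<lambda>z1. ?M p q ps qs y1 y2 z1 z2)" "linC (\<lambda>z2. ?M p q ps qs y1 y2 z1 z2)"
    if len: "length ps = length us" for p q ps qs y1 y2 z1 z2
  proof -
    have "H'.lin (\<lambda>w. f (vs @ [v]) (w * d))" "H'.lin (\<lambda>w. f (vs @ [v]) (d' * (w * d)))"
      if "length vs = length ps" for vs v d d'
      using H'.cyc_balancedD(3)[OF f'] that len
        H'.lin_mult(2)[of "\<lambda>w. f (vs @ [v]) (d' * w)"]
      by (auto intro: H'.lin_mult)
    from this[THEN functional_measure(1)]
    show "linC (\<lambda>y2. ?M p q ps qs y1 y2 z1 z2)" "linC (\<lambda>z2. ?M p q ps qs y1 y2 z1 z2)"
      by (intro meas_functional, blast)+
    have "multilinear (scU H') (length ps) (\<lambda>vs. f (vs @ [v]) w)" for v w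
      using f' len unfolding H'.cyc_balanced_def list_balanced_def by auto
    then show "linC (\<lambda>y1. ?M p q ps qs y1 y2 z1 z2)" by (intro meas_linC)
    show "linC (\<lambda>z1. ?M p q ps qs y1 y2 z1 z2)"
    proof (intro meas_functional functional_measure(1))
      fix vs :: "'v list" and w assume "length vs = length ps"
      then show "H'.lin (\<lambda>v. f (vs @ [v]) w)"
        using H'.cyc_balancedD(1)[OF f, of vs "[]"] len by simp
    qed
  qed
  have "meas C \<Psi> (us @ [u]) x (\<lambda>vs. swl H' vs (\<lambda>ps qs. f ps (prod_list qs * c)))
      = SW x (\<lambda>y z. meas C \<Psi> us y (\<lambda>vs. swl H' (vs @ [\<Psi> z u]) (\<lambda>ps qs. f ps (prod_list qs * c))))"
    by (rule meas_snoc[OF H'.multilinear_cyc[OF f]])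
  also have "\<dots> = SW x (\<lambda>y z. meas C \<Psi> us y (\<lambda>vs. SW z (\<lambda>z1 z2. sw (\<lambda>p q.
      swl H' vs (\<lambda>ps qs. f (ps @ [\<Psi> z1 p]) (prod_list qs * (\<Psi> z2 q * c)))) (deltaL H u))))"
  proof -
    have "swl H' (vs @ [\<Psi> z u]) (\<lambda>ps qs. f ps (prod_list qs * c)) = SW z (\<lambda>z1 z2. sw (\<lambda>p q.
      swl H' vs (\<lambda>ps qs. f (ps @ [\<Psi> z1 p]) (prod_list qs * (\<Psi> z2 q * c)))) (deltaL H u))"
      if "length vs = length us" for vs z
    proof -
      \<comment> \<open>The coproduct of the measured factor may be expanded because the functional
        seen from this slot is balanced over A_L.\<close>
      have "H'.balL (\<lambda>p q. swl H' vs (\<lambda>ps qs. f (ps @ [p]) (prod_list qs * q * c)))"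
        by (rule H'.balL_cyc_slot[OF f]) (simp add: that)
      from sw_deltaL_measured[OF this, of z u] show ?thesis
        by (simp add: swl_snoc mult.assoc)
    qed
    then have "meas C \<Psi> us y (\<lambda>vs. swl H' (vs @ [\<Psi> z u]) (\<lambda>ps qs. f ps (prod_list qs * c)))
        = meas C \<Psi> us y (\<lambda>vs. SW z (\<lambda>z1 z2. sw (\<lambda>p q.
      swl H' vs (\<lambda>ps qs. f (ps @ [\<Psi> z1 p]) (prod_list qs * (\<Psi> z2 q * c)))) (deltaL H u)))" for y z
      by (rule meas_cong)
    then show ?thesis by simp
  qed
  also have "\<dots> = SW x (\<lambda>y z. SW z (\<lambda>z1 z2. sw (\<lambda>p q. swl H us (\<lambda>ps qs.
      SW y (\<lambda>y1 y2. ?M p q ps qs y1 y2 z1 z2))) (deltaL H u)))"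
    by (simp only: meas_sw snoc.IH[OF f'])
  also have "\<dots> = sw (\<lambda>p q. SW x (\<lambda>y z. SW z (\<lambda>z1 z2. swl H us (\<lambda>ps qs.
      SW y (\<lambda>y1 y2. ?M p q ps qs y1 y2 z1 z2))))) (deltaL H u)"
    by (simp only: sw_swap[of _ "deltaL H u"])
  also have "\<dots> = sw (\<lambda>p q. swl H us (\<lambda>ps qs. SW x (\<lambda>y z. SW z (\<lambda>z1 z2. SW y (\<lambda>y1 y2.
      ?M p q ps qs y1 y2 z1 z2))))) (deltaL H u)"
    by (simp only: swl_sw)
  also have "\<dots> = sw (\<lambda>p q. swl H us (\<lambda>ps qs. SW x (\<lambda>y z. SW y (\<lambda>y1 y2. SW z (\<lambda>z1 z2.
      ?M p q ps qs y1 y2 z1 z2))))) (deltaL H u)"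
  proof -
    have "SW z (\<lambda>z1 z2. SW y (\<lambda>y1 y2. ?M p q ps qs y1 y2 z1 z2))
        = SW y (\<lambda>y1 y2. SW z (\<lambda>z1 z2. ?M p q ps qs y1 y2 z1 z2))" for p q ps qs y z
      by (rule sw_swap)
    then show ?thesis by (simp only:)
  qed
  \<comment> \<open>The induction delivers the legs of x grouped by old factors and new factor. The
    goal groups them by first and second legs, so the middle two have to be exchanged.\<close>
  also have "\<dots> = sw (\<lambda>p q. swl H us (\<lambda>ps qs. SW x (\<lambda>y z. SW y (\<lambda>y1 z1. SW z (\<lambda>y2 z2.
      ?M p q ps qs y1 y2 z1 z2))))) (deltaL H u)"
  proof -
    have "swl H us (\<lambda>ps qs. SW x (\<lambda>y z. SW y (\<lambda>y1 y2. SW z (\<lambda>z1 z2. ?M p q ps qs y1 y2 z1 z2))))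
        = swl H us (\<lambda>ps qs. SW x (\<lambda>y z. SW y (\<lambda>y1 z1. SW z (\<lambda>y2 z2. ?M p q ps qs y1 y2 z1 z2))))"
      for p q
      by (intro swl_cong SW_interchange M)
    then show ?thesis by simp
  qed
  also have "\<dots> = swl H (us @ [u]) (\<lambda>ps qs. SW x (\<lambda>y z. meas C \<Psi> ps y (\<lambda>vs. f vs (\<Psi> z (prod_list qs) * c))))"
  proof -
    \<comment> \<open>Now \<open>y1, z1\<close> measure the list \<open>ps @ [p]\<close> and
      \<open>y2, z2\<close> measure a product, so \<open>meas_snoc\<close> and the measuring
      property close them up.\<close>
    have "SW y (\<lambda>y1 z1. SW z (\<lambda>y2 z2. ?M p q ps qs y1 y2 z1 z2))
        = meas C \<Psi> (ps @ [p]) y (\<lambda>vs. f vs (\<Psi> z (prod_list (qs @ [q])) * c))"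
      if len: "length ps = length us" for p q ps qs y z
    proof -
      have m: "multilinear (scU H') (Suc (length ps)) (\<lambda>vs. f vs w)" for w
        using f len unfolding H'.cyc_balanced_def list_balanced_def by auto
      have "f vs (\<Psi> z (prod_list (qs @ [q])) * c)
          = SW z (\<lambda>y2 z2. f vs (\<Psi> y2 (prod_list qs) * (\<Psi> z2 q * c)))"
        if "length vs = Suc (length ps)" for vs
        using functional_measure_mult[OF H'.lin_mult(2)[OF H'.cyc_balancedD(3)[OF f, of vs]]] that len
        by (simp add: mult.assoc)
      then have "meas C \<Psi> (ps @ [p]) y (\<lambda>vs. f vs (\<Psi> z (prod_list (qs @ [q])) * c))
          = meas C \<Psi> (ps @ [p]) y (\<lambda>vs. SW z (\<lambda>y2 z2. f vs (\<Psi> y2 (prod_list qs) * (\<Psi> z2 q * c))))"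
        by (intro meas_cong) simp
      also have "\<dots> = SW y (\<lambda>y1 z1. SW z (\<lambda>y2 z2. ?M p q ps qs y1 y2 z1 z2))"
        by (simp only: meas_sw meas_snoc[OF m]) (rule sw_swap)
      finally show ?thesis by simp
    qed
    then have "swl H us (\<lambda>ps qs. SW x (\<lambda>y z. SW y (\<lambda>y1 z1. SW z (\<lambda>y2 z2. ?M p q ps qs y1 y2 z1 z2))))
        = swl H us (\<lambda>ps qs. SW x (\<lambda>y z. meas C \<Psi> (ps @ [p]) y (\<lambda>vs. f vs (\<Psi> z (prod_list (qs @ [q])) * c))))"
      for p q by (intro swl_cong) simp
    then show ?thesis by (simp add: swl_snoc)
  qed
  finally show ?case .
qed

text \<open>The last factor \<open>w\<close> is measured whole, so x has three legs: on
  \<open>ps\<close>, on the product of \<open>qs\<close> and on \<open>w\<close>. The last two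
  combine to act on the argument of the antipode. They stand behind the leg for \<open>ps\<close>,
  whereas the cyclic operator puts the antipode in front; cocommutativity exchanges them.\<close>

lemma meas_cyc_pull:
  assumes b: "H'.balR (Suc n) b" and us: "length us = Suc n"
  shows "meas C \<Psi> us x (H'.cyc_pull (\<lambda>ps c. b (antipode H' c # ps)))
    = H.cyc_pull (\<lambda>ps c. meas C \<Psi> (antipode H c # ps) x b) us"
proof -
  obtain vs w where vs: "us = vs @ [w]" "length vs = n"
    using us by (cases us rule: rev_cases) auto
  let ?f = "\<lambda>ps c. b (antipode H' c # ps)"
  have f: "H'.cyc_balanced (length vs) ?f"
    using H'.cyc_balanced_antipode[OF b] vs by simp
  let ?F = "\<lambda>ps qs y1 y2 z. meas C \<Psi> ps y1 (\<lambda>vs. ?f vs (\<Psi> y2 (prod_list qs) * \<Psi> z w))"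
  have lin: "H'.lin (\<lambda>c. meas C \<Psi> ps y (\<lambda>vs. ?f vs c))" if "length ps = length vs" for ps y
    by (intro meas_functional) (use H'.cyc_balancedD(3)[OF f] that in simp)
  have "meas C \<Psi> us x (H'.cyc_pull ?f)
      = SW x (\<lambda>y z. meas C \<Psi> vs y (\<lambda>ys. swl H' ys (\<lambda>ps qs. ?f ps (prod_list qs * \<Psi> z w))))"
    using meas_snoc[of vs "H'.cyc_pull ?f" w x]
      list_balanced_multilinear[OF H'.list_balanced_cyc_pull[OF f]]
    by (simp add: vs H'.cyc_pull_def)
  also have "\<dots> = swl H vs (\<lambda>ps qs. SW x (\<lambda>y z. SW y (\<lambda>y1 y2. ?F ps qs y1 y2 z)))"
    by (simp only: meas_swl[OF f] swl_sw)
  also have "\<dots> = swl H vs (\<lambda>ps qs. meas C \<Psi> (antipode H (prod_list qs * w) # ps) x b)"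
  proof (rule swl_cong)
    fix ps qs :: "'u list" assume len: "length ps = length vs"
    have "multilinear (scU H') (length ps) (\<lambda>vs. ?f vs c)" for c
      using f len unfolding H'.cyc_balanced_def list_balanced_def by auto
    then have lin': "linC (\<lambda>y. meas C \<Psi> ps y (\<lambda>vs. ?f vs c))" for c
      by (intro meas_linC)
    note l = lin[OF len]
    have "SW x (\<lambda>y z. SW y (\<lambda>y1 y2. ?F ps qs y1 y2 z)) = SW x (\<lambda>y z. SW z (\<lambda>z1 z2. ?F ps qs y z1 z2))"
    proof (rule SW_coassoc)
      show "linC (\<lambda>y1. ?F ps qs y1 y2 z)" for y2 z by (rule lin')
      show "linC (\<lambda>y2. ?F ps qs y1 y2 z)" for y1 z
        by (rule functional_measure(1)[OF H'.lin_mult(2)[OF l]])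
      show "linC (\<lambda>z. ?F ps qs y1 y2 z)" for y1 y2
        by (rule functional_measure(1)[OF H'.lin_mult(1)[OF l]])
    qed
    also have "\<dots> = SW x (\<lambda>y z. meas C \<Psi> ps y (\<lambda>vs. ?f vs (\<Psi> z (prod_list qs * w))))"
      by (simp only: functional_measure_mult[OF l])
    \<comment> \<open>The leg on the antipode's argument becomes the first one, as in the recursion
      of \<open>meas\<close> for the list headed by the antipode.\<close>
    also have "\<dots> = SW x (\<lambda>z y. meas C \<Psi> ps y (\<lambda>vs. ?f vs (\<Psi> z (prod_list qs * w))))"
      by (rule SW_cocomm) (rule lin' functional_measure(1)[OF l])+
    also have "\<dots> = meas C \<Psi> (antipode H (prod_list qs * w) # ps) x b"
      by (simp add: \<Psi>_S)
    finally show "SW x (\<lambda>y z. SW y (\<lambda>y1 y2. ?F ps qs y1 y2 z))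
      = meas C \<Psi> (antipode H (prod_list qs * w) # ps) x b" .
  qed
  also have "\<dots> = H.cyc_pull (\<lambda>ps c. meas C \<Psi> (antipode H c # ps) x b) us"
    by (simp add: vs H.cyc_pull_def)
  finally show ?thesis .
qed

lemma cyc_mgen:
  assumes \<beta>: "H'.balA n \<beta>" and g: "g \<in> tensor_gens n"
  shows "pairing (\<lambda>g. pairing \<beta> (mgen x g)) (cyc_gen H g)
    = pairing (\<lambda>g. pairing \<beta> (cyc_gen H' g)) (mgen x g)"
proof (cases g)
  case (Scalar a)
  then show ?thesis by (simp add: cyc_gen_def)
next
  case (Tensor us)
  then have us: "length us = n" "n > 0" using g by (auto simp: tensor_gens_def split: if_splits)
  then obtain m where n: "n = Suc m" by (cases n) auto
  have b: "H'.balR (Suc m) (\<lambda>vs. \<beta> (Tensor vs))"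
    using \<beta> n by (simp add: balanced_iff_list_balanced)
  have "pairing (\<lambda>g. pairing \<beta> (mgen x g)) (cyc_gen H g)
      = H.cyc_pull (\<lambda>ps c. pairing \<beta> (mgen x (Tensor (antipode H c # ps)))) us"
    unfolding Tensor H.pairing_cyc_gen ..
  also have "\<dots> = H.cyc_pull (\<lambda>ps c. meas C \<Psi> (antipode H c # ps) x (\<lambda>vs. \<beta> (Tensor vs))) us"
    unfolding H.cyc_pull_def
    by (rule swl_cong, rule pairing_mgen[OF \<beta>]) (use us in auto)
  also have "\<dots> = meas C \<Psi> us x (H'.cyc_pull (\<lambda>ps c. \<beta> (Tensor (antipode H' c # ps))))"
    using meas_cyc_pull[OF b] us n by simp
  also have "\<dots> = pairing (\<lambda>g. pairing \<beta> (cyc_gen H' g)) (mgen x g)"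
    using pairing_mgen[OF H'.balA_cyc[OF \<beta>] us] by (simp add: Tensor H'.pairing_cyc_gen)
  finally show ?thesis .
qed

end

section \<open>Linear maps and homology\<close>

lemma k_linear_closed: "k_linear M N f \<Longrightarrow> x \<in> carrier M \<Longrightarrow> f x \<in> carrier N"
  and k_linear_add: "k_linear M N f \<Longrightarrow> x \<in> carrier M \<Longrightarrow> y \<in> carrier M \<Longrightarrow> f (x \<oplus>\<^bsub>M\<^esub> y) = f x \<oplus>\<^bsub>N\<^esub> f y"
  and k_linear_smult: "k_linear M N f \<Longrightarrow> x \<in> carrier M \<Longrightarrow> f (c \<odot>\<^bsub>M\<^esub> x) = c \<odot>\<^bsub>N\<^esub> f x"
  by (auto simp: k_linear_def)

lemma k_linear_zero:
  assumes "k_space M" "k_space N" "k_linear M N f"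
  shows "f \<zero>\<^bsub>M\<^esub> = \<zero>\<^bsub>N\<^esub>"
proof -
  interpret M: k_space M by fact
  interpret N: k_space N by fact
  have "f \<zero>\<^bsub>M\<^esub> \<oplus>\<^bsub>N\<^esub> f \<zero>\<^bsub>M\<^esub> = f \<zero>\<^bsub>M\<^esub>"
    using k_linear_add[OF assms(3) M.zero_closed M.zero_closed] by simp
  then show ?thesis
    using k_linear_closed[OF assms(3) M.zero_closed] by (metis N.add.l_cancel_one)
qed

lemma k_linear_a_inv:
  assumes "k_space M" "k_space N" "k_linear M N f" "x \<in> carrier M"
  shows "f (\<ominus>\<^bsub>M\<^esub> x) = \<ominus>\<^bsub>N\<^esub> f x"
proof -
  interpret M: k_space M by fact
  interpret N: k_space N by fact
  have "f (\<ominus>\<^bsub>M\<^esub> x) \<oplus>\<^bsub>N\<^esub> f x = \<zero>\<^bsub>N\<^esub>"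
    using k_linear_add[OF assms(3) M.a_inv_closed[OF assms(4)] assms(4)] assms(4)
    by (simp add: M.l_neg k_linear_zero[OF assms(1-3)])
  then show ?thesis
    using assms(4) k_linear_closed[OF assms(3)] by (metis M.a_inv_closed N.minus_equality)
qed

lemma k_linear_finsum:
  assumes "k_space M" "k_space N" "k_linear M N f" "g \<in> I \<rightarrow> carrier M"
  shows "f (\<Oplus>\<^bsub>M\<^esub>i\<in>I. g i) = (\<Oplus>\<^bsub>N\<^esub>i\<in>I. f (g i))"
  using assms(4)
proof (induction I rule: infinite_finite_induct)
  case (infinite I)
  interpret M: k_space M by fact
  interpret N: k_space N by fact
  from infinite show ?case by (simp add: k_linear_zero[OF assms(1-3)])
next
  case empty
  interpret M: k_space M by fact
  interpret N: k_space N by fact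
  show ?case by (simp add: k_linear_zero[OF assms(1-3)])
next
  case (insert i I)
  interpret M: k_space M by fact
  interpret N: k_space N by fact
  have "(\<lambda>i. f (g i)) \<in> insert i I \<rightarrow> carrier N"
    using insert.prems k_linear_closed[OF assms(3)] by auto
  then show ?case
    using insert by (simp add: k_linear_add[OF assms(3)] Pi_iff)
qed

lemma k_linear_comp:
  "k_linear L M f \<Longrightarrow> k_linear M N g \<Longrightarrow> k_linear L N (\<lambda>x. g (f x))"
  by (simp add: k_linear_def Pi_iff)

lemma k_linear_funpow: "k_linear M M f \<Longrightarrow> k_linear M M (f ^^ i)"
  by (induction i) (simp_all add: k_linear_def Pi_iff)

context k_space
begin

lemma k_linear_scale: "k_linear L M f \<Longrightarrow> k_linear L M (\<lambda>x. c \<odot> f x)"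
  by (auto simp: k_linear_def smult_r_distr smult_assoc mult.commute Pi_iff)

lemma k_linear_plus:
  "k_linear L M f \<Longrightarrow> k_linear L M g \<Longrightarrow> k_linear L M (\<lambda>x. f x \<oplus> g x)"
  by (auto simp: k_linear_def smult_r_distr Pi_iff a_ac)

text \<open>Both laws express that scaling by \<open>c\<close> is a linear map, which preserves zero
  and negatives.\<close>

lemma smult_zero: "c \<odot> \<zero> = \<zero>" and smult_a_inv: "x \<in> carrier M \<Longrightarrow> c \<odot> (\<ominus> x) = \<ominus> (c \<odot> x)"
proof -
  have "k_linear M M (\<lambda>x. c \<odot> x)"
    by (rule k_linear_scale) (auto simp: k_linear_def)
  from k_linear_zero[OF _ _ this] k_linear_a_inv[OF _ _ this]
  show "c \<odot> \<zero> = \<zero>" "x \<in> carrier M \<Longrightarrow> c \<odot> (\<ominus> x) = \<ominus> (c \<odot> x)"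
    using k_space_axioms by auto
qed

lemma k_linear_uminus: "k_linear L M f \<Longrightarrow> k_linear L M (\<lambda>x. \<ominus> f x)"
  by (auto simp: k_linear_def smult_a_inv minus_add Pi_iff)

lemma k_linear_sum:
  assumes "\<And>i. i \<in> I \<Longrightarrow> k_linear L M (g i)"
  shows "k_linear L M (\<lambda>x. \<Oplus>i\<in>I. g i x)"
  unfolding k_linear_def
proof (intro conjI ballI allI)
  have g: "g i x \<in> carrier M" if "i \<in> I" "x \<in> carrier L" for i x
    using k_linear_closed[OF assms] that by blast
  show "(\<lambda>x. \<Oplus>i\<in>I. g i x) \<in> carrier L \<rightarrow> carrier M"
    using g by (auto intro!: finsum_closed)
  show "(\<Oplus>i\<in>I. g i (x \<oplus>\<^bsub>L\<^esub> y)) = (\<Oplus>i\<in>I. g i x) \<oplus> (\<Oplus>i\<in>I. g i y)"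
    if "x \<in> carrier L" "y \<in> carrier L" for x y
  proof -
    have "(\<Oplus>i\<in>I. g i (x \<oplus>\<^bsub>L\<^esub> y)) = (\<Oplus>i\<in>I. g i x \<oplus> g i y)"
      using g that by (intro finsum_cong) (auto simp: k_linear_add[OF assms] simp_implies_def)
    then show ?thesis using g that by (simp add: finsum_addf Pi_iff)
  qed
  show "(\<Oplus>i\<in>I. g i (c \<odot>\<^bsub>L\<^esub> x)) = c \<odot> (\<Oplus>i\<in>I. g i x)" if "x \<in> carrier L" for c x
  proof -
    have "k_linear M M (\<lambda>x. c \<odot> x)"
      by (rule k_linear_scale) (auto simp: k_linear_def)
    from k_linear_finsum[OF k_space_axioms k_space_axioms this, of "\<lambda>i. g i x" I]
    have "c \<odot> (\<Oplus>i\<in>I. g i x) = (\<Oplus>i\<in>I. c \<odot> g i x)" using g that by auto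
    also have "\<dots> = (\<Oplus>i\<in>I. g i (c \<odot>\<^bsub>L\<^esub> x))"
      using g that
      by (intro finsum_cong) (auto simp: k_linear_smult[OF assms] simp_implies_def)
    finally show ?thesis by simp
  qed
qed

end

section \<open>Quotients by subspaces and induced maps on homology\<close>

definition k_subspace :: "('k, 'm) module \<Rightarrow> 'm set \<Rightarrow> bool" where
  "k_subspace M B \<longleftrightarrow> abelian_subgroup B M \<and> (\<forall>c. \<forall>x\<in>B. c \<odot>\<^bsub>M\<^esub> x \<in> B)"

lemma k_subspace_image:
  assumes "k_space L" "k_space M" "k_linear L M f"
  shows "k_subspace M (f ` carrier L)"
proof -
  interpret L: k_space L by fact
  interpret M: k_space M by fact
  have "subgroup (f ` carrier L) (add_monoid M)"
  proof (rule M.add.subgroupI)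
    show "f ` carrier L \<noteq> {}" using L.zero_closed by blast
  next
    fix x assume "x \<in> f ` carrier L"
    then obtain y where "y \<in> carrier L" "x = f y" by auto
    then have "\<ominus>\<^bsub>M\<^esub> x = f (\<ominus>\<^bsub>L\<^esub> y)" using k_linear_a_inv[OF assms] by simp
    then show "\<ominus>\<^bsub>M\<^esub> x \<in> f ` carrier L" using \<open>y \<in> carrier L\<close> by blast
  next
    fix x x' assume "x \<in> f ` carrier L" "x' \<in> f ` carrier L"
    then obtain y y' where "y \<in> carrier L" "x = f y" "y' \<in> carrier L" "x' = f y'" by auto
    then show "x \<oplus>\<^bsub>M\<^esub> x' \<in> f ` carrier L"
      using k_linear_add[OF assms(3), symmetric] by auto
  qed (use k_linear_closed[OF assms(3)] in auto)
  then have "abelian_subgroup (f ` carrier L) M"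
    using M.abelian_group_axioms by (intro abelian_subgroupI3 additive_subgroup.intro) auto
  then show ?thesis
    unfolding k_subspace_def using k_linear_smult[OF assms(3), symmetric] L.smult_closed
    by (auto intro!: imageI)
qed

lemma coset_eq:
  assumes "k_subspace M B" "y \<in> carrier M" "z \<in> carrier M"
  shows "B +>\<^bsub>M\<^esub> y = B +>\<^bsub>M\<^esub> z \<longleftrightarrow> (\<exists>b\<in>B. y = b \<oplus>\<^bsub>M\<^esub> z)"
proof -
  interpret abelian_subgroup B M using assms(1) by (simp add: k_subspace_def)
  have "B +>\<^bsub>M\<^esub> y = B +>\<^bsub>M\<^esub> z \<longleftrightarrow> y \<in> B +>\<^bsub>M\<^esub> z"
    using a_repr_independence[of y B z] a_rcos_self[of y] a_subgroup assms by auto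
  then show ?thesis by (auto simp: a_r_coset_def')
qed

text \<open>\<open>B\<close> is closed under scaling, so every member of the coset yields the same
  scaled coset and the union in \<open>subquot\<close> is a single coset.\<close>

lemma subquot_smult:
  assumes "k_space M" "k_subspace M B" "z \<in> carrier M"
  shows "(\<Union>x\<in>B +>\<^bsub>M\<^esub> z. B +>\<^bsub>M\<^esub> (c \<odot>\<^bsub>M\<^esub> x)) = B +>\<^bsub>M\<^esub> (c \<odot>\<^bsub>M\<^esub> z)"
proof -
  interpret M: k_space M by fact
  interpret abelian_subgroup B M using assms(2) by (simp add: k_subspace_def)
  have B: "x \<in> carrier M" if "x \<in> B" for x using that a_subset by auto
  have "B +>\<^bsub>M\<^esub> (c \<odot>\<^bsub>M\<^esub> x) = B +>\<^bsub>M\<^esub> (c \<odot>\<^bsub>M\<^esub> z)" if x: "x \<in> B +>\<^bsub>M\<^esub> z" for x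
  proof -
    obtain b where "b \<in> B" "x = b \<oplus>\<^bsub>M\<^esub> z" using x by (auto simp: a_r_coset_def')
    then have "c \<odot>\<^bsub>M\<^esub> x = c \<odot>\<^bsub>M\<^esub> b \<oplus>\<^bsub>M\<^esub> c \<odot>\<^bsub>M\<^esub> z" "c \<odot>\<^bsub>M\<^esub> b \<in> B" "x \<in> carrier M"
      using assms B M.smult_r_distr by (auto simp: k_subspace_def)
    then show ?thesis using coset_eq[OF assms(2)] assms(3) by blast
  qed
  moreover have "z \<in> B +>\<^bsub>M\<^esub> z" by (rule a_rcos_self) fact
  ultimately show ?thesis by blast
qed

text \<open>Formulated for arbitrary families of record spaces because it is applied both to the
  Hochschild complex and to the total complex of the bicomplex.\<close>

lemma homology_map:
  assumes M: "\<And>n. k_space (M n)" "\<And>n. k_linear (M (n + 1)) (M n) (d (n + 1))"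
    and M': "\<And>n. k_space (M' n)" "\<And>n. k_linear (M' (n + 1)) (M' n) (d' (n + 1))"
    and \<phi>: "\<And>n. k_linear (M n) (M' n) (\<phi> n)"
      "\<And>n z. z \<in> carrier (M (n + 1)) \<Longrightarrow> \<phi> n (d (n + 1) z) = d' (n + 1) (\<phi> (n + 1) z)"
  shows "\<exists>h. k_linear (homology M d n) (homology M' d' n) h \<and> induced_on_homology M d M' d' \<phi> n h"
proof -
  interpret Mn: k_space "M n" by (rule M)
  interpret Mn': k_space "M' n" by (rule M')
  let ?Z = "cycles M d n" and ?B = "boundaries M d n"
  let ?Z' = "cycles M' d' n" and ?B' = "boundaries M' d' n"
  have B: "k_subspace (M n) ?B" unfolding boundaries_def by (rule k_subspace_image[OF M(1) M(1) M(2)])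
  have B': "k_subspace (M' n) ?B'" unfolding boundaries_def by (rule k_subspace_image[OF M'(1) M'(1) M'(2)])
  interpret B: abelian_subgroup ?B "M n" using B by (simp add: k_subspace_def)
  interpret B': abelian_subgroup ?B' "M' n" using B' by (simp add: k_subspace_def)
  have Zc: "z \<in> carrier (M n)" if "z \<in> ?Z" for z using that by (simp add: cycles_def)
  have Z_add: "y \<oplus>\<^bsub>M n\<^esub> z \<in> ?Z" and Z_smult: "c \<odot>\<^bsub>M n\<^esub> z \<in> ?Z" if "y \<in> ?Z" "z \<in> ?Z" for y z c
  proof -
    have "y \<oplus>\<^bsub>M n\<^esub> z \<in> ?Z \<and> c \<odot>\<^bsub>M n\<^esub> z \<in> ?Z"
    proof (cases n)
      case 0
      then show ?thesis using that Mn.add.m_closed Mn.smult_closed by (auto simp: cycles_def)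
    next
      case (Suc m)
      interpret Mm: k_space "M m" by (rule M)
      show ?thesis
        using that k_linear_add[OF M(2)[of m]] k_linear_smult[OF M(2)[of m]] Suc
          Mn.add.m_closed Mn.smult_closed
        by (auto simp: cycles_def Mm.smult_zero)
    qed
    then show "y \<oplus>\<^bsub>M n\<^esub> z \<in> ?Z" "c \<odot>\<^bsub>M n\<^esub> z \<in> ?Z" by auto
  qed
  have \<phi>Z: "\<phi> n z \<in> ?Z'" if "z \<in> ?Z" for z
  proof (cases n)
    case 0
    then show ?thesis using that k_linear_closed[OF \<phi>(1)] by (simp add: cycles_def)
  next
    case (Suc m)
    then show ?thesis
      using that k_linear_closed[OF \<phi>(1)] \<phi>(2)[of z m, symmetric] k_linear_zero[OF M(1) M'(1) \<phi>(1)]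
      by (simp add: cycles_def)
  qed
  have \<phi>c: "\<phi> n z \<in> carrier (M' n)" if "z \<in> ?Z" for z
    using \<phi>Z[OF that] by (simp add: cycles_def)
  have \<phi>B: "\<phi> n b \<in> ?B'" if b: "b \<in> ?B" for b
  proof -
    obtain y where y: "y \<in> carrier (M (n + 1))" "b = d (n + 1) y"
      using b unfolding boundaries_def by blast
    then have "\<phi> n b = d' (n + 1) (\<phi> (n + 1) y)" by (simp only: \<phi>(2))
    then show ?thesis
      unfolding boundaries_def using k_linear_closed[OF \<phi>(1) y(1)] by blast
  qed
  have well: "?B' +>\<^bsub>M' n\<^esub> \<phi> n y = ?B' +>\<^bsub>M' n\<^esub> \<phi> n z"
    if yz: "y \<in> ?Z" "z \<in> ?Z" "?B +>\<^bsub>M n\<^esub> y = ?B +>\<^bsub>M n\<^esub> z" for y z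
  proof -
    obtain b where "b \<in> ?B" "y = b \<oplus>\<^bsub>M n\<^esub> z"
      using coset_eq[OF B Zc[OF yz(1)] Zc[OF yz(2)]] yz(3) by blast
    then have "\<phi> n y = \<phi> n b \<oplus>\<^bsub>M' n\<^esub> \<phi> n z"
      using k_linear_add[OF \<phi>(1), of b n z] Zc[OF yz(2)] B.a_Hcarr by blast
    then show ?thesis
      using coset_eq[OF B' \<phi>c[OF yz(1)] \<phi>c[OF yz(2)]] \<phi>B[OF \<open>b \<in> ?B\<close>] by blast
  qed
  \<comment> \<open>On a coset, \<open>h\<close> picks some cycle representing it;
    \<open>well\<close> makes the choice immaterial.\<close>
  define h where "h X = ?B' +>\<^bsub>M' n\<^esub> \<phi> n (SOME z. z \<in> ?Z \<and> ?B +>\<^bsub>M n\<^esub> z = X)" for X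
  have h: "h (?B +>\<^bsub>M n\<^esub> z) = ?B' +>\<^bsub>M' n\<^esub> \<phi> n z" if "z \<in> ?Z" for z
  proof -
    have "\<exists>y. y \<in> ?Z \<and> ?B +>\<^bsub>M n\<^esub> y = ?B +>\<^bsub>M n\<^esub> z" using that by blast
    from someI_ex[OF this] show ?thesis unfolding h_def using well that by blast
  qed
  have "k_linear (homology M d n) (homology M' d' n) h"
    unfolding k_linear_def homology_def subquot_def
    using h \<phi>Z Z_add Z_smult Zc \<phi>c
    by (auto simp: B.a_rcos_sum B'.a_rcos_sum subquot_smult[OF M(1) B] subquot_smult[OF M'(1) B']
        k_linear_add[OF \<phi>(1)] k_linear_smult[OF \<phi>(1)])
  moreover have "induced_on_homology M d M' d' \<phi> n h"
    using h \<phi>Z by (simp add: induced_on_homology_def homology_class_def)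
  ultimately show ?thesis by blast
qed

section \<open>Hochschild and cyclic homology\<close>

locale linear_cyclic_data =
  fixes X :: "('k::field, 'm) cyclic_data"
  assumes k_space: "k_space (cobj X n)"
    and face_linear: "1 \<le> n \<Longrightarrow> i \<le> n \<Longrightarrow> k_linear (cobj X n) (cobj X (n - 1)) (face X n i)"
    and cyc_linear: "k_linear (cobj X n) (cobj X n) (cyc X n)"
begin

lemma hoch_b_linear: "1 \<le> n \<Longrightarrow> k_linear (cobj X n) (cobj X (n - 1)) (hoch_b X n)"
  unfolding hoch_b_def[abs_def]
  by (intro k_space.k_linear_sum k_space.k_linear_scale k_space face_linear) auto

lemma hoch_b'_linear: "1 \<le> n \<Longrightarrow> k_linear (cobj X n) (cobj X (n - 1)) (hoch_b' X n)"
  unfolding hoch_b'_def[abs_def]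
  by (intro k_space.k_linear_sum k_space.k_linear_scale k_space face_linear) auto

lemma signed_cyc_linear: "k_linear (cobj X n) (cobj X n) (signed_cyc X n)"
  unfolding signed_cyc_def[abs_def] by (intro k_space.k_linear_scale k_space cyc_linear)

lemma cyc_norm_linear: "k_linear (cobj X n) (cobj X n) (cyc_norm X n)"
  unfolding cyc_norm_def[abs_def]
  by (intro k_space.k_linear_sum k_space k_linear_funpow signed_cyc_linear)

lemma k_linear_id: "k_linear M M (\<lambda>z. z)"
  by (simp add: k_linear_def)

lemma vert_linear: "k_linear (cobj X (q + 1)) (cobj X q) (bicomplex_vert X p (q + 1))"
  unfolding bicomplex_vert_def[abs_def]
  using hoch_b_linear[of "q + 1"] k_space.k_linear_uminus[OF k_space hoch_b'_linear[of "q + 1"]]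
  by (cases "even p") simp_all

lemma horiz_linear: "k_linear (cobj X q) (cobj X q) (bicomplex_horiz X p q)"
  unfolding bicomplex_horiz_def[abs_def] a_minus_def
  using k_space.k_linear_plus[OF k_space k_linear_id k_space.k_linear_uminus[OF k_space signed_cyc_linear]]
    cyc_norm_linear
  by (cases "even p") simp_all

lemma k_space_tot_mod: "k_space (tot_mod X n)"
proof -
  note c = k_space.axioms(1)[OF k_space]
  note [simp] = tot_mod_def
  have "abelian_group (tot_mod X n)"
  proof (rule abelian_groupI)
    fix x assume "x \<in> carrier (tot_mod X n)"
    then show "\<exists>y\<in>carrier (tot_mod X n). y \<oplus>\<^bsub>tot_mod X n\<^esub> x = \<zero>\<^bsub>tot_mod X n\<^esub>"
      by (intro bexI[of _ "\<lambda>q\<in>{..n}. \<ominus>\<^bsub>cobj X q\<^esub> x q"])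
        (auto simp: PiE_iff abelian_group.l_neg[OF c] abelian_group.a_inv_closed[OF c] intro!: restrict_ext)
  next
    fix x assume "x \<in> carrier (tot_mod X n)"
    then show "\<zero>\<^bsub>tot_mod X n\<^esub> \<oplus>\<^bsub>tot_mod X n\<^esub> x = x"
      by (intro extensionalityI[of _ "{..n}"])
        (auto simp: PiE_iff abelian_monoid.l_zero[OF abelian_group.axioms(1)[OF c]])
  qed (auto simp: PiE_iff abelian_monoid.a_closed[OF abelian_group.axioms(1)[OF c]]
      abelian_monoid.a_assoc[OF abelian_group.axioms(1)[OF c]]
      abelian_monoid.a_comm[OF abelian_group.axioms(1)[OF c]]
      abelian_monoid.a_lcomm[OF abelian_group.axioms(1)[OF c]]
      abelian_monoid.zero_closed[OF abelian_group.axioms(1)[OF c]] intro!: restrict_ext)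
  moreover have "k_space_axioms (tot_mod X n)"
    by unfold_locales
      (auto simp: PiE_iff k_space.smult_closed[OF k_space] k_space.smult_r_distr[OF k_space]
        k_space.smult_assoc[OF k_space] intro!: restrict_ext)
  ultimately show ?thesis by (rule k_space.intro)
qed

lemma tot_proj_linear: "q \<le> n \<Longrightarrow> k_linear (tot_mod X n) (cobj X q) (\<lambda>z. z q)"
  by (auto simp: k_linear_def tot_mod_def)

text \<open>The total space is a finite product, so linearity into it is checked on components; both
  \<open>tot_d\<close> and \<open>tot_map\<close> are given by components.\<close>

lemma tot_linearI:
  "(\<And>q. q \<le> n \<Longrightarrow> k_linear L (cobj X q) (g q)) \<Longrightarrow> k_linear L (tot_mod X n) (\<lambda>z. \<lambda>q\<in>{..n}. g q z)"
  by (auto simp: k_linear_def tot_mod_def Pi_iff intro!: restrict_ext)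

lemma tot_d_linear: "k_linear (tot_mod X (n + 1)) (tot_mod X n) (tot_d X (n + 1))"
  unfolding tot_d_def[abs_def] add_diff_cancel_right'
  by (intro tot_linearI k_space.k_linear_plus k_space k_linear_comp[OF tot_proj_linear vert_linear]
      k_linear_comp[OF tot_proj_linear horiz_linear]) auto

end

locale cyclic_morphism = X: linear_cyclic_data X + Y: linear_cyclic_data Y
  for X :: "('k::field, 'm) cyclic_data" and Y :: "('k, 'n) cyclic_data" +
  fixes f :: "nat \<Rightarrow> 'm \<Rightarrow> 'n"
  assumes morphism: "cyclic_module_morphism X Y f"
begin

lemma linear: "k_linear (cobj X n) (cobj Y n) (f n)"
  using morphism unfolding cyclic_module_morphism_def by blast

lemma face: "z \<in> carrier (cobj X n) \<Longrightarrow> 1 \<le> n \<Longrightarrow> i \<le> n \<Longrightarrow> f (n - 1) (face X n i z) = face Y n i (f n z)"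
  and cyc: "z \<in> carrier (cobj X n) \<Longrightarrow> f n (cyc X n z) = cyc Y n (f n z)"
  using morphism unfolding cyclic_module_morphism_def by blast+

lemmas smult = k_linear_smult[OF linear]

lemma hoch_b:
  assumes "z \<in> carrier (cobj X n)" "1 \<le> n"
  shows "f (n - 1) (hoch_b X n z) = hoch_b Y n (f n z)" "f (n - 1) (hoch_b' X n z) = hoch_b' Y n (f n z)"
proof -
  interpret N: k_space "cobj Y (n - 1)" by (rule Y.k_space)
  have c: "face X n i z \<in> carrier (cobj X (n - 1))" if "i \<le> n" for i
    using k_linear_closed[OF X.face_linear] that assms by blast
  have c': "face Y n i (f n z) \<in> carrier (cobj Y (n - 1))" if "i \<le> n" for i
    using k_linear_closed[OF Y.face_linear] k_linear_closed[OF linear] that assms by blast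
  \<comment> \<open>One computation serves both differentials: \<open>I\<close> is
    \<open>{..n}\<close> for b and \<open>{..<n}\<close> for b'.\<close>
  have "f (n - 1) (\<Oplus>\<^bsub>cobj X (n - 1)\<^esub>i\<in>I. (- 1) ^ i \<odot>\<^bsub>cobj X (n - 1)\<^esub> face X n i z)
      = (\<Oplus>\<^bsub>cobj Y (n - 1)\<^esub>i\<in>I. (- 1) ^ i \<odot>\<^bsub>cobj Y (n - 1)\<^esub> face Y n i (f n z))"
    if "I \<subseteq> {..n}" for I
  proof -
    have I: "i \<le> n" if "i \<in> I" for i using that \<open>I \<subseteq> {..n}\<close> by auto
    have "f (n - 1) (\<Oplus>\<^bsub>cobj X (n - 1)\<^esub>i\<in>I. (- 1) ^ i \<odot>\<^bsub>cobj X (n - 1)\<^esub> face X n i z)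
        = (\<Oplus>\<^bsub>cobj Y (n - 1)\<^esub>i\<in>I. f (n - 1) ((- 1) ^ i \<odot>\<^bsub>cobj X (n - 1)\<^esub> face X n i z))"
      by (rule k_linear_finsum[OF X.k_space Y.k_space linear])
        (use c I k_space.smult_closed[OF X.k_space] in blast)
    also have "\<dots> = (\<Oplus>\<^bsub>cobj Y (n - 1)\<^esub>i\<in>I. (- 1) ^ i \<odot>\<^bsub>cobj Y (n - 1)\<^esub> face Y n i (f n z))"
      by (rule N.finsum_cong) (use assms in \<open>auto simp: c c' I smult face simp_implies_def simp del: One_nat_def\<close>)
    finally show ?thesis .
  qed
  note sum = this
  have "{..<n} \<subseteq> {..n}" by auto
  from sum[of "{..n}"] sum[OF this]
  show "f (n - 1) (hoch_b X n z) = hoch_b Y n (f n z)" "f (n - 1) (hoch_b' X n z) = hoch_b' Y n (f n z)"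
    by (auto simp: hoch_b_def hoch_b'_def)
qed

lemma signed_cyc: "z \<in> carrier (cobj X n) \<Longrightarrow> f n (signed_cyc X n z) = signed_cyc Y n (f n z)"
  using k_linear_closed[OF X.cyc_linear] by (simp add: signed_cyc_def smult cyc)

lemma cyc_norm:
  assumes "z \<in> carrier (cobj X n)"
  shows "f n (cyc_norm X n z) = cyc_norm Y n (f n z)"
proof -
  interpret N: k_space "cobj Y n" by (rule Y.k_space)
  have c: "(signed_cyc X n ^^ i) z \<in> carrier (cobj X n)" for i
    using k_linear_closed[OF k_linear_funpow[OF X.signed_cyc_linear]] assms by blast
  have c': "(signed_cyc Y n ^^ i) (f n z) \<in> carrier (cobj Y n)" for i
    using k_linear_closed[OF k_linear_funpow[OF Y.signed_cyc_linear]] k_linear_closed[OF linear] assms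
    by blast
  have pow: "f n ((signed_cyc X n ^^ i) z) = (signed_cyc Y n ^^ i) (f n z)" for i
    using c by (induction i) (simp_all add: signed_cyc)
  show ?thesis
    unfolding cyc_norm_def using c c'
    by (subst k_linear_finsum[OF X.k_space Y.k_space linear])
      (auto intro!: N.finsum_cong simp: pow simp_implies_def)
qed

lemma vert:
  assumes "z \<in> carrier (cobj X (q + 1))"
  shows "f q (bicomplex_vert X p (q + 1) z) = bicomplex_vert Y p (q + 1) (f (q + 1) z)"
proof -
  have "hoch_b' X (q + 1) z \<in> carrier (cobj X q)"
    using k_linear_closed[OF X.hoch_b'_linear[of "q + 1"]] assms by simp
  then show ?thesis
    using hoch_b[OF assms] k_linear_a_inv[OF X.k_space Y.k_space linear]
    by (simp add: bicomplex_vert_def)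
qed

lemma horiz:
  assumes "z \<in> carrier (cobj X q)"
  shows "f q (bicomplex_horiz X p q z) = bicomplex_horiz Y p q (f q z)"
proof -
  interpret M: k_space "cobj X q" by (rule X.k_space)
  have c: "signed_cyc X q z \<in> carrier (cobj X q)"
    by (rule k_linear_closed[OF X.signed_cyc_linear assms])
  then have "f q (z \<ominus>\<^bsub>cobj X q\<^esub> signed_cyc X q z) = f q z \<ominus>\<^bsub>cobj Y q\<^esub> signed_cyc Y q (f q z)"
    using assms k_linear_a_inv[OF X.k_space Y.k_space linear c]
    by (simp add: a_minus_def k_linear_add[OF linear] signed_cyc)
  then show ?thesis using cyc_norm[OF assms] by (simp add: bicomplex_horiz_def)
qed

lemma tot_map_linear: "k_linear (tot_mod X n) (tot_mod Y n) (tot_map f n)"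
  unfolding tot_map_def[abs_def]
  by (intro Y.tot_linearI k_linear_comp[OF X.tot_proj_linear linear])

lemma tot_d:
  assumes "z \<in> carrier (tot_mod X (n + 1))"
  shows "tot_map f n (tot_d X (n + 1) z) = tot_d Y (n + 1) (tot_map f (n + 1) z)"
proof -
  have "f q (bicomplex_vert X (n + 1 - (q + 1)) (q + 1) (z (q + 1))
        \<oplus>\<^bsub>cobj X q\<^esub> bicomplex_horiz X (n + 1 - q) q (z q))
      = bicomplex_vert Y (n + 1 - (q + 1)) (q + 1) (f (q + 1) (z (q + 1)))
        \<oplus>\<^bsub>cobj Y q\<^esub> bicomplex_horiz Y (n + 1 - q) q (f q (z q))" if "q \<le> n" for q
  proof -
    have z: "z (q + 1) \<in> carrier (cobj X (q + 1))" "z q \<in> carrier (cobj X q)"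
      using that by (auto intro!: k_linear_closed[OF X.tot_proj_linear[of _ "n + 1"] assms])
    show ?thesis
      using k_linear_closed[OF X.vert_linear z(1)] k_linear_closed[OF X.horiz_linear z(2)]
      by (simp only: k_linear_add[OF linear] vert[OF z(1)] horiz[OF z(2)])
  qed
  then show ?thesis by (auto simp: tot_map_def tot_d_def intro!: restrict_ext)
qed

lemma HH_map:
  "\<exists>h. k_linear (HH X n) (HH Y n) h \<and>
     induced_on_homology (cobj X) (hoch_b X) (cobj Y) (hoch_b Y) f n h"
  unfolding HH_def
proof (rule homology_map)
  fix n
  show "k_linear (cobj X (n + 1)) (cobj X n) (hoch_b X (n + 1))"
    "k_linear (cobj Y (n + 1)) (cobj Y n) (hoch_b Y (n + 1))"
    using X.hoch_b_linear[of "n + 1"] Y.hoch_b_linear[of "n + 1"] by simp_all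
  show "f n (hoch_b X (n + 1) z) = hoch_b Y (n + 1) (f (n + 1) z)"
    if "z \<in> carrier (cobj X (n + 1))" for z
    using hoch_b(1)[OF that] by simp
qed (rule X.k_space Y.k_space linear)+

lemma HC_map:
  "\<exists>h. k_linear (HC X n) (HC Y n) h \<and>
     induced_on_homology (tot_mod X) (tot_d X) (tot_mod Y) (tot_d Y) (tot_map f) n h"
  unfolding HC_def
proof (rule homology_map[of "tot_mod X" "tot_d X" "tot_mod Y" "tot_d Y" "tot_map f"])
  show "tot_map f n (tot_d X (n + 1) z) = tot_d Y (n + 1) (tot_map f (n + 1) z)"
    if "z \<in> carrier (tot_mod X (n + 1))" for n z
    by (rule tot_d[OF that])
qed (rule X.k_space_tot_mod Y.k_space_tot_mod X.tot_d_linear Y.tot_d_linear tot_map_linear)+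

end

section \<open>The cyclic module of a Hopf algebroid and the morphism given by a measuring\<close>

context hopf
begin

lemma cyclic_module_simps:
  "cobj (cyclic_module_of H) = tensR H"
  "face (cyclic_module_of H) n i = descend (relsR H (n - 1)) (face_gen H n i)"
  "degen (cyclic_module_of H) n i = descend (relsR H (n + 1)) (degen_gen H i)"
  "cyc (cyclic_module_of H) n = descend (relsR H n) (cyc_gen H)"
  by (simp_all add: cyclic_module_of_def)

lemma linear_cyclic_data: "linear_cyclic_data (cyclic_module_of H)"
proof (rule linear_cyclic_data.intro)
  show "k_space (cobj (cyclic_module_of H) n)" for n
    unfolding cyclic_module_simps tensR_def by (rule k_space_tensor_power)
  show "k_linear (cobj (cyclic_module_of H) n) (cobj (cyclic_module_of H) (n - 1)) (face (cyclic_module_of H) n i)"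
    if "1 \<le> n" "i \<le> n" for n i
    unfolding cyclic_module_simps tensR_def relsR_def
    by (intro k_linear_descend balA_face keys_face_gen that)
  show "k_linear (cobj (cyclic_module_of H) n) (cobj (cyclic_module_of H) n) (cyc (cyclic_module_of H) n)" for n
    unfolding cyclic_module_simps tensR_def relsR_def
    by (intro k_linear_descend balA_cyc keys_cyc_gen)
qed

end

context hopf_measuring
begin

lemma measured_chain_class:
  "measured_chain C H' \<Psi> \<psi> x n (classR H n z) = classR H' n (lin_ext fscale (mgen x) z)"
  unfolding measured_chain_def classR_def relsR_def by (rule descend_tensor_class[OF balA_mgen])

lemma measured_chain_morphism:
  "cyclic_module_morphism (cyclic_module_of H) (cyclic_module_of H') (measured_chain C H' \<Psi> \<psi> x)"
  unfolding cyclic_module_morphism_def H.cyclic_module_simps H'.cyclic_module_simps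
    tensR_def relsR_def measured_chain_def
proof (intro conjI allI ballI impI, goal_cases)
  \<comment> \<open>The four cases are linearity, faces, degeneracies and the cyclic
    operator.\<close>
  case (1 n)
  have "Poly_Mapping.keys (mgen x g) \<subseteq> tensor_gens n" if "g \<in> tensor_gens n" for g
    using that keys_measured_tensor[of _ C \<Psi> x]
    by (cases g) (fastforce simp: tensor_gens_def split: if_splits)+
  then show ?case by (intro k_linear_descend balA_mgen)
next
  case (2 n i z)
  then show ?case
    by (intro descend_commute[OF H.balA_face H'.balA_face balA_mgen balA_mgen face_mgen]) auto
next
  case (3 n i z)
  then show ?case
    by (intro descend_commute[OF H.balA_degen H'.balA_degen balA_mgen balA_mgen degen_mgen]) auto
next
  case (4 n z)
  then show ?case
    by (intro descend_commute[OF H.balA_cyc H'.balA_cyc balA_mgen balA_mgen cyc_mgen]) auto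
qed

end

theorem proposition3p3:
  fixes H :: "('k::field, 'u::{ring, monoid_mult}, 'a::{ring, monoid_mult}) hopf_algebroid"
    and H' :: "('k, 'v::{ring, monoid_mult}, 'b::{ring, monoid_mult}) hopf_algebroid"
    and C :: "('k, 'c::ab_group_add) coalgebra"
    and \<Psi> :: "'c \<Rightarrow> 'u \<Rightarrow> 'v"
    and \<psi> :: "'c \<Rightarrow> 'a \<Rightarrow> 'b"
    and x :: 'c
  assumes "is_hopf_algebroid H"
    and "is_hopf_algebroid H'"
    and "cocommutative_coalgebra C"
    and "hopf_algebroid_measuring C H H' \<Psi> \<psi>"
  shows "(\<forall>a. measured_chain C H' \<Psi> \<psi> x 0 (classR H 0 (scal a)) = classR H' 0 (scal (\<psi> x a))) \<and>
    (\<forall>us. us \<noteq> [] \<longrightarrow>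
       measured_chain C H' \<Psi> \<psi> x (length us) (classR H (length us) (tens us))
         = classR H' (length us) (measured_tensor C \<Psi> x us)) \<and>
    cyclic_module_morphism (cyclic_module_of H) (cyclic_module_of H') (measured_chain C H' \<Psi> \<psi> x) \<and>
    (\<forall>n. \<exists>h. k_linear (HH (cyclic_module_of H) n) (HH (cyclic_module_of H') n) h \<and>
       induced_on_homology
         (cobj (cyclic_module_of H)) (hoch_b (cyclic_module_of H))
         (cobj (cyclic_module_of H')) (hoch_b (cyclic_module_of H'))
         (measured_chain C H' \<Psi> \<psi> x) n h) \<and>
    (\<forall>n. \<exists>h. k_linear (HC (cyclic_module_of H) n) (HC (cyclic_module_of H') n) h \<and>
       induced_on_homology
         (tot_mod (cyclic_module_of H)) (tot_d (cyclic_module_of H))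
         (tot_mod (cyclic_module_of H')) (tot_d (cyclic_module_of H'))
         (tot_map (measured_chain C H' \<Psi> \<psi> x)) n h)"
proof -
  interpret hopf_measuring H H' C \<Psi> \<psi>
    using assms by unfold_locales
  interpret cyclic_morphism "cyclic_module_of H" "cyclic_module_of H'" "measured_chain C H' \<Psi> \<psi> x"
    by (intro cyclic_morphism.intro H.linear_cyclic_data H'.linear_cyclic_data
        cyclic_morphism_axioms.intro measured_chain_morphism)
  have "measured_chain C H' \<Psi> \<psi> x 0 (classR H 0 (scal a)) = classR H' 0 (scal (\<psi> x a))" for a
    by (simp add: measured_chain_class lin_ext_single[OF vector_space_fscale])
  moreover have "measured_chain C H' \<Psi> \<psi> x (length us) (classR H (length us) (tens us))
         = classR H' (length us) (measured_tensor C \<Psi> x us)" for us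
    by (simp add: measured_chain_class lin_ext_single[OF vector_space_fscale])
  ultimately show ?thesis using measured_chain_morphism HH_map HC_map by blast
qed

end
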